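(* There exist a sequence $(\epsilon_d)_{d\geq 3}$ with $\epsilon_d\in[0,1]$ for all $d\geq 3$ and $\lim_{d\rightarrow\infty}\epsilon_d=0$, and, for each integer $d\geq 3$, an algorithm for the Maximum Weight Independent Set Problem in $d$-claw free graphs that runs in quasi-polynomial time (regarding $d$ as a constant) and achieves an approximation guarantee of $\frac{d-1+\epsilon_d}{2}$. Moreover, on instances that arise as the conflict graph of a (given) instance of the weighted $(d-1)$-Set Packing Problem, the algorithm can be implemented to run in polynomial time.
   Context: For $d\geq 1$, a $d$-claw is a star consisting of a center vertex adjacent to $d$ further vertices (the talons), which are pairwise non-adjacent; a $0$-claw is a single vertex. An undirected graph is $d$-claw free if none of its induced subgraphs is a $d$-claw. The Maximum Weight Independent Set Problem (MWIS) in $d$-claw free graphs: given a finite $d$-claw free graph $G=(V,E)$ and $w:V\rightarrow\mathbb{R}_{>0}$, find an independent set $A^*$ maximizing $w(A^* )=\sum_{v\in A^*}w(v)$. An algorithm achieves approximation guarantee $\rho\geq 1$ if it always returns an independent set $A$ with $w(A^* )\leq\rho\cdot w(A)$ for every optimum $A^*$. Weighted $k$-Set Packing: given a finite collection $\mathcal{S}$ of sets, each of cardinality at most $k$, and $w:\mathcal{S}\rightarrow\mathbb{R}_{>0}$, find a sub-collection of pairwise disjoint sets of maximum total weight. Its conflict graph has vertex set $\mathcal{S}$ and an edge between any two distinct sets with non-empty intersection; it is $(k+1)$-claw free. Quasi-polynomial time means running time $2^{(\log n)^{O(1)}}$ in the input size $n$. *)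

theory Defs
  imports Complex_Main "HOL-Library.Log_Nat" "HOL-Library.Landau_Symbols"
begin

section \<open>Independent sets in claw-free graphs\<close>

definition simple_graph :: "'a set \<Rightarrow> 'a set set \<Rightarrow> bool" where
  "simple_graph V E \<longleftrightarrow> finite V \<and> (\<forall>e\<in>E. e \<subseteq> V \<and> card e = 2)"

definition is_claw :: "nat \<Rightarrow> 'a set \<Rightarrow> 'a set set \<Rightarrow> bool" where
  "is_claw d V E \<longleftrightarrow>
     (\<exists>z T. z \<notin> T \<and> finite T \<and> card T = d \<and> V = insert z T \<and> E = {{z, t} | t. t \<in> T})"

definition induced_edges :: "'a set set \<Rightarrow> 'a set \<Rightarrow> 'a set set" where
  "induced_edges E U = {e \<in> E. e \<subseteq> U}"

definition claw_free :: "nat \<Rightarrow> 'a set \<Rightarrow> 'a set set \<Rightarrow> bool" where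
  "claw_free d V E \<longleftrightarrow> (\<forall>U\<subseteq>V. \<not> is_claw d U (induced_edges E U))"

definition independent_set :: "'a set \<Rightarrow> 'a set set \<Rightarrow> 'a set \<Rightarrow> bool" where
  "independent_set V E A \<longleftrightarrow> A \<subseteq> V \<and> (\<forall>u\<in>A. \<forall>v\<in>A. {u, v} \<notin> E)"

definition max_weight_independent_set ::
    "'a set \<Rightarrow> 'a set set \<Rightarrow> ('a \<Rightarrow> real) \<Rightarrow> 'a set \<Rightarrow> bool" where
  "max_weight_independent_set V E w A \<longleftrightarrow>
     independent_set V E A \<and> (\<forall>B. independent_set V E B \<longrightarrow> sum w B \<le> sum w A)"

definition approx_independent_set ::
    "real \<Rightarrow> 'a set \<Rightarrow> 'a set set \<Rightarrow> ('a \<Rightarrow> real) \<Rightarrow> 'a set \<Rightarrow> bool" where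
  "approx_independent_set \<rho> V E w A \<longleftrightarrow>
     independent_set V E A \<and>
     (\<forall>B. max_weight_independent_set V E w B \<longrightarrow> sum w B \<le> \<rho> * sum w A)"

definition conflict_edges :: "'a set set \<Rightarrow> 'a set set set" where
  "conflict_edges S = {{s, t} | s t. s \<in> S \<and> t \<in> S \<and> s \<noteq> t \<and> s \<inter> t \<noteq> {}}"


section \<open>Algorithms\<close>

text \<open>
  The model of computation is a two-sorted random access machine, programmed in a while language.
  One memory holds natural numbers, the other one real numbers; a memory cell is addressed
  by a name and a list of computed indices, so that \<open>(x, [])\<close> is a variable, \<open>(x, [i])\<close> an array
  entry, \<open>(x, [i, j])\<close> a matrix entry.

  Every assignment and every test costs one unit. (The expressions occurring in a program have
  fixed size, so this agrees with counting single operations up to a constant factor.)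
  There is deliberately no multiplication, division or rounding among the primitives and there
  are no real constants other than natural numbers: after \<open>t\<close> steps, every natural number has
  bit length bounded by that of the input plus \<open>O(t)\<close>, and every real number is an
  integer linear combination of 1 and the input weights, with coefficients of bit length
  bounded in the same way. Hence unit costs cannot be exploited, and on rational weights a run of
  \<open>t\<close> steps can be simulated by a Turing machine in time polynomial in \<open>t\<close> and the bit length of
  the input; arbitrary real weights are nevertheless admitted as inputs.
\<close>

datatype nexp =
    NConst nat
  | NGet string "nexp list"
  | NPlus nexp nexp
  | NMinus nexp nexp

datatype rexp =
    RNat nexp
  | RGet string "nexp list"
  | RPlus rexp rexp
  | RMinus rexp rexp

datatype bexp =
    NLess nexp nexp
  | RLess rexp rexp
  | Neg bexp
  | Conj bexp bexp

datatype com =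
    Skip
  | NSet string "nexp list" nexp
  | RSet string "nexp list" rexp
  | Seq com com
  | Cond bexp com com
  | While bexp com

record state =
  nmem :: "string \<Rightarrow> nat list \<Rightarrow> nat"
  rmem :: "string \<Rightarrow> nat list \<Rightarrow> real"

primrec neval :: "state \<Rightarrow> nexp \<Rightarrow> nat" where
  "neval \<sigma> (NConst n) = n"
| "neval \<sigma> (NGet x es) = nmem \<sigma> x (map (neval \<sigma>) es)"
| "neval \<sigma> (NPlus a b) = neval \<sigma> a + neval \<sigma> b"
| "neval \<sigma> (NMinus a b) = neval \<sigma> a - neval \<sigma> b"

primrec reval :: "state \<Rightarrow> rexp \<Rightarrow> real" where
  "reval \<sigma> (RNat a) = real (neval \<sigma> a)"
| "reval \<sigma> (RGet x es) = rmem \<sigma> x (map (neval \<sigma>) es)"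
| "reval \<sigma> (RPlus a b) = reval \<sigma> a + reval \<sigma> b"
| "reval \<sigma> (RMinus a b) = reval \<sigma> a - reval \<sigma> b"

primrec beval :: "state \<Rightarrow> bexp \<Rightarrow> bool" where
  "beval \<sigma> (NLess a b) \<longleftrightarrow> neval \<sigma> a < neval \<sigma> b"
| "beval \<sigma> (RLess a b) \<longleftrightarrow> reval \<sigma> a < reval \<sigma> b"
| "beval \<sigma> (Neg b) \<longleftrightarrow> \<not> beval \<sigma> b"
| "beval \<sigma> (Conj a b) \<longleftrightarrow> beval \<sigma> a \<and> beval \<sigma> b"

definition upd :: "('a \<Rightarrow> 'b \<Rightarrow> 'c) \<Rightarrow> 'a \<Rightarrow> 'b \<Rightarrow> 'c \<Rightarrow> ('a \<Rightarrow> 'b \<Rightarrow> 'c)" where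
  "upd m x i v = m(x := (m x)(i := v))"

text \<open>\<open>exec c \<sigma> t \<tau>\<close>: started in \<open>\<sigma>\<close>, the program \<open>c\<close> halts after time \<open>t\<close> in state \<open>\<tau>\<close>.\<close>

inductive exec :: "com \<Rightarrow> state \<Rightarrow> nat \<Rightarrow> state \<Rightarrow> bool" where
  Skip: "exec Skip \<sigma> 1 \<sigma>"
| NSet: "exec (NSet x es a) \<sigma> 1
           (\<sigma>\<lparr>nmem := upd (nmem \<sigma>) x (map (neval \<sigma>) es) (neval \<sigma> a)\<rparr>)"
| RSet: "exec (RSet x es a) \<sigma> 1
           (\<sigma>\<lparr>rmem := upd (rmem \<sigma>) x (map (neval \<sigma>) es) (reval \<sigma> a)\<rparr>)"
| Seq: "exec c1 \<sigma> t1 \<sigma>' \<Longrightarrow> exec c2 \<sigma>' t2 \<sigma>'' \<Longrightarrow> exec (Seq c1 c2) \<sigma> (t1 + t2) \<sigma>''"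
| CondTrue: "beval \<sigma> b \<Longrightarrow> exec c1 \<sigma> t \<sigma>' \<Longrightarrow> exec (Cond b c1 c2) \<sigma> (1 + t) \<sigma>'"
| CondFalse: "\<not> beval \<sigma> b \<Longrightarrow> exec c2 \<sigma> t \<sigma>' \<Longrightarrow> exec (Cond b c1 c2) \<sigma> (1 + t) \<sigma>'"
| WhileFalse: "\<not> beval \<sigma> b \<Longrightarrow> exec (While b c) \<sigma> 1 \<sigma>"
| WhileTrue: "beval \<sigma> b \<Longrightarrow> exec c \<sigma> t1 \<sigma>' \<Longrightarrow> exec (While b c) \<sigma>' t2 \<sigma>'' \<Longrightarrow>
              exec (While b c) \<sigma> (1 + t1 + t2) \<sigma>''"

inductive_cases exec_SkipE: "exec Skip \<sigma> t \<tau>"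
inductive_cases exec_NSetE: "exec (NSet x es a) \<sigma> t \<tau>"
inductive_cases exec_RSetE: "exec (RSet x es a) \<sigma> t \<tau>"
inductive_cases exec_SeqE: "exec (Seq c1 c2) \<sigma> t \<tau>"
inductive_cases exec_CondE: "exec (Cond b c1 c2) \<sigma> t \<tau>"
inductive_cases exec_WhileE: "exec (While b c) \<sigma> t \<tau>"

lemma exec_deterministic:
  "exec c \<sigma> t \<tau> \<Longrightarrow> exec c \<sigma> t' \<tau>' \<Longrightarrow> t' = t \<and> \<tau>' = \<tau>"
proof (induction arbitrary: t' \<tau>' rule: exec.induct)
  case (Skip \<sigma>)
  then show ?case by (rule exec_SkipE) simp
next
  case (NSet x es a \<sigma>)
  then show ?case by (rule exec_NSetE) simp
next
  case (RSet x es a \<sigma>)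
  then show ?case by (rule exec_RSetE) simp
next
  case (Seq c1 \<sigma> t1 \<sigma>' c2 t2 \<sigma>'')
  from Seq.prems show ?case
    by (rule exec_SeqE) (metis Seq.IH)
next
  case (CondTrue \<sigma> b c1 t \<sigma>' c2)
  from CondTrue.prems show ?case
    by (rule exec_CondE) (use CondTrue.IH CondTrue.hyps(1) in \<open>fastforce+\<close>)
next
  case (CondFalse \<sigma> b c2 t \<sigma>' c1)
  from CondFalse.prems show ?case
    by (rule exec_CondE) (use CondFalse.IH CondFalse.hyps(1) in \<open>fastforce+\<close>)
next
  case (WhileFalse \<sigma> b c)
  from WhileFalse.prems show ?case
    by (rule exec_WhileE) (use WhileFalse.hyps in simp_all)
next
  case (WhileTrue \<sigma> b c t1 \<sigma>' t2 \<sigma>'')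
  from WhileTrue.prems show ?case
    by (rule exec_WhileE) (use WhileTrue.IH WhileTrue.hyps(1) in \<open>fastforce+\<close>)
qed

definition polynomial_bound :: "(nat \<Rightarrow> nat) \<Rightarrow> bool" where
  "polynomial_bound T \<longleftrightarrow> (\<exists>k::nat. (\<lambda>n. real (T n)) \<in> O(\<lambda>n. real n ^ k))"

definition quasi_polynomial_bound :: "(nat \<Rightarrow> nat) \<Rightarrow> bool" where
  "quasi_polynomial_bound T \<longleftrightarrow>
     (\<exists>k::nat. \<forall>\<^sub>F n in sequentially. real (T n) \<le> 2 powr (log 2 (real n) ^ k))"


section \<open>Inputs and outputs\<close>

text \<open>
  The vertices are numbered by a list \<open>vs\<close> without repetitions, and programs refer to
  a vertex by its position in that list. A weight, being one real number, has size one.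
\<close>

definition graph_input :: "'a list \<Rightarrow> 'a set set \<Rightarrow> ('a \<Rightarrow> real) \<Rightarrow> state" where
  "graph_input vs E w =
     \<lparr>nmem = (\<lambda>x is.
        if x = ''n'' \<and> is = [] then length vs
        else if x = ''adj'' \<and> (\<exists>i j. is = [i, j] \<and> i < length vs \<and> j < length vs \<and>
                                   {vs ! i, vs ! j} \<in> E) then 1
        else 0),
      rmem = (\<lambda>x is. case is of [i] \<Rightarrow> if x = ''w'' \<and> i < length vs then w (vs ! i) else 0
                              | _ \<Rightarrow> 0)\<rparr>"

definition graph_size :: "'a set \<Rightarrow> 'a set set \<Rightarrow> nat" where
  "graph_size V E = card V + card E"

text \<open>
  A set packing instance is presented as a list of lists, each of which lists
  the elements of one set of the collection.
\<close>

definition packing_input :: "nat list list \<Rightarrow> (nat set \<Rightarrow> real) \<Rightarrow> state" where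
  "packing_input xss w =
     \<lparr>nmem = (\<lambda>x is. case is of
          [] \<Rightarrow> if x = ''n'' then length xss else 0
        | [i] \<Rightarrow> if x = ''card'' \<and> i < length xss then length (xss ! i) else 0
        | [i, j] \<Rightarrow> if x = ''elem'' \<and> i < length xss \<and> j < length (xss ! i) then xss ! i ! j else 0
        | _ \<Rightarrow> 0),
      rmem = (\<lambda>x is. case is of [i] \<Rightarrow> if x = ''w'' \<and> i < length xss then w (set (xss ! i)) else 0
                              | _ \<Rightarrow> 0)\<rparr>"

definition packing_size :: "nat list list \<Rightarrow> nat" where
  "packing_size xss = (\<Sum>xs\<leftarrow>xss. 1 + (\<Sum>x\<leftarrow>xs. 1 + floorlog 2 x))"

definition selected :: "'a list \<Rightarrow> state \<Rightarrow> 'a set" where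
  "selected vs \<tau> = {vs ! i | i. i < length vs \<and> nmem \<tau> ''out'' [i] \<noteq> 0}"

definition approximates_MWIS_claw_free :: "com \<Rightarrow> (nat \<Rightarrow> nat) \<Rightarrow> nat \<Rightarrow> real \<Rightarrow> bool" where
  "approximates_MWIS_claw_free c T d \<rho> \<longleftrightarrow>
     (\<forall>(vs :: nat list) E w.
        distinct vs \<and> simple_graph (set vs) E \<and> claw_free d (set vs) E \<and> (\<forall>v\<in>set vs. w v > 0) \<longrightarrow>
        (\<exists>t \<tau>. exec c (graph_input vs E w) t \<tau> \<and> t \<le> T (graph_size (set vs) E) \<and>
               approx_independent_set \<rho> (set vs) E w (selected vs \<tau>)))"

definition approximates_MWIS_conflict_graph :: "com \<Rightarrow> (nat \<Rightarrow> nat) \<Rightarrow> nat \<Rightarrow> real \<Rightarrow> bool" where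
  "approximates_MWIS_conflict_graph c T k \<rho> \<longleftrightarrow>
     (\<forall>xss S w.
        (\<forall>xs\<in>set xss. distinct xs) \<and> distinct (map set xss) \<and> S = set (map set xss) \<and>
        (\<forall>s\<in>S. card s \<le> k) \<and> (\<forall>s\<in>S. w s > 0) \<longrightarrow>
        (\<exists>t \<tau>. exec c (packing_input xss w) t \<tau> \<and> t \<le> T (packing_size xss) \<and>
               approx_independent_set \<rho> S (conflict_edges S) w (selected (map set xss) \<tau>)))"

end

theory Submission
  imports Defs
begin

text \<open>
  Already local search with improvements of constant size works. Guess the heaviest vertex \<open>g\<close>
  of an optimum, round the weights of the vertices that are no heavier than \<open>g\<close> and not adjacent to it
  to multiples of \<open>w g / (2n)\<close>, and exchange as long as some set of at most \<open>k + k\<^sup>2\<close> vertices, where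
  \<open>k = d - 1\<close>, has a larger sum of squared weights than its neighbours in the current solution \<open>A\<close>.

  For \<open>u\<close> in another independent set \<open>B\<close>, the charge \<open>w u - w (N u) / 2\<close> is what \<open>u\<close> contributes
  beyond \<open>k/2 * w A\<close>. Berman's argument, which considers the vertices \<open>u\<close> with the same heaviest
  neighbour \<open>a\<close>, bounds their total charge by \<open>w a / 2\<close>, hence the ratio \<open>(k + 1) / 2\<close>. If the ratio exceeds
  \<open>k/2\<close>, then the vertices of \<open>A\<close> have almost \<open>k\<close> neighbours in \<open>B\<close> on average, most of which look like an
  edge between two vertices of \<open>A\<close> of nearly the same weight. A vertex \<open>a\<close> is good if its total charge is
  at least \<open>e * w a\<close>. A star of more than \<open>2/e\<close> such edges from one center to good
  vertices, together with the talons of these, would be an improvement. As there are about \<open>k\<close>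
  edges at every good vertex, the good vertices make up a fraction \<open>O(1/(e\<^sup>2 k))\<close> of the weight of \<open>A\<close>.
\<close>

section \<open>Local optima of the squared weight\<close>

text \<open>The exponent 1/3 and the constant 152 balance two errors. Vertices that are not good
  have charge at most \<open>e * w a\<close>; the good ones, a fraction of at most
  \<open>150 / (e\<^sup>2 * k)\<close> of the weight, may have charge \<open>w a / 2\<close>. For
  \<open>e = k powr (-1/3)\<close> this adds up to \<open>e + 75 * e\<close>, half of
  \<open>152 * e\<close>. Where \<open>152 * e\<close> exceeds 1, Berman's bound is used instead;
  hence the minimum with 1.

  The size \<open>k + k\<^sup>2\<close> depends on \<open>d\<close> alone, so all candidate sets can
  be tried in polynomial time, in every claw-free graph and not only in conflict graphs; the
  quasi-polynomial bound is a weakening of this.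

  Two obstacles shape the algorithm. Real weights offer no polynomial bound on the number of
  exchanges; after rounding, the weights are integers up to \<open>2 * n\<close>, and every exchange
  raises an integer potential that never exceeds \<open>n * (2 * n)\<^sup>2\<close>. And the machine
  can neither multiply nor divide, so quotients and squares are found by repeated addition, which is
  affordable for numbers of this size.\<close>

text \<open>Scale-free form of the claim that a small loss makes \<open>u\<close> look like an edge:
  the heaviest neighbour has weight 1, \<open>M\<close> holds the other neighbours with relative
  weights \<open>f\<close>, and \<open>t\<close> stands for \<open>y u\<close>. Small terms
  \<open>(1 - f a) * f a\<close> push each \<open>f a\<close> towards 0 or 1, and \<open>t\<close>
  near 1 with \<open>2 * t - 1\<close> near \<open>sum f M\<close> leaves room for exactly one value
  near 1.\<close>

lemma nearly_tight_neighbourhood: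
  fixes f :: "'a \<Rightarrow> real" and t e :: real
  assumes fin: "finite M" and f01: "\<And>a. a \<in> M \<Longrightarrow> 0 < f a \<and> f a \<le> 1"
    and t: "t > 0" and e: "0 < e" "e \<le> 1/2"
    and small: "\<bar>2 * t - 1 - sum f M\<bar> + (t - 1)\<^sup>2 + (\<Sum>a\<in>M. (1 - f a) * f a)
                  < e\<^sup>2 / 48 * (1 + sum f M)"
    and m: "M \<noteq> {} \<Longrightarrow> m \<in> M \<and> (\<forall>a\<in>M. f a \<le> f m)"
  shows "M \<noteq> {}" "1 - e \<le> (f m)\<^sup>2" "1 - e \<le> t\<^sup>2 - (\<Sum>a\<in>M - {m}. (f a)\<^sup>2)"
    "sum f (M - {m}) \<le> 2 * (\<Sum>a\<in>M. (1 - f a) * f a)"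
proof -
  \<comment> \<open>The final errors \<open>2 * h + 9 * h\<^sup>2\<close> stay below
    \<open>4 * h = e\<close>. The bound in \<open>small\<close> becomes
    \<open>h\<^sup>2 / 3 * (1 + S)\<close>, where the 3 will cancel against
    \<open>1 + S \<le> 3\<close>.\<close>
  define h where "h = e / 4"
  define S where "S = sum f M"
  define Q where "Q = (\<Sum>a\<in>M. (1 - f a) * f a)"
  have h: "0 < h" "h \<le> 1/8" using e by (auto simp: h_def)
  have S0: "S \<ge> 0" unfolding S_def using f01 by (intro sum_nonneg) (auto simp: less_imp_le)
  have Q0: "Q \<ge> 0" unfolding Q_def using f01 by (intro sum_nonneg) (auto simp: less_imp_le)
  have hh: "h\<^sup>2 \<le> 1/64"
    using power_mono[OF h(2), of 2] h by (simp add: power2_eq_square)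
  have k: "e\<^sup>2 / 48 = h\<^sup>2 / 3" by (simp add: h_def power2_eq_square)
  have sm: "\<bar>2 * t - 1 - S\<bar> + (t - 1)\<^sup>2 + Q < h\<^sup>2 / 3 * (1 + S)"
    using small unfolding k S_def Q_def .
  have le: "h\<^sup>2 / 3 * (1 + S) \<le> 1/192 * (1 + S)"
    using hh S0 by (intro mult_right_mono) auto
  have sq0: "(t - 1)\<^sup>2 \<ge> 0" by simp
  have a1: "191/192 * (1 + S) \<le> 2 * t" using sm le Q0 sq0 by argo
  have a2: "(t - 1)\<^sup>2 \<le> 1/192 * (1 + S)" using sm le Q0 by argo
  \<comment> \<open>By \<open>a1\<close> and \<open>a2\<close>, \<open>(t - 1)\<^sup>2\<close> is at
    most a small multiple of \<open>t\<close>, which fails for large \<open>t\<close>.\<close>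
  have "t \<le> 6/5"
  proof (rule ccontr)
    assume "\<not> t \<le> 6/5"
    then have "t > 6/5" by simp
    have "(t - 1) * (t - 1) \<ge> 1/5 * (t - 1)" using \<open>t > 6/5\<close> by (intro mult_right_mono) auto
    with a1 a2 \<open>t > 6/5\<close> show False unfolding power2_eq_square by argo
  qed
  then have S3: "1 + S \<le> 3" using a1 by simp
  have "h\<^sup>2 / 3 * (1 + S) \<le> h\<^sup>2 / 3 * 3" using S3 by (intro mult_left_mono) auto
  then have sm3: "\<bar>2 * t - 1 - S\<bar> + (t - 1)\<^sup>2 + Q < h\<^sup>2" using sm by simp
  have "(t - 1)\<^sup>2 < h\<^sup>2" using sm3 Q0 by argo
  then have "\<bar>t - 1\<bar>\<^sup>2 < h\<^sup>2" by simp
  then have t1: "\<bar>t - 1\<bar> < h" by (rule power2_less_imp_less) (use h in simp)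
  have Qh: "Q < h\<^sup>2" using sm3 sq0 by argo
  have hh8: "h\<^sup>2 \<le> h / 8" using h by (simp add: power2_eq_square)
  have Sb: "S > 1 - 2 * h - h\<^sup>2" "S < 1 + 2 * h + h\<^sup>2" using sm3 Q0 sq0 t1 by argo+
  then have S12: "S > 1/2" using h hh by argo
  then show ne: "M \<noteq> {}" unfolding S_def by auto
  have mM: "m \<in> M" and mmax: "\<And>a. a \<in> M \<Longrightarrow> f a \<le> f m" using m ne by auto
  \<comment> \<open>Every \<open>1 - f a\<close> is at least \<open>1 - f m\<close>, and
    \<open>S\<close> exceeds 1/2, so \<open>f m\<close> misses 1 only by a term of second order in
    \<open>h\<close>.\<close>
  have "(1 - f m) * S \<le> Q"
    unfolding S_def Q_def sum_distrib_left using mmax f01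
    by (intro sum_mono mult_right_mono) (auto simp: less_imp_le)
  moreover have "(1 - f m) * (1/2) \<le> (1 - f m) * S"
    using S12 f01[OF mM] by (intro mult_left_mono) auto
  ultimately have fm: "f m \<ge> 1 - 2 * h\<^sup>2" using Qh by argo
  have "(f m)\<^sup>2 \<ge> (1 - 2 * h\<^sup>2)\<^sup>2" using fm hh by (intro power_mono) auto
  moreover have "(1 - 2 * h\<^sup>2)\<^sup>2 = 1 - 4 * h\<^sup>2 + (2 * h\<^sup>2)\<^sup>2"
    by (simp add: power2_eq_square algebra_simps)
  moreover from this have "(1 - 2 * h\<^sup>2)\<^sup>2 \<ge> 1 - 4 * h\<^sup>2" by simp
  ultimately have "(f m)\<^sup>2 \<ge> 1 - 4 * h\<^sup>2" by linarith
  then show "1 - e \<le> (f m)\<^sup>2" using hh8 h(1) unfolding h_def by argo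
  define r where "r = sum f (M - {m})"
  have Sr: "S = f m + r" unfolding S_def r_def using fin mM by (simp add: sum.remove)
  have r3: "r \<le> 3 * h" using Sr Sb fm hh8 h by argo
  have fr: "f a \<le> r" if "a \<in> M - {m}" for a
    unfolding r_def using that fin f01 by (intro member_le_sum) (auto simp: less_imp_le)
  have r0: "r \<ge> 0" unfolding r_def using f01 by (intro sum_nonneg) (auto simp: less_imp_le)
  have "(\<Sum>a\<in>M - {m}. (f a)\<^sup>2) \<le> (\<Sum>a\<in>M - {m}. r * f a)"
    unfolding power2_eq_square using fr f01 by (intro sum_mono mult_right_mono) (auto simp: less_imp_le)
  also have "\<dots> = r * r" by (simp add: r_def sum_distrib_left)
  also have "\<dots> \<le> (3 * h) * (3 * h)" using r3 r0 by (intro mult_mono) auto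
  finally have "(\<Sum>a\<in>M - {m}. (f a)\<^sup>2) \<le> 9 * h\<^sup>2" by (simp add: power2_eq_square)
  moreover have "t\<^sup>2 \<ge> (1 - h)\<^sup>2" using t1 h by (intro power_mono) auto
  moreover have "(1 - h)\<^sup>2 \<ge> 1 - 2 * h" by (simp add: power2_eq_square algebra_simps)
  ultimately show "1 - e \<le> t\<^sup>2 - (\<Sum>a\<in>M - {m}. (f a)\<^sup>2)"
    using hh8 h(1) unfolding h_def by argo
  have "r * 1 \<le> 2 * (\<Sum>a\<in>M - {m}. (1 - f a) * f a)"
    unfolding r_def sum_distrib_left mult_1_right
  proof (intro sum_mono)
    fix a assume a: "a \<in> M - {m}"
    \<comment> \<open>Outside \<open>m\<close> the values are at most
      \<open>r \<le> 3 * h \<le> 3/8\<close>, hence \<open>1 \<le> 2 * (1 - f a)\<close>.\<close>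
    have "1 * f a \<le> (2 * (1 - f a)) * f a" 
      using fr[OF a] r3 h f01 a by (intro mult_right_mono) (auto simp: less_imp_le)
    then show "f a \<le> 2 * ((1 - f a) * f a)" by (simp only: mult.assoc mult_1_left)
  qed
  also have "(\<Sum>a\<in>M - {m}. (1 - f a) * f a) \<le> Q"
    unfolding Q_def using fin f01 by (intro sum_mono2) (auto simp: less_imp_le)
  finally show "sum f (M - {m}) \<le> 2 * (\<Sum>a\<in>M. (1 - f a) * f a)" by (simp add: r_def Q_def)
qed

lemma sum_UNION_le_sum:
  fixes f :: "'a \<Rightarrow> real"
  assumes "finite U" "\<And>u. u \<in> U \<Longrightarrow> finite (M u)" "\<And>a. f a \<ge> 0"
  shows "sum f (\<Union>u\<in>U. M u) \<le> (\<Sum>u\<in>U. sum f (M u))"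
  using assms
proof (induction U rule: finite_induct)
  case (insert u U)
  have "sum f (M u \<union> (\<Union>v\<in>U. M v)) \<le> sum f (M u) + sum f (\<Union>v\<in>U. M v)"
    using insert sum.union_inter[of "M u" "\<Union>v\<in>U. M v" f]
      sum_nonneg[of "M u \<inter> (\<Union>v\<in>U. M v)" f] by simp
  also have "\<dots> \<le> (\<Sum>v\<in>insert u U. sum f (M v))" using insert by simp
  finally show ?case by simp
qed simp

section \<open>Charges, gains and Berman's ratio\<close>

text \<open>The two solutions have separate types and weights, and only the neighbourhoods
  \<open>N u\<close> in \<open>A\<close> link them; a vertex of both solutions is to be its own
  neighbour. The size limit is what the largest exchange, in \<open>card_star\<close>, consumes: at
  most \<open>k\<close> vertices of a star and at most \<open>k\<close> talons at each of their at
  most \<open>k\<close> other ends.\<close>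

locale local_optimum =
  fixes A :: "'a set" and B :: "'b set" and N :: "'b \<Rightarrow> 'a set"
    and w :: "'a \<Rightarrow> real" and y :: "'b \<Rightarrow> real" and k :: nat
  assumes finA: "finite A" and finB: "finite B"
    and NA: "u \<in> B \<Longrightarrow> N u \<subseteq> A"
    and w_pos: "a \<in> A \<Longrightarrow> w a > 0" and y_pos: "u \<in> B \<Longrightarrow> y u > 0"
    and degree: "a \<in> A \<Longrightarrow> card {u \<in> B. a \<in> N u} \<le> k"
    and opt: "U \<subseteq> B \<Longrightarrow> card U \<le> k + k * k \<Longrightarrow>
                (\<Sum>u\<in>U. (y u)\<^sup>2) \<le> (\<Sum>a\<in>(\<Union>u\<in>U. N u). (w a)\<^sup>2)"
    and k_pos: "k > 0"
begin

definition heaviest :: "'b \<Rightarrow> 'a" where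
  "heaviest u = (SOME a. a \<in> N u \<and> (\<forall>b\<in>N u. w b \<le> w a))"

definition second_heaviest :: "'b \<Rightarrow> 'a" where
  "second_heaviest u = (SOME a. a \<in> N u - {heaviest u} \<and> (\<forall>b\<in>N u - {heaviest u}. w b \<le> w a))"

definition charge :: "'b \<Rightarrow> real" where
  "charge u = y u - (\<Sum>a\<in>N u. w a) / 2"

text \<open>The balance of inserting \<open>u\<close> when the loss of its heaviest neighbour is
  booked elsewhere.\<close>

definition gain :: "'b \<Rightarrow> real" where
  "gain u = (y u)\<^sup>2 - (\<Sum>a\<in>N u - {heaviest u}. (w a)\<^sup>2)"

text \<open>Chosen to make \<open>gain_eq\<close> an identity. For \<open>u\<close> in
  \<open>B\<close> no summand is negative, and all vanish exactly if \<open>y u\<close> and all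
  weights in \<open>N u\<close> equal the weight of the heaviest neighbour.\<close>

definition slack :: "'b \<Rightarrow> real" where
  "slack u = (y u - w (heaviest u))\<^sup>2 + (\<Sum>a\<in>N u - {heaviest u}. (w (heaviest u) - w a) * w a)"

lemma finN: "u \<in> B \<Longrightarrow> finite (N u)"
  by (rule finite_subset[OF NA finA])

lemma ex_max: assumes "finite M" "M \<noteq> {}" shows "\<exists>a. a \<in> M \<and> (\<forall>b\<in>M. w b \<le> w a)"
proof -
  have "Max (w ` M) \<in> w ` M" using assms by (intro Max_in) auto
  then obtain a where "a \<in> M" "w a = Max (w ` M)" by auto
  moreover have "w b \<le> Max (w ` M)" if "b \<in> M" for b using assms that by (intro Max_ge) auto
  ultimately show ?thesis by auto
qed

text \<open>A vertex without neighbours could be inserted at no cost.\<close>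

lemma N_nonempty: assumes "u \<in> B" shows "N u \<noteq> {}"
proof
  assume "N u = {}"
  moreover have "(\<Sum>v\<in>{u}. (y v)\<^sup>2) \<le> (\<Sum>a\<in>(\<Union>v\<in>{u}. N v). (w a)\<^sup>2)"
    using assms k_pos by (intro opt) auto
  ultimately show False using y_pos[OF assms] by simp
qed

lemma heaviest: assumes "u \<in> B" shows "heaviest u \<in> N u" "b \<in> N u \<Longrightarrow> w b \<le> w (heaviest u)"
proof -
  have "heaviest u \<in> N u \<and> (\<forall>b\<in>N u. w b \<le> w (heaviest u))"
    unfolding heaviest_def using ex_max[OF finN[OF assms] N_nonempty[OF assms]] by (rule someI_ex)
  then show "heaviest u \<in> N u" "b \<in> N u \<Longrightarrow> w b \<le> w (heaviest u)" by auto
qed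

lemma heaviest_A: "u \<in> B \<Longrightarrow> heaviest u \<in> A" using heaviest NA by blast

lemma heaviest_pos: "u \<in> B \<Longrightarrow> w (heaviest u) > 0" using heaviest_A w_pos by blast

lemma second_heaviest:
  assumes "u \<in> B" "N u - {heaviest u} \<noteq> {}"
  shows "second_heaviest u \<in> N u - {heaviest u} \<and> (\<forall>b\<in>N u - {heaviest u}. w b \<le> w (second_heaviest u))"
proof -
  have "finite (N u - {heaviest u})" using finN[OF assms(1)] by simp
  from ex_max[OF this assms(2)] show ?thesis unfolding second_heaviest_def by (rule someI_ex)
qed

lemma slack_nonneg: assumes "u \<in> B" shows "slack u \<ge> 0"
proof -
  have "(w (heaviest u) - w a) * w a \<ge> 0" if "a \<in> N u" for a
    using heaviest(2)[OF assms that] w_pos[of a] NA[OF assms] that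
    by (intro mult_nonneg_nonneg) (auto intro: less_imp_le)
  then show ?thesis unfolding slack_def by (intro add_nonneg_nonneg sum_nonneg) auto
qed

text \<open>The link between the two currencies: exchanges are decided by squared weights, the ratio
  by the linear charges.\<close>

lemma gain_eq: assumes "u \<in> B" shows "gain u = 2 * w (heaviest u) * charge u + slack u"
proof -
  have s: "(\<Sum>a\<in>N u. w a) = w (heaviest u) + (\<Sum>a\<in>N u - {heaviest u}. w a)"
    using finN[OF assms] heaviest(1)[OF assms] by (simp add: sum.remove)
  have "(\<Sum>a\<in>N u - {heaviest u}. (w (heaviest u) - w a) * w a)
      = w (heaviest u) * (\<Sum>a\<in>N u - {heaviest u}. w a) - (\<Sum>a\<in>N u - {heaviest u}. (w a)\<^sup>2)"
    by (simp add: left_diff_distrib sum_subtractf sum_distrib_left power2_eq_square)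
  then show ?thesis
    unfolding gain_def charge_def slack_def s by (simp add: power2_eq_square algebra_simps)
qed

definition owned :: "'a \<Rightarrow> 'b set" where "owned a = {u \<in> B. heaviest u = a}"

definition talons :: "'a \<Rightarrow> 'b set" where "talons a = {u \<in> owned a. charge u > 0}"

lemma owned_card: assumes "a \<in> A" "T \<subseteq> owned a" shows "card T \<le> k" "finite T"
proof -
  have "T \<subseteq> {u \<in> B. a \<in> N u}" using assms heaviest by (auto simp: owned_def)
  then have "card T \<le> card {u \<in> B. a \<in> N u}" using finB by (intro card_mono) auto
  with degree[OF assms(1)] show "card T \<le> k" by simp
  show "finite T" using assms finB by (auto simp: owned_def intro: finite_subset)
qed

text \<open>In all exchange arguments the neighbourhood of the set \<open>U\<close> that is inserted is charged as
  follows: a common part \<open>V\<close> is paid for once, and every \<open>u\<close> pays for the rest of \<open>N u\<close>.\<close>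

lemma exchange:
  assumes "U \<subseteq> B" "card U \<le> k + k * k" "finite V" "\<And>u. u \<in> U \<Longrightarrow> M u \<subseteq> N u \<and> N u - M u \<subseteq> V"
  shows "(\<Sum>u\<in>U. (y u)\<^sup>2 - (\<Sum>a\<in>M u. (w a)\<^sup>2)) \<le> (\<Sum>a\<in>V. (w a)\<^sup>2)"
proof -
  have fU: "finite U" using assms(1) finB by (rule finite_subset)
  have fM: "finite (M u)" if "u \<in> U" for u
  proof (rule finite_subset)
    show "M u \<subseteq> N u" using assms(4)[OF that] by simp
    show "finite (N u)" using that assms(1) by (intro finN) auto
  qed
  have "(\<Sum>u\<in>U. (y u)\<^sup>2) \<le> (\<Sum>a\<in>(\<Union>u\<in>U. N u). (w a)\<^sup>2)" using assms(1,2) by (rule opt)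
  also have "\<dots> \<le> (\<Sum>a\<in>(\<Union>u\<in>U. M u) \<union> V. (w a)\<^sup>2)"
  proof (rule sum_mono2)
    show "finite ((\<Union>u\<in>U. M u) \<union> V)" using fU fM assms(3) by simp
    have "N u \<subseteq> M u \<union> V" if "u \<in> U" for u using assms(4)[OF that] by auto
    then show "(\<Union>u\<in>U. N u) \<subseteq> (\<Union>u\<in>U. M u) \<union> V" by auto
  qed simp
  also have "\<dots> \<le> (\<Sum>a\<in>(\<Union>u\<in>U. M u). (w a)\<^sup>2) + (\<Sum>a\<in>V. (w a)\<^sup>2)"
    using sum.union_inter[of "\<Union>u\<in>U. M u" V "\<lambda>a. (w a)\<^sup>2"] fU fM assms(3)
      sum_nonneg[of "(\<Union>u\<in>U. M u) \<inter> V" "\<lambda>a. (w a)\<^sup>2"] by simp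
  also have "(\<Sum>a\<in>(\<Union>u\<in>U. M u). (w a)\<^sup>2) \<le> (\<Sum>u\<in>U. \<Sum>a\<in>M u. (w a)\<^sup>2)"
    using fU fM by (intro sum_UNION_le_sum) auto
  finally show ?thesis by (simp add: sum_subtractf)
qed

text \<open>The vertices of \<open>T\<close> share the heaviest neighbour \<open>a\<close>, so
  \<open>exchange\<close> applies with \<open>V = {a}\<close>: \<open>a\<close> is lost only
  once.\<close>

lemma claw: assumes "a \<in> A" "T \<subseteq> owned a" shows "(\<Sum>u\<in>T. gain u) \<le> (w a)\<^sup>2"
proof -
  have "(\<Sum>u\<in>T. (y u)\<^sup>2 - (\<Sum>a\<in>N u - {heaviest u}. (w a)\<^sup>2)) \<le> (\<Sum>a\<in>{a}. (w a)\<^sup>2)"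
  proof (rule exchange)
    show "card T \<le> k + k * k" using owned_card(1)[OF assms] by simp
  qed (use assms(2) heaviest(1) in \<open>auto simp: owned_def\<close>)
  then show ?thesis by (simp add: gain_def)
qed

text \<open>This is \<open>claw\<close> divided by \<open>w a\<close>. The slack is kept because it
  is a part of the loss that has to be bounded later.\<close>

lemma claw_charge:
  assumes "a \<in> A" "T \<subseteq> owned a"
  shows "(\<Sum>u\<in>T. 2 * charge u + slack u / w (heaviest u)) \<le> w a"
proof -
  have T: "u \<in> B" "heaviest u = a" if "u \<in> T" for u using that assms(2) by (auto simp: owned_def)
  have wa: "w a > 0" by (rule w_pos) fact
  have "w a * (\<Sum>u\<in>T. 2 * charge u + slack u / w (heaviest u)) = (\<Sum>u\<in>T. gain u)"
    unfolding sum_distrib_left using T wa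
    by (intro sum.cong) (auto simp: gain_eq field_simps)
  also have "\<dots> \<le> w a * w a" using claw[OF assms] by (simp add: power2_eq_square)
  finally show ?thesis using wa by simp
qed

lemma sum_owned: "(\<Sum>u\<in>B. f u) = (\<Sum>a\<in>A. \<Sum>u\<in>owned a. f u)" for f :: "'b \<Rightarrow> real"
  unfolding owned_def using finA finB heaviest_A by (intro sum.group[symmetric]) auto

lemma sum_charge_slack: "(\<Sum>u\<in>B. 2 * charge u + slack u / w (heaviest u)) \<le> sum w A"
  unfolding sum_owned using claw_charge by (intro sum_mono) auto

lemma sum_talons_le: assumes "a \<in> A" shows "(\<Sum>u\<in>talons a. charge u) \<le> w a / 2"
proof -
  have "(\<Sum>u\<in>talons a. 2 * charge u) \<le> (\<Sum>u\<in>talons a. 2 * charge u + slack u / w (heaviest u))"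
    using slack_nonneg heaviest_pos
    by (intro sum_mono) (auto simp: talons_def owned_def less_imp_le)
  also have "\<dots> \<le> w a" using assms by (intro claw_charge) (auto simp: talons_def)
  finally show ?thesis by (simp flip: sum_distrib_left)
qed

lemma owned_max_charge: assumes "a \<in> A"
  shows "(\<Sum>u\<in>owned a. max 0 (charge u)) = (\<Sum>u\<in>talons a. charge u)"
  using owned_card(2)[OF assms subset_refl]
  by (intro sum.mono_neutral_cong_right) (auto simp: talons_def)

lemma sum_max_charge: "(\<Sum>u\<in>B. max 0 (charge u)) = (\<Sum>a\<in>A. \<Sum>u\<in>talons a. charge u)"
  unfolding sum_owned using owned_max_charge by (rule sum.cong[OF refl])

definition deg :: "'a \<Rightarrow> real" where "deg a = real (card {u \<in> B. a \<in> N u})"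

lemma sum_incidence:
  assumes "C \<subseteq> A"
  shows "(\<Sum>u\<in>B. \<Sum>a\<in>N u \<inter> C. w a) = (\<Sum>a\<in>C. w a * deg a)"
proof -
  have fC: "finite C" using assms finA finite_subset by blast
  have "(\<Sum>u\<in>B. \<Sum>a\<in>N u \<inter> C. w a) = (\<Sum>u\<in>B. \<Sum>a\<in>{a \<in> C. a \<in> N u}. w a)"
    by (intro sum.cong) auto
  also have "\<dots> = (\<Sum>a\<in>C. \<Sum>u\<in>{u \<in> B. a \<in> N u}. w a)"
    using finB fC by (rule sum.swap_restrict)
  finally show ?thesis by (simp add: deg_def mult.commute)
qed

text \<open>Double counting: half of \<open>w a\<close> is subtracted once for every neighbour of
  \<open>a\<close> in \<open>B\<close>. With degrees at most \<open>k\<close>, the total charge is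
  the only possible excess over \<open>k / 2 * sum w A\<close>.\<close>

lemma sum_B: "sum y B = (\<Sum>a\<in>A. w a * deg a) / 2 + (\<Sum>u\<in>B. charge u)"
proof -
  have "(\<Sum>u\<in>B. \<Sum>a\<in>N u. w a) = (\<Sum>u\<in>B. \<Sum>a\<in>N u \<inter> A. w a)"
    using NA by (intro sum.cong) auto
  then have "(\<Sum>u\<in>B. \<Sum>a\<in>N u. w a) = (\<Sum>a\<in>A. w a * deg a)"
    using sum_incidence[of A] by simp
  then show ?thesis by (simp add: charge_def sum_subtractf flip: sum_divide_distrib)
qed

lemma sum_deg_le: "(\<Sum>a\<in>A. w a * deg a) \<le> k * sum w A"
  unfolding sum_distrib_left using degree w_pos
  by (intro sum_mono) (auto simp: deg_def mult.commute less_imp_le intro!: mult_right_mono)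

lemma sum_charge_le: "(\<Sum>u\<in>B. charge u) \<le> sum w A / 2"
proof -
  have "(\<Sum>u\<in>B. charge u) \<le> (\<Sum>u\<in>B. max 0 (charge u))" by (intro sum_mono) auto
  also have "\<dots> \<le> (\<Sum>a\<in>A. w a / 2)"
    unfolding sum_max_charge using sum_talons_le by (intro sum_mono) auto
  finally show ?thesis by (simp add: sum_divide_distrib)
qed

theorem ratio_half_Suc: "sum y B \<le> (k + 1) / 2 * sum w A"
  using sum_B sum_deg_le sum_charge_le by (simp add: field_simps)

text \<open>If it vanishes for \<open>u\<close> in \<open>B\<close>, then all neighbours weigh as
  much as \<open>u\<close> and add up to twice its weight, so there are exactly two:
  \<open>u\<close> is an edge between two vertices of \<open>A\<close> of equal weight.\<close>

definition loss :: "'b \<Rightarrow> real" where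
  "loss u = 2 * \<bar>charge u\<bar> + slack u / w (heaviest u)"

text \<open>At ratio \<open>k / 2\<close> or more the total charge is nonnegative, so the negative
  charges are outweighed by the positive ones, which sum to at most \<open>sum w A / 2\<close>. And
  as charges can contribute no more than this, the degrees cannot fall far short of \<open>k\<close>
  on average.\<close>

lemma
  assumes "k / 2 * sum w A \<le> sum y B"
  shows sum_loss_le: "(\<Sum>u\<in>B. loss u) \<le> 3 * sum w A"
    and sum_missing_le: "(\<Sum>a\<in>A. w a * (k - deg a)) \<le> sum w A"
proof -
  have c0: "(\<Sum>u\<in>B. charge u) \<ge> 0" using assms sum_B sum_deg_le by (simp add: field_simps)
  \<comment> \<open>From \<open>\<bar>c\<bar> = 2 * max 0 c - c\<close>, arranged so that the last
    group is the one bounded by \<open>sum_charge_slack\<close>.\<close>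
  have "loss u = 4 * max 0 (charge u) - 4 * charge u + (2 * charge u + slack u / w (heaviest u))" for u
    by (auto simp: loss_def max_def)
  then have "(\<Sum>u\<in>B. loss u) = 4 * (\<Sum>u\<in>B. max 0 (charge u)) - 4 * (\<Sum>u\<in>B. charge u)
               + (\<Sum>u\<in>B. 2 * charge u + slack u / w (heaviest u))"
    by (simp only: sum.distrib sum_subtractf sum_distrib_left)
  moreover have "(\<Sum>u\<in>B. max 0 (charge u)) \<le> (\<Sum>a\<in>A. w a / 2)"
    unfolding sum_max_charge using sum_talons_le by (intro sum_mono) auto
  ultimately show "(\<Sum>u\<in>B. loss u) \<le> 3 * sum w A"
    using c0 sum_charge_slack by (simp add: sum_divide_distrib[symmetric])
  have "(\<Sum>a\<in>A. w a * (k - deg a)) = k * sum w A - (\<Sum>a\<in>A. w a * deg a)"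
    by (simp add: right_diff_distrib sum_subtractf sum_distrib_left mult.commute)
  with assms sum_B sum_charge_le show "(\<Sum>a\<in>A. w a * (k - deg a)) \<le> sum w A" by simp
qed


section \<open>Vertices that look like edges between two vertices of \<open>A\<close>\<close>

text \<open>In terms of squares, as exchanges are. The last inequality says that \<open>u\<close>
  can pay for all neighbours other than the two heaviest and, up to the factor \<open>1 - e\<close>,
  for the heaviest one.\<close>

definition nice :: "real \<Rightarrow> 'b \<Rightarrow> bool" where
  "nice e u \<longleftrightarrow> N u - {heaviest u} \<noteq> {} \<and> (1 - e) * (w (heaviest u))\<^sup>2 \<le> (w (second_heaviest u))\<^sup>2 \<and>
     (1 - e) * (w (heaviest u))\<^sup>2 \<le> (y u)\<^sup>2 - (\<Sum>a\<in>N u - {heaviest u} - {second_heaviest u}. (w a)\<^sup>2)"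

definition ends :: "real \<Rightarrow> 'b \<Rightarrow> 'a set" where
  "ends e u = (if nice e u then {heaviest u, second_heaviest u} else {})"

definition other :: "'b \<Rightarrow> 'a \<Rightarrow> 'a" where
  "other u b = (if heaviest u = b then second_heaviest u else heaviest u)"

text \<open>Reduction to \<open>nearly_tight_neighbourhood\<close> by dividing all weights by that
  of the heaviest neighbour. Charges scale linearly and slacks quadratically, which is why
  \<open>loss\<close> divides the slack by this weight once.\<close>

lemma nice_if_loss_small:
  assumes u: "u \<in> B" and e: "0 < e" "e \<le> 1/2" and small: "loss u < e\<^sup>2 / 48 * sum w (N u)"
  shows "nice e u" "(\<Sum>a\<in>N u - {heaviest u} - {second_heaviest u}. w a) \<le> 2 * loss u"
proof -
  define x where "x = w (heaviest u)"
  define M where "M = N u - {heaviest u}"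
  define f where "f = (\<lambda>a. w a / x)"
  have x: "x > 0" unfolding x_def by (rule heaviest_pos[OF u])
  have fM: "finite M" unfolding M_def using finN[OF u] by simp
  have wf: "w a = x * f a" for a using x by (simp add: f_def)
  have sM: "sum w M = x * sum f M" by (simp add: wf sum_distrib_left)
  have sN: "sum w (N u) = x * (1 + sum f M)"
    using finN[OF u] heaviest(1)[OF u] by (simp add: sum.remove M_def[symmetric] x_def[symmetric] sM algebra_simps)
  have sl: "slack u = x\<^sup>2 * ((y u / x - 1)\<^sup>2 + (\<Sum>a\<in>M. (1 - f a) * f a))"
  proof -
    have "x * (y u / x - 1) = y u - x" using x by (simp add: field_simps)
    then have "(y u - x)\<^sup>2 = x\<^sup>2 * (y u / x - 1)\<^sup>2" by (metis power_mult_distrib)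
    moreover have "(\<Sum>a\<in>M. (x - w a) * w a) = x\<^sup>2 * (\<Sum>a\<in>M. (1 - f a) * f a)"
      unfolding sum_distrib_left by (rule sum.cong) (auto simp: wf power2_eq_square algebra_simps)
    ultimately show ?thesis
      by (simp add: slack_def x_def[symmetric] M_def[symmetric] distrib_left)
  qed
  have ch: "2 * \<bar>charge u\<bar> = x * \<bar>2 * (y u / x) - 1 - sum f M\<bar>"
  proof -
    have "2 * charge u = x * (2 * (y u / x) - 1 - sum f M)"
      using x by (simp add: charge_def sN algebra_simps)
    then have "\<bar>2 * charge u\<bar> = \<bar>x\<bar> * \<bar>2 * (y u / x) - 1 - sum f M\<bar>" by (simp only: abs_mult)
    then show ?thesis using x by simp
  qed
  let ?h = "\<bar>2 * (y u / x) - 1 - sum f M\<bar> + (y u / x - 1)\<^sup>2 + (\<Sum>a\<in>M. (1 - f a) * f a)"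
  have "slack u / x = x * ((y u / x - 1)\<^sup>2 + (\<Sum>a\<in>M. (1 - f a) * f a))"
    unfolding sl using x by (simp add: power2_eq_square)
  then have L: "loss u = x * ?h"
    unfolding loss_def ch x_def[symmetric] by (simp only: distrib_left add.assoc)
  have "x * ?h < x * (e\<^sup>2 / 48 * (1 + sum f M))"
    using small unfolding L sN by (simp add: mult.left_commute)
  then have h: "?h < e\<^sup>2 / 48 * (1 + sum f M)" using x by simp
  have f01: "0 < f a \<and> f a \<le> 1" if "a \<in> M" for a
    using that heaviest(2)[OF u, of a] NA[OF u] w_pos[of a] x by (auto simp: M_def f_def x_def)
  have m: "second_heaviest u \<in> M \<and> (\<forall>a\<in>M. f a \<le> f (second_heaviest u))" if "M \<noteq> {}"
    using second_heaviest[OF u] that x by (auto simp: M_def f_def divide_right_mono)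
  note * = nearly_tight_neighbourhood[OF fM f01 _ e h m]
  have yx: "y u / x > 0" using y_pos[OF u] x by simp
  have "(1 - e) * x\<^sup>2 \<le> (f (second_heaviest u))\<^sup>2 * x\<^sup>2"
    using *(2)[OF _ yx] by (intro mult_right_mono) auto
  moreover have "(1 - e) * x\<^sup>2 \<le> ((y u / x)\<^sup>2 - (\<Sum>a\<in>M - {second_heaviest u}. (f a)\<^sup>2)) * x\<^sup>2"
    using *(3)[OF _ yx] by (intro mult_right_mono) auto
  moreover have "((y u / x)\<^sup>2 - (\<Sum>a\<in>M - {second_heaviest u}. (f a)\<^sup>2)) * x\<^sup>2
      = (y u)\<^sup>2 - (\<Sum>a\<in>M - {second_heaviest u}. (w a)\<^sup>2)"
    using x by (simp add: wf left_diff_distrib right_diff_distrib sum_distrib_left power_mult_distrib power_divide mult.commute)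
  ultimately show "nice e u"
    using *(1)[OF _ yx] unfolding nice_def M_def[symmetric] x_def[symmetric]
    by (simp add: wf[of "second_heaviest u"] power_mult_distrib mult.commute)
  have "sum w (M - {second_heaviest u}) = x * sum f (M - {second_heaviest u})" by (simp add: wf sum_distrib_left)
  also have "\<dots> \<le> x * (2 * (\<Sum>a\<in>M. (1 - f a) * f a))"
    using *(4)[OF _ yx] x by (intro mult_left_mono) auto
  also have "\<dots> \<le> x * (2 * ?h)" using x by (intro mult_left_mono) auto
  finally show "(\<Sum>a\<in>N u - {heaviest u} - {second_heaviest u}. w a) \<le> 2 * loss u"
    unfolding L M_def by (simp only: mult.left_commute)
qed

lemma loss_nonneg: "u \<in> B \<Longrightarrow> loss u \<ge> 0"
  unfolding loss_def using slack_nonneg heaviest_pos by (simp add: less_imp_le)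

lemma ends_subset: "u \<in> B \<Longrightarrow> ends e u \<subseteq> N u"
  using heaviest(1) second_heaviest by (auto simp: ends_def nice_def)

text \<open>Either the loss is small, and \<open>u\<close> is nice with little weight outside its
  ends, or the loss is large enough to pay for the whole neighbourhood.\<close>

lemma sum_not_ends_le:
  assumes u: "u \<in> B" and e: "0 < e" "e \<le> 1/2"
  shows "(\<Sum>a\<in>N u - ends e u. w a) \<le> 48 / e\<^sup>2 * loss u"
proof (cases "loss u < e\<^sup>2 / 48 * sum w (N u)")
  case True
  note * = nice_if_loss_small[OF u e True]
  have "e\<^sup>2 \<le> (1/2)\<^sup>2" using e by (intro power_mono) auto
  then have "2 \<le> 48 / e\<^sup>2" using e by (simp add: field_simps power2_eq_square)
  then have "2 * loss u \<le> 48 / e\<^sup>2 * loss u" using loss_nonneg[OF u] by (rule mult_right_mono)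
  moreover have "N u - ends e u = N u - {heaviest u} - {second_heaviest u}" using *(1) by (auto simp: ends_def)
  ultimately show ?thesis using *(2) by simp
next
  case False
  have "(\<Sum>a\<in>N u - ends e u. w a) \<le> sum w (N u)"
    using finN[OF u] NA[OF u] w_pos by (intro sum_mono2) (auto simp: less_imp_le subset_iff)
  also have "\<dots> \<le> 48 / e\<^sup>2 * loss u" using False e by (simp add: field_simps)
  finally show ?thesis .
qed

section \<open>Good vertices and stars\<close>

text \<open>Stated with gains, since these are what an exchange collects. A gain is at least
  \<open>2 * w a\<close> times the charge, so where this fails the charges of the talons still sum
  to at most \<open>e * w a\<close>.\<close>

definition good :: "real \<Rightarrow> 'a \<Rightarrow> bool" where
  "good e a \<longleftrightarrow> 2 * e * (w a)\<^sup>2 \<le> (\<Sum>u\<in>talons a. gain u)"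

lemma gain_ge: "u \<in> B \<Longrightarrow> gain u \<ge> 2 * w (heaviest u) * charge u"
  using gain_eq slack_nonneg by simp

lemma sum_charge_not_good:
  assumes "a \<in> A" "\<not> good e a"
  shows "(\<Sum>u\<in>talons a. charge u) \<le> e * w a"
proof -
  have wa: "w a > 0" by (rule w_pos) fact
  have "2 * w a * (\<Sum>u\<in>talons a. charge u) \<le> (\<Sum>u\<in>talons a. gain u)"
    unfolding sum_distrib_left using gain_ge
    by (intro sum_mono) (auto simp: talons_def owned_def)
  also have "\<dots> \<le> 2 * w a * (e * w a)" using assms(2) by (simp add: good_def power2_eq_square algebra_simps)
  finally show ?thesis using wa by simp
qed

definition star :: "real \<Rightarrow> 'a \<Rightarrow> 'b set" where
  "star e b = {u \<in> B. b \<in> ends e u \<and> good e (other u b)}"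

text \<open>Up to the factor \<open>1 - e\<close> the two ends are interchangeable, so a star may be
  centred at either of them.\<close>

lemma niceD:
  assumes "u \<in> B" "b \<in> ends e u" "0 < e" "e \<le> 1/2"
  shows "other u b \<in> N u" "other u b \<noteq> b" "b \<in> N u"
    "(1 - e) * (w (other u b))\<^sup>2 \<le> (w b)\<^sup>2" "(1 - e) * (w b)\<^sup>2 \<le> (w (other u b))\<^sup>2"
    "(1 - e) * (w (other u b))\<^sup>2 \<le> (y u)\<^sup>2 - (\<Sum>a\<in>N u - {b, other u b}. (w a)\<^sup>2)"
proof -
  have n: "nice e u" and b: "b = heaviest u \<or> b = second_heaviest u" using assms by (auto simp: ends_def split: if_splits)
  have s: "second_heaviest u \<in> N u" "second_heaviest u \<noteq> heaviest u" using second_heaviest[OF assms(1)] n by (auto simp: nice_def)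
  have t: "heaviest u \<in> N u" by (rule heaviest(1)) fact
  have le: "w (second_heaviest u) \<le> w (heaviest u)" by (rule heaviest(2)) fact+
  have pos: "w (second_heaviest u) > 0" using s NA[OF assms(1)] w_pos by auto
  have sq: "(w (second_heaviest u))\<^sup>2 \<le> (w (heaviest u))\<^sup>2" using le pos by (intro power_mono) auto
  have e1: "(1 - e) * (w (second_heaviest u))\<^sup>2 \<le> (1 - e) * (w (heaviest u))\<^sup>2"
    using sq assms by (intro mult_left_mono) auto
  have e2: "(1 - e) * (w (heaviest u))\<^sup>2 \<le> 1 * (w (heaviest u))\<^sup>2"
    using assms by (intro mult_right_mono) auto
  have "N u - {heaviest u} - {second_heaviest u} = N u - {b, other u b}" using b by (auto simp: other_def)
  with n have "(1 - e) * (w (heaviest u))\<^sup>2 \<le> (w (second_heaviest u))\<^sup>2"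
     "(1 - e) * (w (heaviest u))\<^sup>2 \<le> (y u)\<^sup>2 - (\<Sum>a\<in>N u - {b, other u b}. (w a)\<^sup>2)"
    by (auto simp: nice_def)
  with e1 e2 b s t show "other u b \<in> N u" "other u b \<noteq> b" "b \<in> N u"
    "(1 - e) * (w (other u b))\<^sup>2 \<le> (w b)\<^sup>2" "(1 - e) * (w b)\<^sup>2 \<le> (w (other u b))\<^sup>2"
    "(1 - e) * (w (other u b))\<^sup>2 \<le> (y u)\<^sup>2 - (\<Sum>a\<in>N u - {b, other u b}. (w a)\<^sup>2)"
    by (auto simp: other_def split: if_splits)
qed

text \<open>If many nice \<open>u\<close> joined \<open>b\<close> to good vertices, then inserting all of them together with the
  talons of these good vertices would be an improvement: \<open>u\<close> pays for the good vertex at its other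
  end, so the talons there are a net gain, and only \<open>b\<close> remains to be paid for.\<close>

lemma card_star:
  assumes b: "b \<in> A" and e: "0 < e" "e \<le> 1/2"
  shows "real (card (star e b)) \<le> 2 / e"
proof -
  define S where "S = star e b"
  define v where "v = (\<lambda>u. other u b)"
  define V where "V = v ` S"
  define TT where "TT = (\<Union>a\<in>V. talons a)"
  \<comment> \<open>The neighbour besides \<open>b\<close> for which \<open>u\<close> does not pay:
    its other end if it belongs to the star, its heaviest neighbour if it is merely a talon.\<close>
  define F where "F = (\<lambda>u. if u \<in> S then v u else heaviest u)"
  define gn where "gn = (\<lambda>u. (y u)\<^sup>2 - (\<Sum>a\<in>N u - {b, F u}. (w a)\<^sup>2))"
  have SB: "u \<in> B" "b \<in> ends e u" "good e (v u)" if "u \<in> S" for u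
    using that by (auto simp: S_def star_def v_def)
  have S_sub: "S \<subseteq> {u \<in> B. b \<in> N u}" using SB niceD(3)[OF _ _ e] by auto
  have fS: "finite S" using finB by (intro finite_subset[OF S_sub]) simp
  have cS: "card S \<le> k"
    using card_mono[OF _ S_sub] degree[OF b] finB by (simp add: le_trans)
  have VA: "V \<subseteq> A" unfolding V_def v_def using niceD(1)[OF SB(1,2) e] NA SB(1) by blast
  have Vb: "a \<noteq> b" if "a \<in> V" for a using that niceD(2)[OF SB(1,2) e] by (auto simp: V_def v_def)
  have fV: "finite V" by (simp add: V_def fS)
  have cV: "card V \<le> k" using card_image_le[OF fS, of v] cS by (simp add: V_def)
  have tal: "finite (talons a)" "card (talons a) \<le> k" "talons a \<subseteq> owned a" if "a \<in> V" for a
    using owned_card[of a "talons a"] that VA by (auto simp: talons_def)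
  have fTT: "finite TT" unfolding TT_def using fV tal by auto
  have "card TT \<le> (\<Sum>a\<in>V. card (talons a))" unfolding TT_def by (rule card_UN_le[OF fV])
  also have "\<dots> \<le> card V * k"
    using tal(2) sum_bounded_above[of V "\<lambda>a. card (talons a)" k] by simp
  also have "\<dots> \<le> k * k" using cV by simp
  finally have cTT: "card TT \<le> k * k" .
  have TTB: "u \<in> B" "heaviest u \<in> V" if "u \<in> TT" for u
    using that by (auto simp: TT_def talons_def owned_def)
  have "(\<Sum>u\<in>S \<union> TT. (y u)\<^sup>2 - (\<Sum>a\<in>N u - {b, F u}. (w a)\<^sup>2)) \<le> (\<Sum>a\<in>insert b V. (w a)\<^sup>2)"
  proof (rule exchange)
    show "S \<union> TT \<subseteq> B" using SB TTB by auto
    show "card (S \<union> TT) \<le> k + k * k" using card_Un_le[of S TT] cS cTT by linarith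
    show "finite (insert b V)" using fV by simp
    show "N u - {b, F u} \<subseteq> N u \<and> N u - (N u - {b, F u}) \<subseteq> insert b V" if "u \<in> S \<union> TT" for u
      using that TTB by (auto simp: F_def V_def)
  qed
  moreover have "(\<Sum>u\<in>S \<union> TT. (if u \<in> S then (1 - e) * (w (v u))\<^sup>2 else 0) + (if u \<in> TT then gain u else 0))
      \<le> (\<Sum>u\<in>S \<union> TT. (y u)\<^sup>2 - (\<Sum>a\<in>N u - {b, F u}. (w a)\<^sup>2))"
  proof (rule sum_mono)
    fix u assume u: "u \<in> S \<union> TT"
    then have uB: "u \<in> B" using SB TTB by auto
    have fN: "finite (N u)" by (rule finN[OF uB])
    consider "u \<in> S" "u \<notin> TT" | "u \<notin> S" "u \<in> TT" | "u \<in> S" "u \<in> TT" using u by auto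
    then show "(if u \<in> S then (1 - e) * (w (v u))\<^sup>2 else 0) + (if u \<in> TT then gain u else 0)
        \<le> (y u)\<^sup>2 - (\<Sum>a\<in>N u - {b, F u}. (w a)\<^sup>2)"
    proof cases
      case 1
      then show ?thesis using niceD(6)[OF SB(1,2) e] by (simp add: F_def v_def)
    next
      case 2
      have "(\<Sum>a\<in>N u - {b, heaviest u}. (w a)\<^sup>2) \<le> (\<Sum>a\<in>N u - {heaviest u}. (w a)\<^sup>2)"
        using fN by (intro sum_mono2) auto
      then show ?thesis using 2 by (simp add: F_def gain_def)
    next
      case 3
      \<comment> \<open>Here \<open>u\<close> counts both in the star and as a talon. Its gain has
        deducted \<open>b\<close>, which the exchange pays for separately; this refund of
        \<open>(w b)\<^sup>2\<close> covers the term \<open>(1 - e) * (w (v u))\<^sup>2\<close> of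
        the star.\<close>
      have tb: "heaviest u \<noteq> b" using TTB(2)[OF 3(2)] Vb by auto
      then have vt: "v u = heaviest u" by (simp add: v_def other_def)
      have "b \<in> N u - {heaviest u}" using niceD(3)[OF SB(1,2)[OF 3(1)] e] tb by auto
      then have "(\<Sum>a\<in>N u - {heaviest u}. (w a)\<^sup>2) = (w b)\<^sup>2 + (\<Sum>a\<in>N u - {heaviest u} - {b}. (w a)\<^sup>2)"
        using fN by (intro sum.remove) auto
      moreover have "N u - {heaviest u} - {b} = N u - {b, F u}" using 3 vt by (auto simp: F_def)
      ultimately have "gain u = (y u)\<^sup>2 - (\<Sum>a\<in>N u - {b, F u}. (w a)\<^sup>2) - (w b)\<^sup>2"
        by (simp add: gain_def)
      moreover have "(1 - e) * (w (v u))\<^sup>2 \<le> (w b)\<^sup>2"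
        using niceD(4)[OF SB(1,2)[OF 3(1)] e] by (simp add: v_def)
      ultimately show ?thesis using 3 by simp
    qed
  qed
  moreover have "(\<Sum>u\<in>S \<union> TT. (if u \<in> S then (1 - e) * (w (v u))\<^sup>2 else 0) + (if u \<in> TT then gain u else 0))
     = (\<Sum>u\<in>S. (1 - e) * (w (v u))\<^sup>2) + (\<Sum>u\<in>TT. gain u)"
  proof -
    have "(\<Sum>u\<in>S \<union> TT. (if u \<in> S then (1 - e) * (w (v u))\<^sup>2 else 0)) = (\<Sum>u\<in>S. (1 - e) * (w (v u))\<^sup>2)"
      using fS fTT by (intro sum.mono_neutral_cong_right) auto
    moreover have "(\<Sum>u\<in>S \<union> TT. (if u \<in> TT then gain u else 0)) = (\<Sum>u\<in>TT. gain u)"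
      using fS fTT by (intro sum.mono_neutral_cong_right) auto
    ultimately show ?thesis by (simp add: sum.distrib)
  qed
  moreover have "(\<Sum>u\<in>TT. gain u) = (\<Sum>a\<in>V. \<Sum>u\<in>talons a. gain u)"
    unfolding TT_def using fV tal by (intro sum.UNION_disjoint) (auto simp: talons_def owned_def)
  moreover have "(\<Sum>a\<in>insert b V. (w a)\<^sup>2) = (w b)\<^sup>2 + (\<Sum>a\<in>V. (w a)\<^sup>2)"
    using fV Vb by (subst sum.insert) auto
  ultimately have "(\<Sum>u\<in>S. (1 - e) * (w (v u))\<^sup>2) - (w b)\<^sup>2 \<le> (\<Sum>a\<in>V. (w a)\<^sup>2 - (\<Sum>u\<in>talons a. gain u))"
    by (simp add: sum_subtractf)
  \<comment> \<open>Several \<open>u\<close> may share their other end. Summing over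
    \<open>S\<close> in place of \<open>V\<close> is an upper estimate because, by
    \<open>claw\<close>, no summand is negative.\<close>
  also have "\<dots> \<le> (\<Sum>u\<in>S. (w (v u))\<^sup>2 - (\<Sum>u\<in>talons (v u). gain u))"
    unfolding V_def
  proof (rule order_trans[OF sum_image_le])
    show "0 \<le> (w (v u))\<^sup>2 - sum gain (talons (v u))" if "u \<in> S" for u
      using claw[of "v u" "talons (v u)"] that VA by (auto simp: V_def talons_def)
  qed (use fS in auto)
  also have "\<dots> \<le> (\<Sum>u\<in>S. (w (v u))\<^sup>2 - 2 * e * (w (v u))\<^sup>2)"
    using SB(3) by (intro sum_mono) (auto simp: good_def)
  finally have "(\<Sum>u\<in>S. (1 - e) * (w (v u))\<^sup>2) - (\<Sum>u\<in>S. (w (v u))\<^sup>2 - 2 * e * (w (v u))\<^sup>2) \<le> (w b)\<^sup>2"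
    by simp
  then have "(\<Sum>u\<in>S. e * (w (v u))\<^sup>2) \<le> (w b)\<^sup>2"
    unfolding sum_subtractf[symmetric] by (simp add: algebra_simps)
  moreover have "(\<Sum>u\<in>S. e * (1/2 * (w b)\<^sup>2)) \<le> (\<Sum>u\<in>S. e * (w (v u))\<^sup>2)"
  proof (intro sum_mono mult_left_mono)
    fix u assume "u \<in> S"
    have "1/2 * (w b)\<^sup>2 \<le> (1 - e) * (w b)\<^sup>2" using e by (intro mult_right_mono) auto
    also have "\<dots> \<le> (w (v u))\<^sup>2" using niceD(5)[OF SB(1,2)[OF \<open>u \<in> S\<close>] e] by (simp add: v_def)
    finally show "1/2 * (w b)\<^sup>2 \<le> (w (v u))\<^sup>2" .
  qed (use e in auto)
  ultimately have "(real (card S) * e / 2) * (w b)\<^sup>2 \<le> 1 * (w b)\<^sup>2" by simp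
  then have "real (card S) * e / 2 \<le> 1" using w_pos[OF b] by (subst (asm) mult_le_cancel_right) auto
  then show ?thesis using e by (simp add: S_def field_simps)
qed

text \<open>A good end of \<open>u\<close> puts \<open>u\<close> into the star at the opposite end,
  which weighs at least half as much. Charged there, every \<open>b\<close> pays
  \<open>2 * w b\<close> at most \<open>2 / e\<close> times.\<close>

lemma sum_ends_good:
  assumes e: "0 < e" "e \<le> 1/2"
  shows "(\<Sum>u\<in>B. \<Sum>a\<in>{a \<in> ends e u. good e a}. w a) \<le> 4 / e * sum w A"
proof -
  have "(\<Sum>a\<in>{a \<in> ends e u. good e a}. w a) \<le> (\<Sum>b\<in>{b \<in> A. u \<in> star e b}. 2 * w b)" if u: "u \<in> B" for u
  proof (cases "nice e u")
    case True
    define t s where "t = heaviest u" and "s = second_heaviest u"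
    have ends: "ends e u = {t, s}" using True by (simp add: ends_def t_def s_def)
    have ts: "t \<noteq> s" using second_heaviest[OF u] True by (auto simp: nice_def t_def s_def)
    have A: "t \<in> A" "s \<in> A" using ends_subset[OF u, of e] NA[OF u] by (auto simp: ends)
    have *: "w a \<le> 2 * w b" if "b \<in> ends e u" "a = other u b" for a b
    proof -
      have "1/2 * (w a)\<^sup>2 \<le> (1 - e) * (w a)\<^sup>2" using e by (intro mult_right_mono) auto
      also have "\<dots> \<le> (w b)\<^sup>2" using niceD(4)[OF u that(1) e] that by simp
      finally have "(w a)\<^sup>2 \<le> 4 * (w b)\<^sup>2" using zero_le_power2[of "w b"] by linarith
      then have "(w a)\<^sup>2 \<le> (2 * w b)\<^sup>2" by (simp add: power_mult_distrib)
      moreover have "w b > 0" using that(1) A ends w_pos by auto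
      ultimately show ?thesis by (auto intro: power2_le_imp_le[of "w a" "2 * w b"])
    qed
    have o: "other u t = s" "other u s = t" using ts by (auto simp: other_def t_def s_def)
    have st: "{b \<in> A. u \<in> star e b} = {b \<in> {t, s}. good e (other u b)}"
      using u A by (auto simp: star_def ends)
    have "w s \<le> 2 * w t" "w t \<le> 2 * w s" by (rule *; simp add: ends o)+
    moreover have "w t > 0" "w s > 0" using A w_pos by auto
    ultimately show ?thesis unfolding st ends using ts o
      by (subst (1 2) sum.inter_filter) auto
  next
    case False
    have "(\<Sum>b\<in>{b \<in> A. u \<in> star e b}. 2 * w b) \<ge> 0"
      using w_pos by (intro sum_nonneg) (auto intro: less_imp_le)
    with False show ?thesis by (simp add: ends_def)
  qed
  then have "(\<Sum>u\<in>B. \<Sum>a\<in>{a \<in> ends e u. good e a}. w a) \<le> (\<Sum>u\<in>B. \<Sum>b\<in>{b \<in> A. u \<in> star e b}. 2 * w b)"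
    by (rule sum_mono)
  also have "\<dots> = (\<Sum>b\<in>A. \<Sum>u\<in>{u \<in> B. u \<in> star e b}. 2 * w b)"
    using finB finA by (rule sum.swap_restrict)
  also have "\<dots> = (\<Sum>b\<in>A. card (star e b) * (2 * w b))"
  proof (rule sum.cong)
    fix b have "{u \<in> B. u \<in> star e b} = star e b" by (auto simp: star_def)
    then show "(\<Sum>u\<in>{u \<in> B. u \<in> star e b}. 2 * w b) = card (star e b) * (2 * w b)" by simp
  qed simp
  also have "\<dots> \<le> (\<Sum>b\<in>A. 2 / e * (2 * w b))"
    using card_star[OF _ e] w_pos by (intro sum_mono mult_right_mono) (auto intro: less_imp_le)
  finally show ?thesis by (simp add: sum_distrib_left mult.assoc)
qed

lemma ratio_parametric:
  fixes e :: real
  assumes e: "0 < e" "e \<le> 1/2"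
  shows "sum y B \<le> (k / 2 + e + 75 / (e\<^sup>2 * k)) * sum w A"
proof (cases "k / 2 * sum w A \<le> sum y B")
  case True
  define G where "G = {a \<in> A. good e a}"
  define W where "W = sum w A"
  have W0: "W \<ge> 0" unfolding W_def using w_pos by (intro sum_nonneg) (auto intro: less_imp_le)
  have GA: "G \<subseteq> A" by (auto simp: G_def)
  have miss: "(\<Sum>a\<in>G. w a * (k - deg a)) \<le> W"
  proof -
    have "(\<Sum>a\<in>G. w a * (k - deg a)) \<le> (\<Sum>a\<in>A. w a * (k - deg a))"
      using GA finA w_pos degree
      by (intro sum_mono2) (auto simp: deg_def intro!: mult_nonneg_nonneg intro: less_imp_le)
    then show ?thesis using sum_missing_le[OF True] by (simp add: W_def)
  qed
  have "(\<Sum>a\<in>G. w a * deg a) = (\<Sum>u\<in>B. \<Sum>a\<in>N u \<inter> G. w a)" using sum_incidence[OF GA] by simp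
  also have "\<dots> \<le> (\<Sum>u\<in>B. (\<Sum>a\<in>N u - ends e u. w a) + (\<Sum>a\<in>{a \<in> ends e u. good e a}. w a))"
  proof (rule sum_mono)
    fix u assume u: "u \<in> B"
    have fin: "finite (ends e u)" by (rule finite_subset[OF ends_subset[OF u] finN[OF u]])
    have "(\<Sum>a\<in>N u \<inter> G. w a) \<le> (\<Sum>a\<in>(N u - ends e u) \<union> {a \<in> ends e u. good e a}. w a)"
    proof (rule sum_mono2)
      show "0 \<le> w a" if "a \<in> (N u - ends e u) \<union> {a \<in> ends e u. good e a} - N u \<inter> G" for a
      proof -
        have "a \<in> N u" using that ends_subset[OF u] by auto
        then show ?thesis using w_pos[of a] NA[OF u] by auto
      qed
    qed (use finN[OF u] fin in \<open>auto simp: G_def\<close>)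
    also have "\<dots> = (\<Sum>a\<in>N u - ends e u. w a) + (\<Sum>a\<in>{a \<in> ends e u. good e a}. w a)"
      using finN[OF u] fin by (intro sum.union_disjoint) auto
    finally show "(\<Sum>a\<in>N u \<inter> G. w a) \<le> \<dots>" .
  qed
  also have "\<dots> \<le> 48 / e\<^sup>2 * (\<Sum>u\<in>B. loss u) + 4 / e * W"
    unfolding sum.distrib sum_distrib_left W_def[unfolded sum_distrib_left]
    using sum_ends_good[OF e] sum_not_ends_le[OF _ e]
    by (intro add_mono sum_mono) (auto simp: sum_distrib_left)
  also have "\<dots> \<le> 48 / e\<^sup>2 * (3 * W) + 4 / e * W"
    using sum_loss_le[OF True] e unfolding W_def by (intro add_mono mult_left_mono) auto
  finally have deg: "(\<Sum>a\<in>G. w a * deg a) \<le> 144 / e\<^sup>2 * W + 4 / e * W" by simp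
  have "k * sum w G = (\<Sum>a\<in>G. w a * (k - deg a)) + (\<Sum>a\<in>G. w a * deg a)"
    by (simp add: right_diff_distrib sum_subtractf sum_distrib_left mult.commute)
  then have kG: "k * sum w G \<le> W + (144 / e\<^sup>2 * W + 4 / e * W)" using miss deg by simp
  \<comment> \<open>The 1 stems from degrees short of \<open>k\<close>, \<open>144 = 48 * 3\<close>
    from neighbours that are not ends, and \<open>4 / e\<close> from good ends.\<close>
  have "1 + 144 / e\<^sup>2 + 4 / e \<le> 150 / e\<^sup>2"
  proof -
    have "e * e \<le> 1/2 * (1/2)" using e by (intro mult_mono) auto
    then have "e\<^sup>2 + 4 * e \<le> 6" using e unfolding power2_eq_square by linarith
    moreover have "1 + 144 / e\<^sup>2 + 4 / e = (e\<^sup>2 + 4 * e + 144) / e\<^sup>2"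
      using e by (simp add: field_simps power2_eq_square)
    ultimately show ?thesis by (simp add: divide_right_mono)
  qed
  then have "(1 + 144 / e\<^sup>2 + 4 / e) * W \<le> 150 / e\<^sup>2 * W" using W0 by (rule mult_right_mono)
  then have "k * sum w G \<le> 150 / e\<^sup>2 * W" using kG by (simp add: algebra_simps)
  then have G: "sum w G / 2 \<le> 75 / (e\<^sup>2 * k) * W" using k_pos e by (simp add: field_simps)
  have "(\<Sum>u\<in>B. charge u) \<le> (\<Sum>u\<in>B. max 0 (charge u))" by (intro sum_mono) auto
  also have "\<dots> \<le> (\<Sum>a\<in>A. (if good e a then w a / 2 else 0) + e * w a)"
    unfolding sum_max_charge
  proof (rule sum_mono)
    fix a assume a: "a \<in> A"
    then have "e * w a \<ge> 0" using w_pos[OF a] e by simp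
    then show "(\<Sum>u\<in>talons a. charge u) \<le> (if good e a then w a / 2 else 0) + e * w a"
      using sum_talons_le[OF a] sum_charge_not_good[OF a] by auto
  qed
  also have "\<dots> = (\<Sum>a\<in>G. w a / 2) + e * W"
    using finA by (simp add: sum.distrib G_def W_def sum_distrib_left sum.inter_filter)
  also have "(\<Sum>a\<in>G. w a / 2) = sum w G / 2" by (rule sum_divide_distrib[symmetric])
  finally have "(\<Sum>u\<in>B. charge u) \<le> 75 / (e\<^sup>2 * k) * W + e * W" using G by simp
  then show ?thesis using sum_B sum_deg_le by (simp add: W_def algebra_simps)
next
  case False
  have "sum w A \<ge> 0" using w_pos by (intro sum_nonneg) (auto intro: less_imp_le)
  then have "(e + 75 / (e\<^sup>2 * k)) * sum w A \<ge> 0" using e by (intro mult_nonneg_nonneg) auto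
  with False show ?thesis by (simp add: algebra_simps)
qed

theorem ratio: "sum y B \<le> (k + min 1 (152 * k powr (-1/3))) / 2 * sum w A"
proof (cases "152 * k powr (-1/3) \<le> 1")
  case True
  define e where "e = k powr (-1/3)"
  have e: "0 < e" "e \<le> 1/2" using True k_pos by (auto simp: e_def)
  have "e ^ 3 = e powr 3" using e by simp
  also have "\<dots> = k powr (-1)" unfolding e_def powr_powr by simp
  finally have "e ^ 3 * k = 1" using k_pos by (simp add: powr_minus_divide)
  then have "75 / (e\<^sup>2 * k) = 75 * (e ^ 3 * k) / (e\<^sup>2 * k)" by simp
  also have "\<dots> = 75 * e" using e k_pos by (simp add: power2_eq_square power3_eq_cube)
  finally have "75 / (e\<^sup>2 * k) = 75 * e" .
  then have "k / 2 + e + 75 / (e\<^sup>2 * k) = (k + min 1 (152 * k powr (-1/3))) / 2"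
    using True by (simp add: e_def)
  with ratio_parametric[OF e] show ?thesis by simp
next
  case False
  then show ?thesis using ratio_half_Suc by (simp add: add.commute)
qed

end

section \<open>Time-bounded execution of programs\<close>

definition setn :: "string \<Rightarrow> nat list \<Rightarrow> nat \<Rightarrow> state \<Rightarrow> state" where
  "setn x is v \<sigma> = \<sigma>\<lparr>nmem := upd (nmem \<sigma>) x is v\<rparr>"

definition setr :: "string \<Rightarrow> nat list \<Rightarrow> real \<Rightarrow> state \<Rightarrow> state" where
  "setr x is v \<sigma> = \<sigma>\<lparr>rmem := upd (rmem \<sigma>) x is v\<rparr>"

lemma mem_set [simp]:
  "nmem (setn x is v \<sigma>) = (nmem \<sigma>)(x := (nmem \<sigma> x)(is := v))" "rmem (setn x is v \<sigma>) = rmem \<sigma>"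
  "rmem (setr x is r \<sigma>) = (rmem \<sigma>)(x := (rmem \<sigma> x)(is := r))" "nmem (setr x is r \<sigma>) = nmem \<sigma>"
  by (simp_all add: setn_def setr_def upd_def)

primrec nvars :: "com \<Rightarrow> string set" where
  "nvars Skip = {}"
| "nvars (NSet x es a) = {x}"
| "nvars (RSet x es a) = {}"
| "nvars (Seq c1 c2) = nvars c1 \<union> nvars c2"
| "nvars (Cond b c1 c2) = nvars c1 \<union> nvars c2"
| "nvars (While b c) = nvars c"

primrec rvars :: "com \<Rightarrow> string set" where
  "rvars Skip = {}"
| "rvars (NSet x es a) = {}"
| "rvars (RSet x es a) = {x}"
| "rvars (Seq c1 c2) = rvars c1 \<union> rvars c2"
| "rvars (Cond b c1 c2) = rvars c1 \<union> rvars c2"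
| "rvars (While b c) = rvars c"

text \<open>A syntactic bound on what a program can change. As it holds for every run,
  specifications name only what they compute, and the rest is recovered from \<open>nvars\<close>
  and \<open>rvars\<close>.\<close>

definition frame :: "com \<Rightarrow> state \<Rightarrow> state \<Rightarrow> bool" where
  "frame c \<sigma> \<tau> \<longleftrightarrow> (\<forall>x. x \<notin> nvars c \<longrightarrow> nmem \<tau> x = nmem \<sigma> x) \<and>
                    (\<forall>x. x \<notin> rvars c \<longrightarrow> rmem \<tau> x = rmem \<sigma> x)"

lemma frame_nmem: "frame c \<sigma> \<tau> \<Longrightarrow> x \<notin> nvars c \<Longrightarrow> nmem \<tau> x = nmem \<sigma> x"
  and frame_rmem: "frame c \<sigma> \<tau> \<Longrightarrow> x \<notin> rvars c \<Longrightarrow> rmem \<tau> x = rmem \<sigma> x"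
  by (auto simp: frame_def)

lemma frame_refl [simp]: "frame c \<sigma> \<sigma>"
  by (simp add: frame_def)

lemma frame_trans:
  "frame c \<sigma> \<tau> \<Longrightarrow> frame c' \<tau> \<tau>' \<Longrightarrow> nvars c \<subseteq> nvars d \<Longrightarrow> nvars c' \<subseteq> nvars d \<Longrightarrow>
   rvars c \<subseteq> rvars d \<Longrightarrow> rvars c' \<subseteq> rvars d \<Longrightarrow> frame d \<sigma> \<tau>'"
  by (auto simp: frame_def subset_iff) metis+

lemma exec_frame: "exec c \<sigma> t \<tau> \<Longrightarrow> frame c \<sigma> \<tau>"
  by (induction rule: exec.induct) (auto simp: frame_def upd_def)

section \<open>Total correctness with time bounds\<close>

definition runs :: "com \<Rightarrow> state \<Rightarrow> nat \<Rightarrow> (state \<Rightarrow> bool) \<Rightarrow> bool" where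
  "runs c \<sigma> T Q \<longleftrightarrow> (\<exists>t \<tau>. exec c \<sigma> t \<tau> \<and> t \<le> T \<and> Q \<tau>)"

lemma runs_conseq:
  assumes "runs c \<sigma> T P" "T \<le> T'" "\<And>\<tau>. P \<tau> \<Longrightarrow> frame c \<sigma> \<tau> \<Longrightarrow> Q \<tau>"
  shows "runs c \<sigma> T' Q"
proof -
  obtain t \<tau> where "exec c \<sigma> t \<tau>" "t \<le> T" "P \<tau>" using assms(1) by (auto simp: runs_def)
  then show ?thesis using assms(2) assms(3)[of \<tau>] exec_frame unfolding runs_def
    by (intro exI[of _ t] exI[of _ \<tau>]) auto
qed

lemma runs_Seq:
  assumes "runs c1 \<sigma> T1 P" "\<And>\<tau>. P \<tau> \<Longrightarrow> frame c1 \<sigma> \<tau> \<Longrightarrow> runs c2 \<tau> T2 Q" "T1 + T2 \<le> T"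
  shows "runs (Seq c1 c2) \<sigma> T Q"
proof -
  obtain t1 \<tau>1 where 1: "exec c1 \<sigma> t1 \<tau>1" "t1 \<le> T1" "P \<tau>1" using assms(1) by (auto simp: runs_def)
  then obtain t2 \<tau>2 where 2: "exec c2 \<tau>1 t2 \<tau>2" "t2 \<le> T2" "Q \<tau>2"
    using assms(2)[OF _ exec_frame] by (fastforce simp: runs_def)
  have "exec (Seq c1 c2) \<sigma> (t1 + t2) \<tau>2" by (rule exec.Seq) fact+
  then show ?thesis using 1 2 assms(3) unfolding runs_def by (meson add_mono le_trans)
qed

lemma runs_Cond:
  assumes "beval \<sigma> b \<Longrightarrow> runs c1 \<sigma> T Q" "\<not> beval \<sigma> b \<Longrightarrow> runs c2 \<sigma> T Q" "T + 1 \<le> T'"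
  shows "runs (Cond b c1 c2) \<sigma> T' Q"
proof (cases "beval \<sigma> b")
  case True
  then obtain t \<tau> where "exec c1 \<sigma> t \<tau>" "t \<le> T" "Q \<tau>" using assms(1) by (auto simp: runs_def)
  with exec.CondTrue[OF True] assms(3) show ?thesis unfolding runs_def by fastforce
next
  case False
  then obtain t \<tau> where "exec c2 \<sigma> t \<tau>" "t \<le> T" "Q \<tau>" using assms(2) by (auto simp: runs_def)
  with exec.CondFalse[OF False] assms(3) show ?thesis unfolding runs_def by fastforce
qed

primrec loopfree :: "com \<Rightarrow> bool" where
  "loopfree Skip = True"
| "loopfree (NSet x es a) = True"
| "loopfree (RSet x es a) = True"
| "loopfree (Seq c1 c2) = (loopfree c1 \<and> loopfree c2)"
| "loopfree (Cond b c1 c2) = (loopfree c1 \<and> loopfree c2)"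
| "loopfree (While b c) = False"

primrec cost :: "com \<Rightarrow> nat" where
  "cost Skip = 1"
| "cost (NSet x es a) = 1"
| "cost (RSet x es a) = 1"
| "cost (Seq c1 c2) = cost c1 + cost c2"
| "cost (Cond b c1 c2) = 1 + max (cost c1) (cost c2)"
| "cost (While b c) = 0"

primrec step :: "com \<Rightarrow> state \<Rightarrow> state" where
  "step Skip \<sigma> = \<sigma>"
| "step (NSet x es a) \<sigma> = setn x (map (neval \<sigma>) es) (neval \<sigma> a) \<sigma>"
| "step (RSet x es a) \<sigma> = setr x (map (neval \<sigma>) es) (reval \<sigma> a) \<sigma>"
| "step (Seq c1 c2) \<sigma> = step c2 (step c1 \<sigma>)"
| "step (Cond b c1 c2) \<sigma> = (if beval \<sigma> b then step c1 \<sigma> else step c2 \<sigma>)"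
| "step (While b c) \<sigma> = \<sigma>"

lemma exec_step: "loopfree c \<Longrightarrow> \<exists>t \<le> cost c. exec c \<sigma> t (step c \<sigma>)"
proof (induction c arbitrary: \<sigma>)
  case (Seq c1 c2)
  then show ?case by simp (meson add_mono exec.Seq)
next
  case (Cond b c1 c2)
  then obtain t1 t2 where "t1 \<le> cost c1" "exec c1 \<sigma> t1 (step c1 \<sigma>)" "t2 \<le> cost c2" "exec c2 \<sigma> t2 (step c2 \<sigma>)"
    by auto meson
  then have "beval \<sigma> b \<Longrightarrow> exec (Cond b c1 c2) \<sigma> (1 + t1) (step c1 \<sigma>)"
    "\<not> beval \<sigma> b \<Longrightarrow> exec (Cond b c1 c2) \<sigma> (1 + t2) (step c2 \<sigma>)"
    by (blast intro: exec.CondTrue exec.CondFalse)+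
  moreover have "1 + t1 \<le> cost (Cond b c1 c2)" "1 + t2 \<le> cost (Cond b c1 c2)"
    using \<open>t1 \<le> cost c1\<close> \<open>t2 \<le> cost c2\<close> by auto
  ultimately show ?case by (cases "beval \<sigma> b") auto
qed (auto simp: setn_def setr_def intro!: exI[of _ "Suc 0"] exec.Skip[simplified] exec.NSet[simplified] exec.RSet[simplified])

lemma runs_step: "loopfree c \<Longrightarrow> cost c \<le> T \<Longrightarrow> Q (step c \<sigma>) \<Longrightarrow> runs c \<sigma> T Q"
  using exec_step[of c \<sigma>] unfolding runs_def by (meson le_trans)

text \<open>The measure has to drop only if the loop goes on. A last pass that merely detects the
  end may thus leave it unchanged, and up to \<open>\<mu> \<sigma> + 1\<close> passes are
  counted.\<close>

lemma runs_While:
  assumes inv: "I \<sigma>"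
    and step: "\<And>\<tau>. I \<tau> \<Longrightarrow> beval \<tau> b \<Longrightarrow> frame (While b c) \<sigma> \<tau> \<Longrightarrow>
                  runs c \<tau> T (\<lambda>\<tau>'. I \<tau>' \<and> (beval \<tau>' b \<longrightarrow> (\<mu> \<tau>' :: nat) < \<mu> \<tau>))"
  shows "runs (While b c) \<sigma> ((\<mu> \<sigma> + 1) * (T + 1) + 1) (\<lambda>\<tau>. I \<tau> \<and> \<not> beval \<tau> b)"
proof -
  \<comment> \<open>Strengthened for the induction: a state with a false guard needs a single step,
    so no pass is spent on it.\<close>
  have "runs (While b c) \<tau> (if beval \<tau> b then (\<mu> \<tau> + 1) * (T + 1) + 1 else 1) (\<lambda>\<tau>. I \<tau> \<and> \<not> beval \<tau> b)"
    if "I \<tau>" "frame (While b c) \<sigma> \<tau>" for \<tau>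
    using that
  proof (induction "\<mu> \<tau>" arbitrary: \<tau> rule: less_induct)
    case less
    show ?case
    proof (cases "beval \<tau> b")
      case False
      then show ?thesis using less.prems exec.WhileFalse[OF False] by (auto simp: runs_def)
    next
      case True
      obtain t1 \<tau>1 where 1: "exec c \<tau> t1 \<tau>1" "t1 \<le> T" "I \<tau>1" "beval \<tau>1 b \<Longrightarrow> \<mu> \<tau>1 < \<mu> \<tau>"
        using step[OF less.prems(1) True less.prems(2)] by (auto simp: runs_def)
      have fr: "frame (While b c) \<sigma> \<tau>1"
        using less.prems(2) exec_frame[OF 1(1)] by (rule frame_trans) auto
      have "runs (While b c) \<tau>1 (\<mu> \<tau> * (T + 1) + 1) (\<lambda>\<tau>. I \<tau> \<and> \<not> beval \<tau> b)"
      proof (cases "beval \<tau>1 b")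
        case t: True
        have "(\<mu> \<tau>1 + 1) * (T + 1) \<le> \<mu> \<tau> * (T + 1)" using 1(4)[OF t] by (intro mult_right_mono) auto
        then show ?thesis using less.hyps[OF 1(4)[OF t] 1(3) fr] t
          by (auto elim!: runs_conseq)
      next
        case False
        then show ?thesis using 1(3) exec.WhileFalse[OF False]
          unfolding runs_def by (intro exI[of _ 1] exI[of _ \<tau>1]) auto
      qed
      then obtain t2 \<tau>2 where 2: "exec (While b c) \<tau>1 t2 \<tau>2" "t2 \<le> \<mu> \<tau> * (T + 1) + 1" "I \<tau>2 \<and> \<not> beval \<tau>2 b"
        by (auto simp: runs_def)
      have "exec (While b c) \<tau> (1 + t1 + t2) \<tau>2" by (rule exec.WhileTrue) fact+
      moreover have "1 + t1 + t2 \<le> (\<mu> \<tau> + 1) * (T + 1) + 1" using 1(2) 2(2) by simp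
      ultimately show ?thesis using 2(3) True unfolding runs_def by auto
    qed
  qed
  from this[OF inv] show ?thesis by (auto elim!: runs_conseq split: if_splits)
qed

section \<open>Counting loops and sums\<close>

abbreviation nv :: "string \<Rightarrow> nexp" where "nv x \<equiv> NGet x []"
abbreviation rv :: "string \<Rightarrow> rexp" where "rv x \<equiv> RGet x []"
abbreviation na :: "string \<Rightarrow> string \<Rightarrow> nexp" where "na x i \<equiv> NGet x [nv i]"
abbreviation ra :: "string \<Rightarrow> string \<Rightarrow> rexp" where "ra x i \<equiv> RGet x [nv i]"

definition For :: "string \<Rightarrow> nexp \<Rightarrow> com \<Rightarrow> com" where
  "For x N c = Seq (NSet x [] (NConst 0))
     (While (NLess (nv x) N) (Seq c (NSet x [] (NPlus (nv x) (NConst 1)))))"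

lemma vars_For [simp]: "nvars (For x N c) = insert x (nvars c)" "rvars (For x N c) = rvars c"
  by (auto simp: For_def)

lemma runs_For:
  assumes bound: "\<And>\<tau>. frame (For x N c) \<sigma> \<tau> \<Longrightarrow> neval \<tau> N = m"
    and x: "x \<notin> nvars c"
    and init: "I 0 (setn x [] 0 \<sigma>)"
    and step: "\<And>j \<tau>. j < m \<Longrightarrow> I j \<tau> \<Longrightarrow> nmem \<tau> x [] = j \<Longrightarrow> frame (For x N c) \<sigma> \<tau> \<Longrightarrow>
                 runs c \<tau> T (\<lambda>\<tau>'. I (Suc j) (setn x [] (Suc j) \<tau>'))"
    and T: "m * (T + 2) + 3 \<le> T'"
  shows "runs (For x N c) \<sigma> T' (I m)"
proof -
  let ?I = "\<lambda>\<tau>. frame (For x N c) \<sigma> \<tau> \<and> nmem \<tau> x [] \<le> m \<and> I (nmem \<tau> x []) \<tau>"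
  let ?\<sigma> = "setn x [] 0 \<sigma>"
  have "exec (NSet x [] (NConst 0)) \<sigma> 1 ?\<sigma>"
    using exec.NSet[of x "[]" "NConst 0" \<sigma>] by (simp add: setn_def)
  then have fr: "frame (For x N c) \<sigma> ?\<sigma>" by (auto simp: frame_def)
  define W where "W = While (NLess (nv x) N) (Seq c (NSet x [] (NPlus (nv x) (NConst 1))))"
  have W: "runs W ?\<sigma> (m * (T + 2) + 1 + 1) (I m)"
  \<comment> \<open>The measure used below is \<open>m - 1 - x\<close>, which counts exactly
    \<open>m\<close> passes; for \<open>m = 0\<close> truncated subtraction would count one pass too
    many.\<close>
  proof (cases m)
    case 0
    have "\<not> beval ?\<sigma> (NLess (nv x) N)" using bound[OF fr] 0 by simp
    from exec.WhileFalse[OF this, of "Seq c (NSet x [] (NPlus (nv x) (NConst 1)))"] show ?thesis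
      using init 0 by (auto simp: runs_def W_def intro!: exI)
  next
    case (Suc m')
    have "runs W ?\<sigma> (((m - 1 - nmem ?\<sigma> x []) + 1) * ((T + 1) + 1) + 1)
            (\<lambda>\<tau>. ?I \<tau> \<and> \<not> beval \<tau> (NLess (nv x) N))"
      unfolding W_def
    proof (rule runs_While)
      show "?I ?\<sigma>" using fr init by simp
    next
      fix \<tau> assume I: "?I \<tau>" and b: "beval \<tau> (NLess (nv x) N)"
      have lt: "nmem \<tau> x [] < m" using b bound[of \<tau>] I by simp
      show "runs (Seq c (NSet x [] (NPlus (nv x) (NConst 1)))) \<tau> (T + 1)
             (\<lambda>\<tau>'. ?I \<tau>' \<and> (beval \<tau>' (NLess (nv x) N) \<longrightarrow> m - 1 - nmem \<tau>' x [] < m - 1 - nmem \<tau> x []))"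
      proof (rule runs_Seq[OF step[OF lt _ refl]])
        fix \<tau>1 assume I1: "I (Suc (nmem \<tau> x [])) (setn x [] (Suc (nmem \<tau> x [])) \<tau>1)" and fr1: "frame c \<tau> \<tau>1"
        have xx: "nmem \<tau>1 x = nmem \<tau> x" using frame_nmem[OF fr1 x] .
        have "frame (For x N c) \<sigma> \<tau>1" using I fr1 by (auto intro: frame_trans)
        then have fr2: "frame (For x N c) \<sigma> (setn x [] (Suc (nmem \<tau> x [])) \<tau>1)" by (auto simp: frame_def)
        show "runs (NSet x [] (NPlus (nv x) (NConst 1))) \<tau>1 1
             (\<lambda>\<tau>'. ?I \<tau>' \<and> (beval \<tau>' (NLess (nv x) N) \<longrightarrow> m - 1 - nmem \<tau>' x [] < m - 1 - nmem \<tau> x []))"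
          using I1 fr2 lt bound[OF fr2] xx by (intro runs_step) auto
      qed (use I in auto)
    qed
    then show ?thesis by (rule runs_conseq) (use Suc bound in \<open>auto simp: not_less\<close>)
  qed
  show ?thesis unfolding For_def W_def[symmetric]
  proof (rule runs_Seq)
    show "runs (NSet x [] (NConst 0)) \<sigma> 1 (\<lambda>\<tau>. \<tau> = ?\<sigma>)" by (intro runs_step) auto
    show "runs W \<tau> (m * (T + 2) + 1 + 1) (I m)" if "\<tau> = ?\<sigma>" for \<tau> using W that by simp
  qed (use T in simp)
qed

definition nsum :: "string \<Rightarrow> nexp \<Rightarrow> string \<Rightarrow> bexp \<Rightarrow> nexp \<Rightarrow> com" where
  "nsum x N acc b e = Seq (NSet acc [] (NConst 0))
     (For x N (Cond b (NSet acc [] (NPlus (nv acc) e)) Skip))"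

definition rsum :: "string \<Rightarrow> nexp \<Rightarrow> string \<Rightarrow> rexp \<Rightarrow> bexp \<Rightarrow> rexp \<Rightarrow> com" where
  "rsum x N acc e0 b e = Seq (RSet acc [] e0)
     (For x N (Cond b (RSet acc [] (RPlus (rv acc) e)) Skip))"

lemma vars_sum [simp]:
  "nvars (nsum x N acc b e) = {x, acc}" "rvars (nsum x N acc b e) = {}"
  "nvars (rsum x N acc e0 b r) = {x}" "rvars (rsum x N acc e0 b r) = {acc}"
  by (auto simp: nsum_def rsum_def)

lemma sum_filter_Suc:
  fixes f :: "nat \<Rightarrow> 'a :: comm_monoid_add"
  shows "(\<Sum>i\<in>{i. i < Suc j \<and> P i}. f i) = (\<Sum>i\<in>{i. i < j \<and> P i}. f i) + (if P j then f j else 0)"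
proof (cases "P j")
  case True
  then have "{i. i < Suc j \<and> P i} = insert j {i. i < j \<and> P i}" by (auto simp: less_Suc_eq)
  then show ?thesis using True by (simp add: add.commute)
next
  case False
  then have "{i. i < Suc j \<and> P i} = {i. i < j \<and> P i}" by (auto simp: less_Suc_eq)
  then show ?thesis using False by simp
qed

lemma runs_nsum:
  fixes f :: "nat \<Rightarrow> nat"
  assumes "acc \<noteq> x"
    and bound: "\<And>\<tau>. frame (nsum x N acc b e) \<sigma> \<tau> \<Longrightarrow> neval \<tau> N = m"
    and body: "\<And>j \<tau>. j < m \<Longrightarrow> nmem \<tau> x [] = j \<Longrightarrow> frame (nsum x N acc b e) \<sigma> \<tau> \<Longrightarrow>
                 (beval \<tau> b \<longleftrightarrow> P j) \<and> (P j \<longrightarrow> neval \<tau> e = f j)"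
    and "4 * m + 4 \<le> T"
  shows "runs (nsum x N acc b e) \<sigma> T (\<lambda>\<tau>. nmem \<tau> acc [] = (\<Sum>i\<in>{i. i < m \<and> P i}. f i))"
  unfolding nsum_def
proof (rule runs_Seq)
  let ?\<sigma> = "setn acc [] 0 \<sigma>"
  show "runs (NSet acc [] (NConst 0)) \<sigma> 1 (\<lambda>\<tau>. \<tau> = ?\<sigma>)" by (intro runs_step) auto
  fix \<tau> assume [simp]: "\<tau> = ?\<sigma>"
  let ?F = "For x N (Cond b (NSet acc [] (NPlus (nv acc) e)) Skip)"
  have fr: "frame (nsum x N acc b e) \<sigma> \<tau>'" if "frame ?F \<tau> \<tau>'" for \<tau>'
    using that by (auto simp: frame_def)
  show "runs ?F \<tau> (m * (2 + 2) + 3) (\<lambda>\<tau>. nmem \<tau> acc [] = (\<Sum>i\<in>{i. i < m \<and> P i}. f i))"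
  proof (rule runs_For[where I = "\<lambda>j \<tau>. nmem \<tau> acc [] = (\<Sum>i\<in>{i. i < j \<and> P i}. f i)"])
    fix j \<tau>' assume "j < m" "nmem \<tau>' acc [] = (\<Sum>i\<in>{i. i < j \<and> P i}. f i)" "nmem \<tau>' x [] = j"
      and "frame ?F \<tau> \<tau>'"
    then show "runs (Cond b (NSet acc [] (NPlus (nv acc) e)) Skip) \<tau>' 2
       (\<lambda>\<tau>'. nmem (setn x [] (Suc j) \<tau>') acc [] = (\<Sum>i\<in>{i. i < Suc j \<and> P i}. f i))"
      using body[OF _ _ fr, of j \<tau>'] assms(1) by (intro runs_step) (auto simp: sum_filter_Suc)
  qed (use assms(1) bound fr in auto)
qed (use assms in simp)

lemma runs_rsum:
  fixes f :: "nat \<Rightarrow> real"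
  assumes bound: "\<And>\<tau>. frame (rsum x N acc e0 b e) \<sigma> \<tau> \<Longrightarrow> neval \<tau> N = m"
    and body: "\<And>j \<tau>. j < m \<Longrightarrow> nmem \<tau> x [] = j \<Longrightarrow> frame (rsum x N acc e0 b e) \<sigma> \<tau> \<Longrightarrow>
                 (beval \<tau> b \<longleftrightarrow> P j) \<and> (P j \<longrightarrow> reval \<tau> e = f j)"
    and "4 * m + 4 \<le> T"
  shows "runs (rsum x N acc e0 b e) \<sigma> T
           (\<lambda>\<tau>. rmem \<tau> acc [] = reval \<sigma> e0 + (\<Sum>i\<in>{i. i < m \<and> P i}. f i))"
  unfolding rsum_def
proof (rule runs_Seq)
  let ?\<sigma> = "setr acc [] (reval \<sigma> e0) \<sigma>"
  show "runs (RSet acc [] e0) \<sigma> 1 (\<lambda>\<tau>. \<tau> = ?\<sigma>)" by (intro runs_step) auto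
  fix \<tau> assume [simp]: "\<tau> = ?\<sigma>"
  let ?F = "For x N (Cond b (RSet acc [] (RPlus (rv acc) e)) Skip)"
  have fr: "frame (rsum x N acc e0 b e) \<sigma> \<tau>'" if "frame ?F \<tau> \<tau>'" for \<tau>'
    using that by (auto simp: frame_def)
  show "runs ?F \<tau> (m * (2 + 2) + 3) (\<lambda>\<tau>. rmem \<tau> acc [] = reval \<sigma> e0 + (\<Sum>i\<in>{i. i < m \<and> P i}. f i))"
  proof (rule runs_For[where I = "\<lambda>j \<tau>. rmem \<tau> acc [] = reval \<sigma> e0 + (\<Sum>i\<in>{i. i < j \<and> P i}. f i)"])
    fix j \<tau>' assume "j < m" "rmem \<tau>' acc [] = reval \<sigma> e0 + (\<Sum>i\<in>{i. i < j \<and> P i}. f i)" "nmem \<tau>' x [] = j"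
      and "frame ?F \<tau> \<tau>'"
    then show "runs (Cond b (RSet acc [] (RPlus (rv acc) e)) Skip) \<tau>' 2
       (\<lambda>\<tau>'. rmem (setn x [] (Suc j) \<tau>') acc [] = reval \<sigma> e0 + (\<Sum>i\<in>{i. i < Suc j \<and> P i}. f i))"
      using body[OF _ _ fr, of j \<tau>'] by (intro runs_step) (auto simp: sum_filter_Suc)
  qed (use bound fr in auto)
qed (use assms in simp)

section \<open>The local search program\<close>

text \<open>Nested loops of arbitrary depth need one literal name per counter. Strings of
  \<open>m + 1\<close> letters z are distinct and clash with no other name of the program.\<close>

definition zname :: "nat \<Rightarrow> string" where "zname m = CHR ''z'' # replicate m CHR ''z''"

lemma zname_neq [simp]:
  "zname m \<noteq> ''n''" "zname m \<noteq> ''adj''" "zname m \<noteq> ''p''" "zname m \<noteq> ''sq''" "zname m \<noteq> ''in''"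
  "zname m \<noteq> ''ch''" "zname m \<noteq> ''i''" "zname m \<noteq> ''su''" "zname m \<noteq> ''sk''" "zname m \<noteq> ''out''"
  "zname m \<noteq> ''g''" "zname m = zname m' \<longleftrightarrow> m = m'"
  by (auto simp: zname_def)

lemma zname_neq' [simp]:
  "''n'' \<noteq> zname m" "''adj'' \<noteq> zname m" "''p'' \<noteq> zname m" "''sq'' \<noteq> zname m" "''in'' \<noteq> zname m"
  "''ch'' \<noteq> zname m" "''i'' \<noteq> zname m" "''su'' \<noteq> zname m" "''sk'' \<noteq> zname m" "''out'' \<noteq> zname m"
  "''g'' \<noteq> zname m"
  by (auto simp: zname_def)

lemma zname_notin [simp]:
  "''n'' \<notin> zname ` S" "''adj'' \<notin> zname ` S" "''p'' \<notin> zname ` S" "''sq'' \<notin> zname ` S"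
  "''out'' \<notin> zname ` S" "''g'' \<notin> zname ` S"
  by auto

definition disj :: "bexp \<Rightarrow> bexp \<Rightarrow> bexp" where "disj b c = Neg (Conj (Neg b) (Neg c))"

definition eqb :: "nexp \<Rightarrow> nexp \<Rightarrow> bexp" where "eqb x y = Conj (Neg (NLess x y)) (Neg (NLess y x))"

abbreviation posb :: "nexp \<Rightarrow> bexp" where "posb x \<equiv> NLess (NConst 0) x"

text \<open>A disjunction unrolled when the program is written. Its size depends on \<open>d\<close>
  only, so the test may fairly cost one unit.\<close>

primrec bex :: "nat \<Rightarrow> (nat \<Rightarrow> bexp) \<Rightarrow> bexp" where
  "bex 0 f = NLess (NConst 0) (NConst 0)"
| "bex (Suc m) f = disj (f m) (bex m f)"

lemma beval_disj [simp]: "beval \<sigma> (disj b c) \<longleftrightarrow> beval \<sigma> b \<or> beval \<sigma> c"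
  and beval_eqb [simp]: "beval \<sigma> (eqb x y) \<longleftrightarrow> neval \<sigma> x = neval \<sigma> y"
  by (auto simp: disj_def eqb_def)

lemma beval_bex [simp]: "beval \<sigma> (bex m f) \<longleftrightarrow> (\<exists>j<m. beval \<sigma> (f j))"
  by (induction m) (auto simp: less_Suc_eq)

definition eligible_test :: bexp where
  "eligible_test = Conj (Neg (posb (NGet ''adj'' [nv ''g'', nv ''i''])))
     (Conj (Neg (eqb (nv ''i'') (nv ''g''))) (Neg (RLess (ra ''w'' ''g'') (ra ''w'' ''i''))))"

text \<open>Integer division by repeated addition: \<open>acc\<close> runs through the multiples of
  the weight of \<open>g\<close>, and \<open>k\<close> remembers the last one that does not exceed
  \<open>r\<close>.\<close>

definition divide :: com where
  "divide = Seq (RSet ''acc'' [] (RNat (NConst 0)))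
     (For ''j'' (NPlus (nv ''n'') (nv ''n'')) (Seq (RSet ''acc'' [] (RPlus (rv ''acc'') (ra ''w'' ''g'')))
        (Cond (Neg (RLess (rv ''r'') (rv ''acc''))) (NSet ''k'' [] (NPlus (nv ''j'') (NConst 1))) Skip)))"

text \<open>Both the numerator \<open>2 * n * w i\<close> and the square of the quotient come from
  repeated addition. Ineligible vertices keep the value 0, which \<open>admissible\<close> treats as
  forbidden.\<close>

definition scale_one :: com where
  "scale_one = Seq (NSet ''k'' [] (NConst 0))
     (Seq (Cond eligible_test
         (Seq (rsum ''j'' (NPlus (nv ''n'') (nv ''n'')) ''r'' (RNat (NConst 0)) (posb (NConst 1)) (ra ''w'' ''i''))
           divide) Skip)
     (Seq (nsum ''j'' (nv ''k'') ''q'' (posb (NConst 1)) (nv ''k''))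
     (Seq (NSet ''p'' [nv ''i''] (nv ''k'')) (NSet ''sq'' [nv ''i''] (nv ''q'')))))"

definition scale :: com where "scale = For ''i'' (nv ''n'') scale_one"

definition chosen :: "nat \<Rightarrow> bexp" where
  "chosen s = bex s (\<lambda>j. eqb (nv ''i'') (nv (zname j)))"

definition touched :: "nat \<Rightarrow> bexp" where
  "touched s = bex s (\<lambda>j. disj (eqb (nv ''i'') (nv (zname j))) (posb (NGet ''adj'' [nv ''i'', nv (zname j)])))"

definition admissible :: "nat \<Rightarrow> bexp" where
  "admissible s = Neg (bex s (\<lambda>j. disj (Neg (posb (na ''p'' (zname j))))
     (bex s (\<lambda>l. posb (NGet ''adj'' [nv (zname j), nv (zname l)])))))"

text \<open>The new entry of \<open>i\<close> depends only on the tuple and on the old entry of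
  \<open>i\<close>, so the array can be overwritten in place.\<close>

definition exchange_loop :: "nat \<Rightarrow> com" where
  "exchange_loop s = For ''i'' (nv ''n'')
     (Cond (chosen s) (NSet ''in'' [nv ''i''] (NConst 1))
       (Cond (touched s) (NSet ''in'' [nv ''i''] (NConst 0)) Skip))"

text \<open>Both sums run over vertices and not over positions of the tuple. A repeated entry is
  thus counted once, and tuples of length \<open>s\<close> also represent smaller sets.\<close>

definition try_exchange :: "nat \<Rightarrow> com" where
  "try_exchange s = Seq (nsum ''i'' (nv ''n'') ''su'' (chosen s) (na ''sq'' ''i''))
     (Seq (nsum ''i'' (nv ''n'') ''sk'' (Conj (posb (na ''in'' ''i'')) (touched s)) (na ''sq'' ''i''))
     (Cond (Conj (admissible s) (NLess (nv ''sk'') (nv ''su'')))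
       (Seq (exchange_loop s) (NSet ''ch'' [] (NConst 1))) Skip))"

primrec loops :: "nat \<Rightarrow> com \<Rightarrow> com" where
  "loops 0 c = c"
| "loops (Suc m) c = For (zname m) (nv ''n'') (loops m c)"

text \<open>One pass tries all tuples and may exchange several times; a pass that leaves
  \<open>ch\<close> at 0 certifies local optimality.\<close>

definition search :: "nat \<Rightarrow> com" where
  "search s = Seq (For ''i'' (nv ''n'') (NSet ''in'' [nv ''i''] (NConst 0)))
     (Seq (NSet ''ch'' [] (NConst 1))
       (While (posb (nv ''ch'')) (Seq (NSet ''ch'' [] (NConst 0)) (loops s (try_exchange s)))))"

text \<open>Solutions for different \<open>g\<close> are compared by their original weights, as each
  \<open>g\<close> has its own unit of rounding.\<close>

definition update :: com where
  "update = Seq (rsum ''i'' (nv ''n'') ''val'' (ra ''w'' ''g'') (posb (na ''in'' ''i'')) (ra ''w'' ''i''))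
     (Cond (RLess (rv ''best'') (rv ''val''))
       (Seq (RSet ''best'' [] (rv ''val''))
       (Seq (For ''i'' (nv ''n'') (NSet ''out'' [nv ''i''] (na ''in'' ''i''))) (NSet ''out'' [nv ''g''] (NConst 1)))) Skip)"

definition mwis :: "nat \<Rightarrow> com" where
  "mwis s = Seq (RSet ''best'' [] (RNat (NConst 0)))
     (For ''g'' (nv ''n'') (Seq scale (Seq (search s) update)))"

lemma vars_divide [simp]: "nvars divide = {''j'', ''k''}" "rvars divide = {''acc''}"
  by (auto simp: divide_def)

lemma vars_scale_one [simp]:
  "nvars scale_one = {''j'', ''k'', ''q'', ''p'', ''sq''}" "rvars scale_one = {''acc'', ''r''}"
  by (auto simp: scale_one_def)

lemma vars_scale [simp]:
  "nvars scale = {''i'', ''j'', ''k'', ''q'', ''p'', ''sq''}" "rvars scale = {''acc'', ''r''}"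
  by (auto simp: scale_def)

lemma vars_exchange_loop [simp]: "nvars (exchange_loop s) = {''i'', ''in''}" "rvars (exchange_loop s) = {}"
  by (auto simp: exchange_loop_def)

lemma vars_try_exchange [simp]:
  "nvars (try_exchange s) = {''i'', ''su'', ''sk'', ''in'', ''ch''}" "rvars (try_exchange s) = {}"
  by (auto simp: try_exchange_def)

lemma vars_loops [simp]: "nvars (loops m c) = zname ` {..<m} \<union> nvars c" "rvars (loops m c) = rvars c"
  by (induction m) (auto simp: lessThan_Suc)

lemma vars_search [simp]:
  "nvars (search s) = zname ` {..<s} \<union> {''i'', ''su'', ''sk'', ''in'', ''ch''}" "rvars (search s) = {}"
  by (auto simp: search_def)

lemma vars_update [simp]: "nvars update = {''i'', ''out''}" "rvars update = {''val'', ''best''}"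
  by (auto simp: update_def)

section \<open>Exchanges and the potential\<close>

locale indexed_graph =
  fixes n :: nat and a :: "nat \<Rightarrow> nat \<Rightarrow> bool"
  assumes a_sym: "a i j \<Longrightarrow> a j i" and a_irrefl: "\<not> a i i"
begin

definition indep :: "nat set \<Rightarrow> bool" where
  "indep X \<longleftrightarrow> X \<subseteq> {..<n} \<and> (\<forall>i\<in>X. \<forall>j\<in>X. \<not> a i j)"

text \<open>Vertices of \<open>U\<close> are near \<open>U\<close>, so those already in the solution
  appear on both sides of the comparison in \<open>improves\<close> and cancel.\<close>

definition near :: "nat set \<Rightarrow> nat \<Rightarrow> bool" where
  "near U i \<longleftrightarrow> i \<in> U \<or> (\<exists>u\<in>U. a i u)"

definition improves :: "(nat \<Rightarrow> nat) \<Rightarrow> nat set \<Rightarrow> nat set \<Rightarrow> bool" where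
  "improves p A U \<longleftrightarrow> indep U \<and> (\<forall>u\<in>U. p u > 0) \<and>
     (\<Sum>i\<in>{i \<in> A. near U i}. (p i)\<^sup>2) < (\<Sum>i\<in>U. (p i)\<^sup>2)"

definition exchanged :: "nat set \<Rightarrow> nat set \<Rightarrow> nat set" where
  "exchanged A U = {i \<in> A. \<not> near U i} \<union> U"

definition locally_optimal :: "nat \<Rightarrow> (nat \<Rightarrow> nat) \<Rightarrow> nat set \<Rightarrow> bool" where
  "locally_optimal s p A \<longleftrightarrow> (\<forall>f. (\<forall>j<s. f j < n) \<longrightarrow> \<not> improves p A (f ` {..<s}))"

definition potential :: "(nat \<Rightarrow> nat) \<Rightarrow> nat set \<Rightarrow> nat" where
  "potential p X = (\<Sum>i\<in>X. (p i)\<^sup>2)"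

lemma indep_finite: "indep X \<Longrightarrow> finite X"
  unfolding indep_def using finite_subset by blast

lemma indep_subset: "indep X \<Longrightarrow> Y \<subseteq> X \<Longrightarrow> indep Y"
  unfolding indep_def by blast

lemma indep_exchanged:
  assumes "indep A" "improves p A U"
  shows "indep (exchanged A U)"
  unfolding indep_def
proof (intro conjI ballI)
  show "exchanged A U \<subseteq> {..<n}" using assms by (auto simp: indep_def improves_def exchanged_def)
  fix i j assume ij: "i \<in> exchanged A U" "j \<in> exchanged A U"
  have A: "x \<in> A \<Longrightarrow> y \<in> A \<Longrightarrow> \<not> a x y" and U: "x \<in> U \<Longrightarrow> y \<in> U \<Longrightarrow> \<not> a x y" for x y
    using assms by (auto simp: indep_def improves_def)
  consider "i \<in> U" "j \<in> U" | "i \<in> A" "j \<in> A" | "\<not> near U i" "j \<in> U" | "\<not> near U j" "i \<in> U"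
    using ij by (auto simp: exchanged_def)
  then show "\<not> a i j"
    by cases (use A U a_sym[of i j] in \<open>auto simp: near_def\<close>)
qed

text \<open>Potentials are natural numbers, so each exchange gains at least 1; with
  \<open>potential_le\<close> this bounds the number of exchanges.\<close>

lemma potential_exchanged:
  assumes "indep A" "improves p A U"
  shows "potential p A < potential p (exchanged A U)"
proof -
  have fin: "finite A" "finite U" using assms indep_finite by (auto simp: improves_def)
  have "potential p A = (\<Sum>i\<in>{i \<in> A. near U i}. (p i)\<^sup>2) + (\<Sum>i\<in>{i \<in> A. \<not> near U i}. (p i)\<^sup>2)"
    unfolding potential_def using fin by (subst sum.union_disjoint[symmetric]) (auto intro: sum.cong)
  also have "\<dots> < (\<Sum>i\<in>U. (p i)\<^sup>2) + (\<Sum>i\<in>{i \<in> A. \<not> near U i}. (p i)\<^sup>2)"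
    using assms(2) by (simp add: improves_def)
  also have "\<dots> = potential p (exchanged A U)"
    unfolding potential_def exchanged_def using fin
    by (subst sum.union_disjoint) (auto simp: near_def)
  finally show ?thesis .
qed

lemma potential_le:
  assumes "indep X" "\<And>i. i < n \<Longrightarrow> p i \<le> m"
  shows "potential p X \<le> n * m\<^sup>2"
proof -
  have "potential p X \<le> (\<Sum>i<n. (p i)\<^sup>2)"
    unfolding potential_def using assms(1) by (intro sum_mono2) (auto simp: indep_def)
  also have "\<dots> \<le> (\<Sum>i<n. m\<^sup>2)" using assms(2) by (intro sum_mono power_mono) auto
  finally show ?thesis by simp
qed

section \<open>Reading graphs, weights and solutions off the memory\<close>

definition graph_state :: "state \<Rightarrow> bool" where
  "graph_state \<sigma> \<longleftrightarrow> nmem \<sigma> ''n'' [] = n \<and> (\<forall>i<n. \<forall>j<n. nmem \<sigma> ''adj'' [i, j] > 0 \<longleftrightarrow> a i j)"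

definition scaled_state :: "(nat \<Rightarrow> nat) \<Rightarrow> state \<Rightarrow> bool" where
  "scaled_state p \<sigma> \<longleftrightarrow> (\<forall>i<n. nmem \<sigma> ''p'' [i] = p i \<and> nmem \<sigma> ''sq'' [i] = (p i)\<^sup>2)"

definition members :: "string \<Rightarrow> state \<Rightarrow> nat set" where
  "members x \<sigma> = {i. i < n \<and> nmem \<sigma> x [i] > 0}"

definition tuple :: "nat \<Rightarrow> state \<Rightarrow> nat set" where
  "tuple s \<sigma> = (\<lambda>j. nmem \<sigma> (zname j) []) ` {..<s}"

lemma graph_state_frame:
  "graph_state \<sigma> \<Longrightarrow> frame c \<sigma> \<tau> \<Longrightarrow> ''n'' \<notin> nvars c \<Longrightarrow> ''adj'' \<notin> nvars c \<Longrightarrow> graph_state \<tau>"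
  by (simp add: graph_state_def frame_nmem)

lemma scaled_state_frame:
  "scaled_state p \<sigma> \<Longrightarrow> frame c \<sigma> \<tau> \<Longrightarrow> ''p'' \<notin> nvars c \<Longrightarrow> ''sq'' \<notin> nvars c \<Longrightarrow> scaled_state p \<tau>"
  by (simp add: scaled_state_def frame_nmem)

lemma members_frame: "frame c \<sigma> \<tau> \<Longrightarrow> x \<notin> nvars c \<Longrightarrow> members x \<tau> = members x \<sigma>"
  by (simp add: members_def frame_nmem)

lemma tuple_frame: "frame c \<sigma> \<tau> \<Longrightarrow> (\<And>j. j < s \<Longrightarrow> zname j \<notin> nvars c) \<Longrightarrow> tuple s \<tau> = tuple s \<sigma>"
  by (auto simp: tuple_def frame_nmem image_def)

lemma beval_chosen: "nmem \<tau> ''i'' [] = i \<Longrightarrow> beval \<tau> (chosen s) \<longleftrightarrow> i \<in> tuple s \<tau>"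
  by (auto simp: chosen_def tuple_def)

lemma adj_test:
  "graph_state \<tau> \<Longrightarrow> i < n \<Longrightarrow> j < n \<Longrightarrow> 0 < nmem \<tau> ''adj'' [i, j] \<longleftrightarrow> a i j"
  by (simp add: graph_state_def)

lemma tuple_entry: "tuple s \<tau> \<subseteq> {..<n} \<Longrightarrow> j < s \<Longrightarrow> nmem \<tau> (zname j) [] < n"
  by (auto simp: tuple_def)

lemma beval_touched:
  assumes "graph_state \<tau>" "nmem \<tau> ''i'' [] = i" "i < n" "tuple s \<tau> \<subseteq> {..<n}"
  shows "beval \<tau> (touched s) \<longleftrightarrow> near (tuple s \<tau>) i"
proof -
  have "beval \<tau> (touched s) \<longleftrightarrow> (\<exists>j<s. i = nmem \<tau> (zname j) [] \<or> 0 < nmem \<tau> ''adj'' [i, nmem \<tau> (zname j) []])"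
    using assms(2) by (simp add: touched_def)
  also have "\<dots> \<longleftrightarrow> (\<exists>j<s. i = nmem \<tau> (zname j) [] \<or> a i (nmem \<tau> (zname j) []))"
    using adj_test[OF assms(1,3) tuple_entry[OF assms(4)]] by auto
  finally show ?thesis by (auto simp: near_def tuple_def)
qed

lemma beval_admissible:
  assumes "graph_state \<tau>" "scaled_state p \<tau>" "tuple s \<tau> \<subseteq> {..<n}"
  shows "beval \<tau> (admissible s) \<longleftrightarrow> indep (tuple s \<tau>) \<and> (\<forall>u\<in>tuple s \<tau>. p u > 0)"
proof -
  note z = tuple_entry[OF assms(3)]
  have p: "nmem \<tau> ''p'' [nmem \<tau> (zname j) []] = p (nmem \<tau> (zname j) [])" if "j < s" for j
    using assms(2) z[OF that] by (simp add: scaled_state_def)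
  have "beval \<tau> (admissible s) \<longleftrightarrow> (\<forall>j<s. 0 < nmem \<tau> ''p'' [nmem \<tau> (zname j) []] \<and>
      (\<forall>l<s. \<not> 0 < nmem \<tau> ''adj'' [nmem \<tau> (zname j) [], nmem \<tau> (zname l) []]))"
    by (simp add: admissible_def del: not_gr_zero)
  also have "\<dots> \<longleftrightarrow> (\<forall>j<s. 0 < p (nmem \<tau> (zname j) []) \<and>
      (\<forall>l<s. \<not> a (nmem \<tau> (zname j) []) (nmem \<tau> (zname l) [])))"
    using adj_test[OF assms(1) z z] p by (metis (no_types, lifting))
  finally show ?thesis using z by (auto simp: indep_def tuple_def)
qed

lemma runs_exchange_loop:
  assumes g: "graph_state \<sigma>" and z: "tuple s \<sigma> \<subseteq> {..<n}" and T: "5 * n + 3 \<le> T"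
  shows "runs (exchange_loop s) \<sigma> T
           (\<lambda>\<tau>. members ''in'' \<tau> = exchanged (members ''in'' \<sigma>) (tuple s \<sigma>))"
proof -
  let ?A = "members ''in'' \<sigma>" and ?U = "tuple s \<sigma>"
  have m: "i < n \<Longrightarrow> i \<in> exchanged ?A ?U \<longleftrightarrow> i \<in> ?U \<or> (i \<in> ?A \<and> \<not> near ?U i)" for i
    by (auto simp: exchanged_def)
  have "runs (exchange_loop s) \<sigma> T
     (\<lambda>\<tau>. \<forall>x<n. nmem \<tau> ''in'' [x] > 0 \<longleftrightarrow> (if x < n then x \<in> exchanged ?A ?U else x \<in> ?A))"
    unfolding exchange_loop_def
  proof (rule runs_For[where m = n and I = "\<lambda>i \<tau>. \<forall>x<n. nmem \<tau> ''in'' [x] > 0 \<longleftrightarrow> (if x < i then x \<in> exchanged ?A ?U else x \<in> ?A)"])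
    fix j \<tau>
    assume j: "j < n" and I: "\<forall>x<n. nmem \<tau> ''in'' [x] > 0 \<longleftrightarrow> (if x < j then x \<in> exchanged ?A ?U else x \<in> ?A)"
      and i: "nmem \<tau> ''i'' [] = j" and "frame (For ''i'' (nv ''n'') (Cond (chosen s) (NSet ''in'' [nv ''i''] (NConst 1))
       (Cond (touched s) (NSet ''in'' [nv ''i''] (NConst 0)) Skip))) \<sigma> \<tau>"
    then have fr: "frame (exchange_loop s) \<sigma> \<tau>" by (simp add: exchange_loop_def)
    have gt: "graph_state \<tau>" using graph_state_frame[OF g fr] by simp
    have u: "tuple s \<tau> = ?U" using tuple_frame[OF fr] by simp
    have c: "beval \<tau> (chosen s) \<longleftrightarrow> j \<in> ?U" "beval \<tau> (touched s) \<longleftrightarrow> near ?U j"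
      using beval_chosen[OF i] beval_touched[OF gt i j] z u by auto
    show "runs (Cond (chosen s) (NSet ''in'' [nv ''i''] (NConst 1))
       (Cond (touched s) (NSet ''in'' [nv ''i''] (NConst 0)) Skip)) \<tau> 3
       (\<lambda>\<tau>'. \<forall>x<n. nmem (setn ''i'' [] (Suc j) \<tau>') ''in'' [x] > 0 \<longleftrightarrow>
            (if x < Suc j then x \<in> exchanged ?A ?U else x \<in> ?A))"
      using I i j c by (intro runs_step) (auto simp: m less_Suc_eq)
  qed (use g T in \<open>auto simp: graph_state_def frame_nmem members_def\<close>)
  then show ?thesis
    by (rule runs_conseq) (auto simp: members_def exchanged_def dest: subsetD[OF z])
qed

lemma runs_try_exchange:
  assumes g: "graph_state \<sigma>" and p: "scaled_state p \<sigma>" and z: "tuple s \<sigma> \<subseteq> {..<n}"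
    and T: "13 * n + 13 \<le> T"
  shows "runs (try_exchange s) \<sigma> T (\<lambda>\<tau>.
     if improves p (members ''in'' \<sigma>) (tuple s \<sigma>)
     then members ''in'' \<tau> = exchanged (members ''in'' \<sigma>) (tuple s \<sigma>) \<and> nmem \<tau> ''ch'' [] = 1
     else members ''in'' \<tau> = members ''in'' \<sigma> \<and> nmem \<tau> ''ch'' [] = nmem \<sigma> ''ch'' [])"
  (is "runs _ _ _ ?Q")
proof -
  let ?A = "members ''in'' \<sigma>" and ?U = "tuple s \<sigma>"
  let ?s1 = "nsum ''i'' (nv ''n'') ''su'' (chosen s) (na ''sq'' ''i'')"
  let ?s2 = "nsum ''i'' (nv ''n'') ''sk'' (Conj (posb (na ''in'' ''i'')) (touched s)) (na ''sq'' ''i'')"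
  have U: "?U = {i. i < n \<and> i \<in> ?U}" using z by auto
  show ?thesis unfolding try_exchange_def
  proof (rule runs_Seq)
    show "runs ?s1 \<sigma> (4 * n + 4) (\<lambda>\<tau>. nmem \<tau> ''su'' [] = (\<Sum>i\<in>{i. i < n \<and> i \<in> ?U}. (p i)\<^sup>2))"
    proof (rule runs_nsum)
      fix j \<tau> assume j: "j < n" "nmem \<tau> ''i'' [] = j" and fr: "frame ?s1 \<sigma> \<tau>"
      show "(beval \<tau> (chosen s) \<longleftrightarrow> j \<in> ?U) \<and> (j \<in> ?U \<longrightarrow> neval \<tau> (na ''sq'' ''i'') = (p j)\<^sup>2)"
        using beval_chosen[OF j(2)] tuple_frame[OF fr, of s] scaled_state_frame[OF p fr] j
        by (simp add: scaled_state_def)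
    qed (use g in \<open>auto simp: graph_state_def frame_nmem\<close>)
  next
    fix \<tau>1 assume su: "nmem \<tau>1 ''su'' [] = (\<Sum>i\<in>{i. i < n \<and> i \<in> ?U}. (p i)\<^sup>2)" and fr1: "frame ?s1 \<sigma> \<tau>1"
    have g1: "graph_state \<tau>1" "scaled_state p \<tau>1" "tuple s \<tau>1 = ?U" "members ''in'' \<tau>1 = ?A"
      using graph_state_frame[OF g fr1] scaled_state_frame[OF p fr1] tuple_frame[OF fr1, of s]
        members_frame[OF fr1, of "''in''"] by auto
    show "runs (Seq ?s2 (Cond (Conj (admissible s) (NLess (nv ''sk'') (nv ''su'')))
       (Seq (exchange_loop s) (NSet ''ch'' [] (NConst 1))) Skip)) \<tau>1 (9 * n + 9) ?Q"
    proof (rule runs_Seq)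
      show "runs ?s2 \<tau>1 (4 * n + 4) (\<lambda>\<tau>. nmem \<tau> ''sk'' [] = (\<Sum>i\<in>{i. i < n \<and> (i \<in> ?A \<and> near ?U i)}. (p i)\<^sup>2))"
      proof (rule runs_nsum)
        fix j \<tau> assume j: "j < n" "nmem \<tau> ''i'' [] = j" and fr: "frame ?s2 \<tau>1 \<tau>"
        have "tuple s \<tau> = ?U" "members ''in'' \<tau> = ?A" "graph_state \<tau>" "scaled_state p \<tau>"
          using tuple_frame[OF fr, of s] g1 graph_state_frame[OF g1(1) fr] scaled_state_frame[OF g1(2) fr]
            members_frame[OF fr, of "''in''"] by auto
        then show "(beval \<tau> (Conj (posb (na ''in'' ''i'')) (touched s)) \<longleftrightarrow> j \<in> ?A \<and> near ?U j) \<and>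
            (j \<in> ?A \<and> near ?U j \<longrightarrow> neval \<tau> (na ''sq'' ''i'') = (p j)\<^sup>2)"
          using beval_touched[of \<tau> j s] j z by (auto simp: scaled_state_def members_def)
      qed (use g1 in \<open>auto simp: graph_state_def frame_nmem\<close>)
    next
      fix \<tau>2 assume sk: "nmem \<tau>2 ''sk'' [] = (\<Sum>i\<in>{i. i < n \<and> (i \<in> ?A \<and> near ?U i)}. (p i)\<^sup>2)"
        and fr2: "frame ?s2 \<tau>1 \<tau>2"
      have g2: "graph_state \<tau>2" "scaled_state p \<tau>2" "tuple s \<tau>2 = ?U" "members ''in'' \<tau>2 = ?A"
          "nmem \<tau>2 ''su'' = nmem \<tau>1 ''su''" "nmem \<tau>2 ''ch'' = nmem \<sigma> ''ch''"
        using graph_state_frame[OF g1(1) fr2] scaled_state_frame[OF g1(2) fr2] tuple_frame[OF fr2, of s]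
          members_frame[OF fr2, of "''in''"] frame_nmem[OF fr2] frame_nmem[OF fr1] g1 by auto
      have A: "{i. i < n \<and> (i \<in> ?A \<and> near ?U i)} = {i \<in> ?A. near ?U i}" by (auto simp: members_def)
      have imp: "beval \<tau>2 (Conj (admissible s) (NLess (nv ''sk'') (nv ''su''))) \<longleftrightarrow> improves p ?A ?U"
        using beval_admissible[OF g2(1,2)] z su sk g2(3,5) unfolding A U[symmetric]
        by (simp add: improves_def)
      show "runs (Cond (Conj (admissible s) (NLess (nv ''sk'') (nv ''su'')))
         (Seq (exchange_loop s) (NSet ''ch'' [] (NConst 1))) Skip) \<tau>2 (5 * n + 5) ?Q"
      proof (rule runs_Cond)
        assume "beval \<tau>2 (Conj (admissible s) (NLess (nv ''sk'') (nv ''su'')))"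
        then have imp': "improves p ?A ?U" using imp by simp
        show "runs (Seq (exchange_loop s) (NSet ''ch'' [] (NConst 1))) \<tau>2 (5 * n + 4) ?Q"
        proof (rule runs_Seq[OF runs_exchange_loop[OF g2(1), of s]])
          fix \<tau>3 assume "members ''in'' \<tau>3 = exchanged (members ''in'' \<tau>2) (tuple s \<tau>2)"
          then show "runs (NSet ''ch'' [] (NConst 1)) \<tau>3 1 ?Q"
            using imp' g2 by (intro runs_step) (auto simp: members_def)
        qed (use g2 z in auto)
      next
        assume "\<not> beval \<tau>2 (Conj (admissible s) (NLess (nv ''sk'') (nv ''su'')))"
        then show "runs Skip \<tau>2 (5 * n + 4) ?Q" using imp g2 by (intro runs_step) auto
      qed simp
    qed simp
  qed (use T in simp)
qed

end

section \<open>Enumeration of tuples and termination of the search\<close>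

primrec loops_time :: "nat \<Rightarrow> nat \<Rightarrow> nat" where
  "loops_time 0 n = 13 * n + 13"
| "loops_time (Suc m) n = n * (loops_time m n + 2) + 3"

definition search_time :: "nat \<Rightarrow> nat \<Rightarrow> nat" where
  "search_time s n = 3 * n + 5 + (n * (2 * n)\<^sup>2 + 1) * (loops_time s n + 2)"

context indexed_graph
begin

definition solution_state :: "(nat \<Rightarrow> nat) \<Rightarrow> state \<Rightarrow> bool" where
  "solution_state p \<sigma> \<longleftrightarrow> graph_state \<sigma> \<and> scaled_state p \<sigma> \<and> indep (members ''in'' \<sigma>) \<and>
     (\<forall>i\<in>members ''in'' \<sigma>. p i > 0)"

definition progress :: "(nat \<Rightarrow> nat) \<Rightarrow> state \<Rightarrow> state \<Rightarrow> bool" where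
  "progress p \<sigma> \<tau> \<longleftrightarrow>
     potential p (members ''in'' \<sigma>) < potential p (members ''in'' \<tau>) \<and> nmem \<tau> ''ch'' [] = 1"

definition unchanged :: "state \<Rightarrow> state \<Rightarrow> bool" where
  "unchanged \<sigma> \<tau> \<longleftrightarrow> members ''in'' \<tau> = members ''in'' \<sigma> \<and> nmem \<tau> ''ch'' [] = nmem \<sigma> ''ch'' []"

text \<open>The entries fixed by the outer loops, while \<open>loops m\<close> varies the first
  \<open>m\<close> ones.\<close>

definition suffix_tuple :: "nat \<Rightarrow> nat \<Rightarrow> state \<Rightarrow> nat set" where
  "suffix_tuple m s \<sigma> = (\<lambda>j. nmem \<sigma> (zname j) []) ` {m..<s}"

lemma solution_state_setn [simp]:
  "x \<noteq> ''n'' \<Longrightarrow> x \<noteq> ''adj'' \<Longrightarrow> x \<noteq> ''p'' \<Longrightarrow> x \<noteq> ''sq'' \<Longrightarrow> x \<noteq> ''in'' \<Longrightarrow>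
     solution_state p (setn x is v \<sigma>) \<longleftrightarrow> solution_state p \<sigma>"
  by (simp add: solution_state_def graph_state_def scaled_state_def members_def)

lemma members_setn [simp]: "x \<noteq> y \<Longrightarrow> members x (setn y is v \<sigma>) = members x \<sigma>"
  by (simp add: members_def)

lemma progress_setn [simp]:
  "x \<noteq> ''in'' \<Longrightarrow> x \<noteq> ''ch'' \<Longrightarrow> progress p \<sigma> (setn x is v \<tau>) \<longleftrightarrow> progress p \<sigma> \<tau>"
  by (simp add: progress_def)

lemma unchanged_setn [simp]:
  "x \<noteq> ''in'' \<Longrightarrow> x \<noteq> ''ch'' \<Longrightarrow> unchanged \<sigma> (setn x is v \<tau>) \<longleftrightarrow> unchanged \<sigma> \<tau>"
  by (simp add: unchanged_def)

text \<open>After an exchange nothing is claimed about the tuples tried before, since another pass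
  will follow. Without an exchange the solution has been the same throughout, so all failed tests
  refer to one set.\<close>

lemma runs_loops:
  assumes "solution_state p \<sigma>" "\<And>j. m \<le> j \<Longrightarrow> j < s \<Longrightarrow> nmem \<sigma> (zname j) [] < n" "m \<le> s"
  shows "runs (loops m (try_exchange s)) \<sigma> (loops_time m n) (\<lambda>\<tau>. solution_state p \<tau> \<and>
     (progress p \<sigma> \<tau> \<or> unchanged \<sigma> \<tau> \<and>
       (\<forall>f. (\<forall>j<m. f j < n) \<longrightarrow> \<not> improves p (members ''in'' \<sigma>) (f ` {..<m} \<union> suffix_tuple m s \<sigma>))))"
  using assms
proof (induction m arbitrary: \<sigma>)
  case 0
  have tup: "suffix_tuple 0 s \<sigma> = tuple s \<sigma>" by (simp add: suffix_tuple_def tuple_def lessThan_atLeast0)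
  have z: "tuple s \<sigma> \<subseteq> {..<n}" using 0(2) by (auto simp: tuple_def)
  have g: "graph_state \<sigma>" "scaled_state p \<sigma>" "indep (members ''in'' \<sigma>)" "\<forall>i\<in>members ''in'' \<sigma>. p i > 0"
    using 0(1) by (auto simp: solution_state_def)
  show ?case unfolding loops.simps loops_time.simps
  proof (rule runs_conseq[OF runs_try_exchange[OF g(1,2) z order_refl] order_refl])
    fix \<tau> assume post: "if improves p (members ''in'' \<sigma>) (tuple s \<sigma>)
      then members ''in'' \<tau> = exchanged (members ''in'' \<sigma>) (tuple s \<sigma>) \<and> nmem \<tau> ''ch'' [] = 1
      else members ''in'' \<tau> = members ''in'' \<sigma> \<and> nmem \<tau> ''ch'' [] = nmem \<sigma> ''ch'' []"
      and fr: "frame (try_exchange s) \<sigma> \<tau>"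
    have gt: "graph_state \<tau>" "scaled_state p \<tau>"
      using graph_state_frame[OF g(1) fr] scaled_state_frame[OF g(2) fr] by auto
    show "solution_state p \<tau> \<and> (progress p \<sigma> \<tau> \<or> unchanged \<sigma> \<tau> \<and>
       (\<forall>f :: nat \<Rightarrow> nat. (\<forall>j<0. f j < n) \<longrightarrow> \<not> improves p (members ''in'' \<sigma>) (f ` {..<0} \<union> suffix_tuple 0 s \<sigma>)))"
    proof (cases "improves p (members ''in'' \<sigma>) (tuple s \<sigma>)")
      case True
      have "\<forall>i\<in>exchanged (members ''in'' \<sigma>) (tuple s \<sigma>). p i > 0"
        using g(4) True by (auto simp: exchanged_def improves_def)
      then show ?thesis
        using post True indep_exchanged[OF g(3) True] potential_exchanged[OF g(3) True] gt
        by (simp add: solution_state_def progress_def)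
    next
      case False
      then show ?thesis using post g gt by (simp add: solution_state_def unchanged_def tup)
    qed
  qed
next
  case (Suc m)
  let ?c = "loops m (try_exchange s)"
  let ?A = "members ''in'' \<sigma>"
  \<comment> \<open>Without progress, the tuples whose entry at \<open>m\<close> is below
    \<open>j\<close> have all been tried in vain.\<close>
  let ?I = "\<lambda>j \<tau>. solution_state p \<tau> \<and> (progress p \<sigma> \<tau> \<or> unchanged \<sigma> \<tau> \<and>
     (\<forall>f. (\<forall>l<Suc m. f l < n) \<and> f m < j \<longrightarrow>
        \<not> improves p ?A (f ` {..<Suc m} \<union> suffix_tuple (Suc m) s \<sigma>)))"
  have "runs (For (zname m) (nv ''n'') ?c) \<sigma> (loops_time (Suc m) n) (?I n)"
  proof (rule runs_For[where I = ?I and m = n])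
    show "neval \<tau> (nv ''n'') = n" if "frame (For (zname m) (nv ''n'') ?c) \<sigma> \<tau>" for \<tau>
    proof -
      have "''n'' \<notin> nvars (For (zname m) (nv ''n'') ?c)" by auto
      from frame_nmem[OF that this] show ?thesis
        using Suc.prems(1) by (simp add: solution_state_def graph_state_def)
    qed
    show "zname m \<notin> nvars ?c" by auto
    show "?I 0 (setn (zname m) [] 0 \<sigma>)" using Suc.prems(1) by (simp add: unchanged_def)
  next
    fix j \<tau> assume j: "j < n" and I: "?I j \<tau>" and zm: "nmem \<tau> (zname m) [] = j"
      and fr: "frame (For (zname m) (nv ''n'') ?c) \<sigma> \<tau>"
    have zl: "nmem \<tau> (zname l) [] = nmem \<sigma> (zname l) []" if "m < l" for l
      using that by (subst frame_nmem[OF fr]) auto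
    have zn: "nmem \<tau> (zname l) [] < n" if "m \<le> l" "l < s" for l
      using that Suc.prems(2)[of l] zl[of l] zm j by (cases "l = m") auto
    have tup: "suffix_tuple m s \<tau> = insert j (suffix_tuple (Suc m) s \<sigma>)"
    proof -
      have "{m..<s} = insert m {Suc m..<s}" using Suc.prems(3) by auto
      then show ?thesis using zm zl by (auto simp: suffix_tuple_def image_def)
    qed
    have "m \<le> s" using Suc.prems(3) by simp
    from I have "solution_state p \<tau>" by simp
    from Suc.IH[OF this zn \<open>m \<le> s\<close>]
    show "runs ?c \<tau> (loops_time m n) (\<lambda>\<tau>'. ?I (Suc j) (setn (zname m) [] (Suc j) \<tau>'))"
    proof (rule runs_conseq[OF _ order_refl])
      fix \<tau>' assume IH: "solution_state p \<tau>' \<and> (progress p \<tau> \<tau>' \<or> unchanged \<tau> \<tau>' \<and>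
         (\<forall>f. (\<forall>j<m. f j < n) \<longrightarrow> \<not> improves p (members ''in'' \<tau>) (f ` {..<m} \<union> suffix_tuple m s \<tau>)))"
      have "progress p \<sigma> \<tau>' \<or> unchanged \<sigma> \<tau>' \<and>
        (\<forall>f. (\<forall>l<Suc m. f l < n) \<and> f m < Suc j \<longrightarrow>
          \<not> improves p ?A (f ` {..<Suc m} \<union> suffix_tuple (Suc m) s \<sigma>))"
      proof (cases "progress p \<sigma> \<tau>'")
        case False
        \<comment> \<open>Progress is never undone, since the potential does not decrease. No
          progress in total therefore means that the earlier iterations and the present one all left
          the solution unchanged.\<close>
        have npt: "\<not> progress p \<tau> \<tau>'" using False I by (auto simp: progress_def unchanged_def)
        then have u': "unchanged \<tau> \<tau>'" using IH by simp
        then have "\<not> progress p \<sigma> \<tau>" using False by (auto simp: progress_def unchanged_def)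
        then have u: "unchanged \<sigma> \<tau>" using I by simp
        have "\<not> improves p ?A (f ` {..<Suc m} \<union> suffix_tuple (Suc m) s \<sigma>)"
          if f: "\<forall>l<Suc m. f l < n" "f m < Suc j" for f
        proof (cases "f m < j")
          case True
          then show ?thesis using I f \<open>\<not> progress p \<sigma> \<tau>\<close> by auto
        next
          case False
          then have "f m = j" using f by simp
          then have "f ` {..<Suc m} \<union> suffix_tuple (Suc m) s \<sigma> = f ` {..<m} \<union> suffix_tuple m s \<tau>"
            by (auto simp: tup lessThan_Suc)
          then show ?thesis using IH npt f u by (simp add: unchanged_def)
        qed
        then show ?thesis using u u' by (simp add: unchanged_def)
      qed simp
      then show "?I (Suc j) (setn (zname m) [] (Suc j) \<tau>')" using IH by simp
    qed
  qed simp
  then show ?case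
    unfolding loops.simps by (rule runs_conseq) auto
qed

lemma runs_search:
  assumes g: "graph_state \<sigma>" "scaled_state p \<sigma>" and p: "\<And>i. i < n \<Longrightarrow> p i \<le> 2 * n"
  shows "runs (search s) \<sigma> (search_time s n) (\<lambda>\<tau>. solution_state p \<tau> \<and> locally_optimal s p (members ''in'' \<tau>))"
  unfolding search_def
proof (rule runs_Seq)
  let ?clear = "For ''i'' (nv ''n'') (NSet ''in'' [nv ''i''] (NConst 0))"
  show "runs ?clear \<sigma> (n * (1 + 2) + 3) (\<lambda>\<tau>. \<forall>x<n. nmem \<tau> ''in'' [x] = 0)"
    by (rule runs_For[where I = "\<lambda>j \<tau>. \<forall>x<j. nmem \<tau> ''in'' [x] = 0"])
       (use g in \<open>auto simp: graph_state_def frame_nmem less_Suc_eq intro!: runs_step\<close>)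
  fix \<tau> assume z: "\<forall>x<n. nmem \<tau> ''in'' [x] = 0" and fr: "frame ?clear \<sigma> \<tau>"
  have ok: "solution_state p \<tau>"
    using graph_state_frame[OF g(1) fr] scaled_state_frame[OF g(2) fr] z
    by (auto simp: solution_state_def members_def indep_def)
  let ?body = "Seq (NSet ''ch'' [] (NConst 0)) (loops s (try_exchange s))"
  let ?Q = "\<lambda>\<tau>. solution_state p \<tau> \<and> locally_optimal s p (members ''in'' \<tau>)"
  let ?M = "n * (2 * n)\<^sup>2"
  show "runs (Seq (NSet ''ch'' [] (NConst 1)) (While (posb (nv ''ch'')) ?body)) \<tau>
          (1 + ((?M + 1) * ((1 + loops_time s n) + 1) + 1)) ?Q"
  proof (rule runs_Seq)
    show "runs (NSet ''ch'' [] (NConst 1)) \<tau> 1 (\<lambda>\<tau>'. solution_state p \<tau>' \<and> nmem \<tau>' ''ch'' [] = 1)"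
      using ok by (intro runs_step) auto
    fix \<tau>1 assume 1: "solution_state p \<tau>1 \<and> nmem \<tau>1 ''ch'' [] = 1"
    \<comment> \<open>The flag starts at 1, so the claim of optimality is vacuous before the first
      pass.\<close>
    let ?I = "\<lambda>\<tau>. solution_state p \<tau> \<and> (nmem \<tau> ''ch'' [] = 0 \<longrightarrow> locally_optimal s p (members ''in'' \<tau>))"
    let ?mu = "\<lambda>\<tau>. ?M - potential p (members ''in'' \<tau>)"
    have "runs (While (posb (nv ''ch'')) ?body) \<tau>1 ((?mu \<tau>1 + 1) * ((1 + loops_time s n) + 1) + 1)
            (\<lambda>\<tau>. ?I \<tau> \<and> \<not> beval \<tau> (posb (nv ''ch'')))"
    proof (rule runs_While)
      fix \<tau>2 assume 2: "?I \<tau>2" and "beval \<tau>2 (posb (nv ''ch''))"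
      show "runs ?body \<tau>2 (1 + loops_time s n)
         (\<lambda>\<tau>'. ?I \<tau>' \<and> (beval \<tau>' (posb (nv ''ch'')) \<longrightarrow> ?mu \<tau>' < ?mu \<tau>2))"
      proof (rule runs_Seq)
        show "runs (NSet ''ch'' [] (NConst 0)) \<tau>2 1 (\<lambda>\<tau>'. solution_state p \<tau>' \<and> nmem \<tau>' ''ch'' [] = 0 \<and>
                members ''in'' \<tau>' = members ''in'' \<tau>2)"
          using 2 by (intro runs_step) auto
        fix \<tau>3 assume 3: "solution_state p \<tau>3 \<and> nmem \<tau>3 ''ch'' [] = 0 \<and> members ''in'' \<tau>3 = members ''in'' \<tau>2"
        then have "solution_state p \<tau>3" by simp
        from runs_loops[OF this, of s s]
        show "runs (loops s (try_exchange s)) \<tau>3 (loops_time s n)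
           (\<lambda>\<tau>'. ?I \<tau>' \<and> (beval \<tau>' (posb (nv ''ch'')) \<longrightarrow> ?mu \<tau>' < ?mu \<tau>2))"
        proof (rule runs_conseq)
          fix \<tau>' assume post: "solution_state p \<tau>' \<and> (progress p \<tau>3 \<tau>' \<or> unchanged \<tau>3 \<tau>' \<and>
            (\<forall>f. (\<forall>j<s. f j < n) \<longrightarrow> \<not> improves p (members ''in'' \<tau>3) (f ` {..<s} \<union> suffix_tuple s s \<tau>3)))"
          \<comment> \<open>Below this bound, a growing potential strictly decreases the truncated
            difference \<open>?mu\<close>.\<close>
          have "potential p (members ''in'' \<tau>') \<le> ?M"
            using post p by (intro potential_le) (auto simp: solution_state_def)
          then show "?I \<tau>' \<and> (beval \<tau>' (posb (nv ''ch'')) \<longrightarrow> ?mu \<tau>' < ?mu \<tau>2)"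
            using post 3 by (auto simp: progress_def unchanged_def locally_optimal_def suffix_tuple_def)
        qed auto
      qed simp
    qed (use 1 in auto)
    then show "runs (While (posb (nv ''ch'')) ?body) \<tau>1 ((?M + 1) * ((1 + loops_time s n) + 1) + 1) ?Q"
    proof (rule runs_conseq)
      show "(?mu \<tau>1 + 1) * ((1 + loops_time s n) + 1) + 1 \<le> (?M + 1) * ((1 + loops_time s n) + 1) + 1"
        by (intro add_mono mult_mono) auto
    qed auto
  qed simp
qed (simp add: search_time_def)

end

section \<open>Rounding relative to the guessed vertex\<close>

locale weighted_graph = indexed_graph +
  fixes W :: "nat \<Rightarrow> real"
  assumes W_pos: "i < n \<Longrightarrow> W i > 0"
begin

definition weight_state :: "state \<Rightarrow> bool" where
  "weight_state \<sigma> \<longleftrightarrow> (\<forall>i<n. rmem \<sigma> ''w'' [i] = W i)"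

lemma weight_state_frame: "weight_state \<sigma> \<Longrightarrow> frame c \<sigma> \<tau> \<Longrightarrow> ''w'' \<notin> rvars c \<Longrightarrow> weight_state \<tau>"
  by (simp add: weight_state_def frame_rmem)

definition eligible :: "nat \<Rightarrow> nat \<Rightarrow> bool" where
  "eligible g i \<longleftrightarrow> \<not> a g i \<and> i \<noteq> g \<and> W i \<le> W g"

text \<open>The floor of \<open>2 * n * W i / W g\<close>, characterised without division in the
  form that the loop of \<open>divide\<close> maintains.\<close>

definition quotient :: "nat \<Rightarrow> nat \<Rightarrow> nat \<Rightarrow> bool" where
  "quotient g i k \<longleftrightarrow> k \<le> 2 * n \<and> k * W g \<le> 2 * n * W i \<and> 2 * n * W i < (k + 1) * W g"

definition scaled :: "nat \<Rightarrow> nat \<Rightarrow> nat \<Rightarrow> bool" where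
  "scaled g i k \<longleftrightarrow> (if eligible g i then quotient g i k else k = 0)"

lemma scaled_le: "scaled g i k \<Longrightarrow> k \<le> 2 * n"
  by (auto simp: scaled_def quotient_def split: if_splits)

lemma runs_divide:
  assumes g: "graph_state \<sigma>" "weight_state \<sigma>" "nmem \<sigma> ''g'' [] = g" "g < n"
    and i: "i < n" "W i \<le> W g" and r: "rmem \<sigma> ''r'' [] = 2 * n * W i" and k: "nmem \<sigma> ''k'' [] = 0"
  shows "runs divide \<sigma> (10 * n + 4) (\<lambda>\<tau>. quotient g i (nmem \<tau> ''k'' []))"
  unfolding divide_def
proof (rule runs_Seq)
  let ?R = "2 * real n * W i"
  show "runs (RSet ''acc'' [] (RNat (NConst 0))) \<sigma> 1 (\<lambda>\<tau>. \<tau> = setr ''acc'' [] 0 \<sigma>)"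
    by (intro runs_step) auto
  fix \<tau> assume [simp]: "\<tau> = setr ''acc'' [] 0 \<sigma>"
  let ?b = "Seq (RSet ''acc'' [] (RPlus (rv ''acc'') (ra ''w'' ''g'')))
        (Cond (Neg (RLess (rv ''r'') (rv ''acc''))) (NSet ''k'' [] (NPlus (nv ''j'') (NConst 1))) Skip)"
  let ?F = "For ''j'' (NPlus (nv ''n'') (nv ''n'')) ?b"
  let ?I = "\<lambda>j \<tau>. rmem \<tau> ''acc'' [] = real j * W g \<and> real (nmem \<tau> ''k'' []) * W g \<le> ?R \<and>
      nmem \<tau> ''k'' [] \<le> j \<and> (nmem \<tau> ''k'' [] = j \<or> ?R < real (nmem \<tau> ''k'' [] + 1) * W g)"
  have R0: "0 \<le> ?R" using W_pos[OF i(1)] by simp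
  have "runs ?F \<tau> (10 * n + 3) (?I (2 * n))"
  proof (rule runs_For[where I = ?I and m = "2 * n" and T = 3])
    fix j \<tau>' assume I: "?I j \<tau>'" and j: "nmem \<tau>' ''j'' [] = j" and fr: "frame ?F \<tau> \<tau>'"
    have "nmem \<tau>' ''g'' [] = g" "rmem \<tau>' ''w'' [g] = W g" "rmem \<tau>' ''r'' [] = ?R"
      using frame_nmem[OF fr, of "''g''"] frame_rmem[OF fr, of "''w''"] frame_rmem[OF fr, of "''r''"] g r
      by (auto simp: weight_state_def)
    then show "runs ?b \<tau>' 3 (\<lambda>\<tau>''. ?I (Suc j) (setn ''j'' [] (Suc j) \<tau>''))"
      using I j by (intro runs_step) (auto simp: algebra_simps)
  qed (use g k R0 in \<open>auto simp: graph_state_def frame_nmem\<close>)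
  then show "runs ?F \<tau> (10 * n + 3) (\<lambda>\<tau>. quotient g i (nmem \<tau> ''k'' []))"
  proof (rule runs_conseq[OF _ order_refl])
    fix \<tau>' assume I: "?I (2 * n) \<tau>'"
    \<comment> \<open>If all multiples tried fit, then \<open>k = 2 * n\<close> and no test has
      yielded the strict upper estimate; it comes from \<open>W i \<le> W g\<close>.\<close>
    have "2 * real n * W i \<le> 2 * real n * W g" using i(2) by (intro mult_left_mono) auto
    also have "\<dots> < (2 * real n + 1) * W g" using W_pos[OF g(4)] by (simp add: algebra_simps)
    finally have "?R < (2 * real n + 1) * W g" .
    then show "quotient g i (nmem \<tau>' ''k'' [])"
      using I by (auto simp: quotient_def add.commute)
  qed
qed simp

lemma beval_eligible:
  assumes "graph_state \<sigma>" "weight_state \<sigma>" "nmem \<sigma> ''g'' [] = g" "g < n" "nmem \<sigma> ''i'' [] = i" "i < n"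
  shows "beval \<sigma> eligible_test \<longleftrightarrow> eligible g i"
  using assms by (auto simp: eligible_test_def eligible_def graph_state_def weight_state_def)

lemma runs_scale_one:
  assumes g: "graph_state \<sigma>" "weight_state \<sigma>" "nmem \<sigma> ''g'' [] = g" "g < n"
    and i: "nmem \<sigma> ''i'' [] = i" "i < n"
  shows "runs scale_one \<sigma> (26 * n + 16) (\<lambda>\<tau>. \<exists>k. scaled g i k \<and>
     nmem \<tau> ''p'' = (nmem \<sigma> ''p'')([i] := k) \<and> nmem \<tau> ''sq'' = (nmem \<sigma> ''sq'')([i] := k\<^sup>2))"
  (is "runs _ _ _ ?Q")
  unfolding scale_one_def
proof (rule runs_Seq)
  let ?r = "rsum ''j'' (NPlus (nv ''n'') (nv ''n'')) ''r'' (RNat (NConst 0)) (posb (NConst 1)) (ra ''w'' ''i'')"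
  let ?q = "nsum ''j'' (nv ''k'') ''q'' (posb (NConst 1)) (nv ''k'')"
  let ?sto = "Seq (NSet ''p'' [nv ''i''] (nv ''k'')) (NSet ''sq'' [nv ''i''] (nv ''q''))"
  show "runs (NSet ''k'' [] (NConst 0)) \<sigma> 1 (\<lambda>\<tau>. \<tau> = setn ''k'' [] 0 \<sigma>)" by (intro runs_step) auto
  fix \<tau> assume \<tau>: "\<tau> = setn ''k'' [] 0 \<sigma>"
  have g': "graph_state \<tau>" "weight_state \<tau>" "nmem \<tau> ''g'' [] = g" "nmem \<tau> ''i'' [] = i" "nmem \<tau> ''k'' [] = 0"
    using g i by (auto simp: \<tau> graph_state_def weight_state_def)
  show "runs (Seq (Cond eligible_test (Seq ?r divide) Skip) (Seq ?q ?sto)) \<tau> (18 * n + 9 + (8 * n + 6)) ?Q"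
  proof (rule runs_Seq)
    show "runs (Cond eligible_test (Seq ?r divide) Skip) \<tau> (18 * n + 9) (\<lambda>\<tau>. scaled g i (nmem \<tau> ''k'' []))"
    proof (rule runs_Cond)
      assume "beval \<tau> eligible_test"
      then have el: "eligible g i" using beval_eligible g' g i by blast
      show "runs (Seq ?r divide) \<tau> (18 * n + 8) (\<lambda>\<tau>. scaled g i (nmem \<tau> ''k'' []))"
      proof (rule runs_Seq)
        show "runs ?r \<tau> (8 * n + 4)
           (\<lambda>\<tau>'. rmem \<tau>' ''r'' [] = reval \<tau> (RNat (NConst 0)) + (\<Sum>j\<in>{j. j < 2 * n \<and> True}. W i))"
        proof (rule runs_rsum)
          fix j \<tau>' assume fr: "frame ?r \<tau> \<tau>'"
          show "(beval \<tau>' (posb (NConst 1)) \<longleftrightarrow> True) \<and> (True \<longrightarrow> reval \<tau>' (ra ''w'' ''i'') = W i)"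
            using frame_nmem[OF fr, of "''i''"] weight_state_frame[OF g'(2) fr] g' i
            by (simp add: weight_state_def)
        qed (use g' in \<open>auto simp: graph_state_def frame_nmem\<close>)
        fix \<tau>' assume r: "rmem \<tau>' ''r'' [] = reval \<tau> (RNat (NConst 0)) + (\<Sum>j\<in>{j. j < 2 * n \<and> True}. W i)"
          and fr: "frame ?r \<tau> \<tau>'"
        have "runs divide \<tau>' (10 * n + 4) (\<lambda>\<tau>. quotient g i (nmem \<tau> ''k'' []))"
          using g' graph_state_frame[OF g'(1) fr] weight_state_frame[OF g'(2) fr]
            frame_nmem[OF fr, of "''g''"] frame_nmem[OF fr, of "''k''"] el g(4) i(2) r
          by (intro runs_divide) (auto simp: eligible_def)
        then show "runs divide \<tau>' (10 * n + 4) (\<lambda>\<tau>. scaled g i (nmem \<tau> ''k'' []))"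
          using el by (simp add: scaled_def)
      qed simp
    next
      assume "\<not> beval \<tau> eligible_test"
      then have "\<not> eligible g i" using beval_eligible g' g i by blast
      then show "runs Skip \<tau> (18 * n + 8) (\<lambda>\<tau>. scaled g i (nmem \<tau> ''k'' []))"
        using g' by (intro runs_step) (auto simp: scaled_def)
    qed simp
  next
    let ?c = "Cond eligible_test (Seq ?r divide) Skip"
    fix \<tau>1 assume k: "scaled g i (nmem \<tau>1 ''k'' [])" and fr1: "frame ?c \<tau> \<tau>1"
    have 1: "nmem \<tau>1 ''i'' [] = i" "nmem \<tau>1 ''p'' = nmem \<sigma> ''p''" "nmem \<tau>1 ''sq'' = nmem \<sigma> ''sq''"
      using frame_nmem[OF fr1] i by (auto simp: \<tau>)
    show "runs (Seq ?q ?sto) \<tau>1 (8 * n + 6) ?Q"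
    proof (rule runs_Seq)
      show "runs ?q \<tau>1 (8 * n + 4) (\<lambda>\<tau>. nmem \<tau> ''q'' [] = (\<Sum>j\<in>{j. j < nmem \<tau>1 ''k'' [] \<and> True}. nmem \<tau>1 ''k'' []))"
      proof (rule runs_nsum)
        fix j \<tau>' assume fr: "frame ?q \<tau>1 \<tau>'"
        show "(beval \<tau>' (posb (NConst 1)) \<longleftrightarrow> True) \<and> (True \<longrightarrow> neval \<tau>' (nv ''k'') = nmem \<tau>1 ''k'' [])"
          using frame_nmem[OF fr, of "''k''"] by simp
      next
        show "neval \<tau>' (nv ''k'') = nmem \<tau>1 ''k'' []" if "frame ?q \<tau>1 \<tau>'" for \<tau>'
          using frame_nmem[OF that, of "''k''"] by simp
      qed (use scaled_le[OF k] in auto)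
      fix \<tau>2 assume q: "nmem \<tau>2 ''q'' [] = (\<Sum>j\<in>{j. j < nmem \<tau>1 ''k'' [] \<and> True}. nmem \<tau>1 ''k'' [])"
        and fr2: "frame ?q \<tau>1 \<tau>2"
      have 2: "nmem \<tau>2 ''i'' [] = i" "nmem \<tau>2 ''p'' = nmem \<sigma> ''p''" "nmem \<tau>2 ''sq'' = nmem \<sigma> ''sq''"
        "nmem \<tau>2 ''k'' = nmem \<tau>1 ''k''" using frame_nmem[OF fr2] 1 by auto
      show "runs ?sto \<tau>2 2 ?Q"
        using 2 q k by (intro runs_step exI[of _ "nmem \<tau>1 ''k'' []"]) (auto simp: power2_eq_square)
    qed simp
  qed simp
qed simp

lemma runs_scale:
  assumes g: "graph_state \<sigma>" "weight_state \<sigma>" "nmem \<sigma> ''g'' [] = g" "g < n"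
  shows "runs scale \<sigma> (n * (26 * n + 18) + 3) (\<lambda>\<tau>. \<exists>p. scaled_state p \<tau> \<and> (\<forall>i<n. scaled g i (p i)))"
proof -
  have "runs scale \<sigma> (n * (26 * n + 18) + 3) (\<lambda>\<tau>. \<forall>x<n. scaled g x (nmem \<tau> ''p'' [x]) \<and>
      nmem \<tau> ''sq'' [x] = (nmem \<tau> ''p'' [x])\<^sup>2)"
    unfolding scale_def
  proof (rule runs_For[where I = "\<lambda>i \<tau>. \<forall>x<i. scaled g x (nmem \<tau> ''p'' [x]) \<and>
      nmem \<tau> ''sq'' [x] = (nmem \<tau> ''p'' [x])\<^sup>2" and T = "26 * n + 16"])
    fix j \<tau> assume j: "j < n" and I: "\<forall>x<j. scaled g x (nmem \<tau> ''p'' [x]) \<and> nmem \<tau> ''sq'' [x] = (nmem \<tau> ''p'' [x])\<^sup>2"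
      and i: "nmem \<tau> ''i'' [] = j" and fr: "frame (For ''i'' (nv ''n'') scale_one) \<sigma> \<tau>"
    have "runs scale_one \<tau> (26 * n + 16) (\<lambda>\<tau>'. \<exists>k. scaled g j k \<and>
     nmem \<tau>' ''p'' = (nmem \<tau> ''p'')([j] := k) \<and> nmem \<tau>' ''sq'' = (nmem \<tau> ''sq'')([j] := k\<^sup>2))"
      using graph_state_frame[OF g(1) fr] weight_state_frame[OF g(2) fr] frame_nmem[OF fr, of "''g''"] g(3,4) i j
      by (intro runs_scale_one) auto
    then show "runs scale_one \<tau> (26 * n + 16) (\<lambda>\<tau>'. \<forall>x<Suc j.
        scaled g x (nmem (setn ''i'' [] (Suc j) \<tau>') ''p'' [x]) \<and>
        nmem (setn ''i'' [] (Suc j) \<tau>') ''sq'' [x] = (nmem (setn ''i'' [] (Suc j) \<tau>') ''p'' [x])\<^sup>2)"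
      by (rule runs_conseq) (use I in \<open>auto simp: less_Suc_eq\<close>)
  qed (use g in \<open>auto simp: graph_state_def frame_nmem\<close>)
  then show ?thesis
    by (rule runs_conseq) (auto simp: scaled_state_def intro!: exI[of _ "\<lambda>x. nmem _ ''p'' [x]"])
qed

lemma runs_update:
  assumes g: "graph_state \<sigma>" "weight_state \<sigma>" "nmem \<sigma> ''g'' [] = g" "g < n"
  defines "v \<equiv> W g + sum W (members ''in'' \<sigma>)"
  shows "runs update \<sigma> (7 * n + 11) (\<lambda>\<tau>.
    if rmem \<sigma> ''best'' [] < v
    then rmem \<tau> ''best'' [] = v \<and> members ''out'' \<tau> = insert g (members ''in'' \<sigma>)
    else rmem \<tau> ''best'' [] = rmem \<sigma> ''best'' [] \<and> members ''out'' \<tau> = members ''out'' \<sigma>)" (is "runs _ _ _ ?Q")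
  unfolding update_def
proof (rule runs_Seq)
  let ?S = "members ''in'' \<sigma>"
  let ?s = "rsum ''i'' (nv ''n'') ''val'' (ra ''w'' ''g'') (posb (na ''in'' ''i'')) (ra ''w'' ''i'')"
  show "runs ?s \<sigma> (4 * n + 4) (\<lambda>\<tau>. rmem \<tau> ''val'' [] = reval \<sigma> (ra ''w'' ''g'') + (\<Sum>i\<in>{i. i < n \<and> i \<in> ?S}. W i))"
  proof (rule runs_rsum)
    fix j \<tau> assume "j < n" "nmem \<tau> ''i'' [] = j" and fr: "frame ?s \<sigma> \<tau>"
    then show "(beval \<tau> (posb (na ''in'' ''i'')) \<longleftrightarrow> j \<in> ?S) \<and> (j \<in> ?S \<longrightarrow> reval \<tau> (ra ''w'' ''i'') = W j)"
      using weight_state_frame[OF g(2) fr] frame_nmem[OF fr, of "''in''"]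
      by (simp add: weight_state_def members_def)
  qed (use g in \<open>auto simp: graph_state_def frame_nmem\<close>)
  fix \<tau> assume v: "rmem \<tau> ''val'' [] = reval \<sigma> (ra ''w'' ''g'') + (\<Sum>i\<in>{i. i < n \<and> i \<in> ?S}. W i)"
    and fr: "frame ?s \<sigma> \<tau>"
  have "{i. i < n \<and> i \<in> ?S} = ?S" by (auto simp: members_def)
  then have v: "rmem \<tau> ''val'' [] = v" using v g by (simp add: v_def weight_state_def)
  have t: "rmem \<tau> ''best'' = rmem \<sigma> ''best''" "members ''in'' \<tau> = ?S" "members ''out'' \<tau> = members ''out'' \<sigma>"
    "nmem \<tau> ''n'' [] = n" "nmem \<tau> ''g'' [] = g"
    using frame_rmem[OF fr, of "''best''"] members_frame[OF fr] frame_nmem[OF fr] g by (auto simp: graph_state_def)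
  let ?l = "For ''i'' (nv ''n'') (NSet ''out'' [nv ''i''] (na ''in'' ''i''))"
  show "runs (Cond (RLess (rv ''best'') (rv ''val'')) (Seq (RSet ''best'' [] (rv ''val''))
     (Seq ?l (NSet ''out'' [nv ''g''] (NConst 1)))) Skip) \<tau> (3 * n + 6) ?Q"
  proof (rule runs_Cond)
    assume "beval \<tau> (RLess (rv ''best'') (rv ''val''))"
    then have b: "rmem \<sigma> ''best'' [] < v" using v t by simp
    show "runs (Seq (RSet ''best'' [] (rv ''val'')) (Seq ?l (NSet ''out'' [nv ''g''] (NConst 1)))) \<tau> (3 * n + 5) ?Q"
    proof (rule runs_Seq)
      show "runs (RSet ''best'' [] (rv ''val'')) \<tau> 1 (\<lambda>\<tau>'. \<tau>' = setr ''best'' [] v \<tau>)"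
        using v by (intro runs_step) auto
      fix \<tau>1 assume \<tau>1: "\<tau>1 = setr ''best'' [] v \<tau>"
      show "runs (Seq ?l (NSet ''out'' [nv ''g''] (NConst 1))) \<tau>1 (3 * n + 4) ?Q"
      proof (rule runs_Seq)
        show "runs ?l \<tau>1 (3 * n + 3) (\<lambda>\<tau>. \<forall>x<n. nmem \<tau> ''out'' [x] = nmem \<tau>1 ''in'' [x])"
          by (rule runs_For[where I = "\<lambda>j \<tau>. \<forall>x<j. nmem \<tau> ''out'' [x] = nmem \<tau>1 ''in'' [x]" and T = 1])
             (use t in \<open>auto simp: frame_nmem less_Suc_eq \<tau>1 intro!: runs_step\<close>)
        fix \<tau>2 assume o: "\<forall>x<n. nmem \<tau>2 ''out'' [x] = nmem \<tau>1 ''in'' [x]" and fr2: "frame ?l \<tau>1 \<tau>2"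
        have "members ''out'' \<tau>2 = ?S" using o t by (auto simp: members_def \<tau>1)
        moreover have "rmem \<tau>2 ''best'' [] = v" "nmem \<tau>2 ''g'' [] = g"
          using frame_rmem[OF fr2, of "''best''"] frame_nmem[OF fr2, of "''g''"] t by (auto simp: \<tau>1)
        ultimately show "runs (NSet ''out'' [nv ''g''] (NConst 1)) \<tau>2 1 ?Q"
          using b g(4) by (intro runs_step) (auto simp: members_def)
      qed simp
    qed simp
  next
    assume "\<not> beval \<tau> (RLess (rv ''best'') (rv ''val''))"
    then show "runs Skip \<tau> (3 * n + 5) ?Q" using v t by (intro runs_step) auto
  qed simp
qed simp

end

section \<open>The approximation guarantee\<close>

definition mwis_time :: "nat \<Rightarrow> nat \<Rightarrow> nat" where
  "mwis_time s n = n * (n * (26 * n + 18) + search_time s n + 7 * n + 16) + 4"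

context weighted_graph
begin

text \<open>Rounding the weights loses at most \<open>W g / 2\<close> in total; this is covered by the factor
  \<open>\<rho> \<ge> 3/2\<close> with which the guessed vertex \<open>g\<close>, being part of both solutions, is counted.\<close>

lemma guess:
  assumes B: "indep B" "g \<in> B" "\<And>b. b \<in> B \<Longrightarrow> W b \<le> W g"
    and p: "\<And>i. i < n \<Longrightarrow> scaled g i (p i)"
    and S: "indep S" "\<And>i. i \<in> S \<Longrightarrow> p i > 0"
    and \<rho>: "\<rho> \<ge> 3/2"
    and approx: "(\<Sum>i\<in>{b \<in> B - {g}. p b > 0}. real (p i)) \<le> \<rho> * (\<Sum>i\<in>S. real (p i))"
  shows "sum W B \<le> \<rho> * (W g + sum W S)"
proof -
  have gn: "g < n" and fB: "finite B" and Bn: "b \<in> B \<Longrightarrow> b < n" for b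
    using B indep_finite by (auto simp: indep_def)
  have n: "real n > 0" using gn by simp
  have Wg: "W g > 0" by (rule W_pos) fact
  have cB: "card (B - {g}) \<le> n"
    using card_mono[of "{..<n}" "B - {g}"] B(1) by (auto simp: indep_def)
  have "2 * n * (\<Sum>b\<in>B - {g}. W b) \<le> (\<Sum>b\<in>B - {g}. (p b + 1) * W g)"
    unfolding sum_distrib_left
  proof (rule sum_mono)
    fix b assume b: "b \<in> B - {g}"
    then have "eligible g b" using B by (auto simp: eligible_def indep_def)
    then show "2 * n * W b \<le> (p b + 1) * W g"
      using p[of b] Bn b by (auto simp: scaled_def quotient_def add.commute)
  qed
  also have "\<dots> = W g * (\<Sum>b\<in>B - {g}. real (p b)) + card (B - {g}) * W g"
    by (simp add: algebra_simps sum.distrib sum_distrib_left)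
  \<comment> \<open>Vertices rounded to 0 contribute nothing here, while the ratio for local optima
    is available for positive weights only.\<close>
  also have "(\<Sum>b\<in>B - {g}. real (p b)) = (\<Sum>i\<in>{b \<in> B - {g}. p b > 0}. real (p i))"
    using fB by (intro sum.mono_neutral_right) auto
  also have "W g * \<dots> \<le> W g * (\<rho> * (\<Sum>i\<in>S. real (p i)))"
    using approx Wg by (intro mult_left_mono) auto
  also have "\<dots> = \<rho> * (\<Sum>i\<in>S. p i * W g)" by (simp add: sum_distrib_left mult_ac)
  also have "\<rho> * (\<Sum>i\<in>S. p i * W g) \<le> \<rho> * (\<Sum>i\<in>S. 2 * n * W i)"
  proof (intro mult_left_mono sum_mono)
    fix i assume i: "i \<in> S"
    then have "i < n" using S by (auto simp: indep_def)
    then show "p i * W g \<le> 2 * n * W i"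
      using p[of i] S(2)[OF i] by (auto simp: scaled_def quotient_def split: if_splits)
  qed (use \<rho> in auto)
  also have "card (B - {g}) * W g \<le> n * W g" using cB Wg by (intro mult_right_mono) auto
  finally have "2 * n * (\<Sum>b\<in>B - {g}. W b) \<le> 2 * n * (\<rho> * sum W S + W g / 2)"
    by (simp add: algebra_simps sum_distrib_left)
  then have "(\<Sum>b\<in>B - {g}. W b) \<le> \<rho> * sum W S + W g / 2" using n by simp
  moreover have "3/2 * W g \<le> \<rho> * W g" using \<rho> Wg by (intro mult_right_mono) auto
  moreover have "sum W B = W g + (\<Sum>b\<in>B - {g}. W b)" using fB B(2) by (rule sum.remove)
  ultimately show ?thesis by (simp add: algebra_simps)
qed

text \<open>The invariant says that \<open>best\<close> suffices for every independent set that has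
  a heaviest vertex among those already guessed. The ratio for local optima enters as the hypothesis
  \<open>approx\<close>, and only for integer weights.\<close>

lemma runs_mwis:
  assumes g: "graph_state \<sigma>" "weight_state \<sigma>" and out: "members ''out'' \<sigma> = {}"
    and \<rho>: "\<rho> \<ge> 3/2"
    and approx: "\<And>p A B. indep A \<Longrightarrow> (\<And>i. i \<in> A \<Longrightarrow> p i > 0) \<Longrightarrow> locally_optimal s p A \<Longrightarrow>
        indep B \<Longrightarrow> (\<And>i. i \<in> B \<Longrightarrow> p i > 0) \<Longrightarrow> (\<Sum>i\<in>B. real (p i)) \<le> \<rho> * (\<Sum>i\<in>A. real (p i))"
  shows "runs (mwis s) \<sigma> (mwis_time s n) (\<lambda>\<tau>. indep (members ''out'' \<tau>) \<and>
           (\<forall>B. indep B \<longrightarrow> sum W B \<le> \<rho> * sum W (members ''out'' \<tau>)))"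
  unfolding mwis_def
proof (rule runs_Seq)
  show "runs (RSet ''best'' [] (RNat (NConst 0))) \<sigma> 1 (\<lambda>\<tau>. \<tau> = setr ''best'' [] 0 \<sigma>)"
    by (intro runs_step) auto
  fix \<tau> assume \<tau>: "\<tau> = setr ''best'' [] 0 \<sigma>"
  have g': "graph_state \<tau>" "weight_state \<tau>" "members ''out'' \<tau> = {}" "rmem \<tau> ''best'' [] = 0"
    using g out by (auto simp: \<tau> graph_state_def weight_state_def members_def)
  let ?c = "Seq scale (Seq (search s) update)"
  let ?T = "(n * (26 * n + 18) + 3) + (search_time s n + (7 * n + 11))"
  let ?I = "\<lambda>j \<tau>. indep (members ''out'' \<tau>) \<and> rmem \<tau> ''best'' [] = sum W (members ''out'' \<tau>) \<and>
     (\<forall>B. indep B \<and> (\<exists>h<j. h \<in> B \<and> (\<forall>b\<in>B. W b \<le> W h)) \<longrightarrow> sum W B \<le> \<rho> * rmem \<tau> ''best'' [])"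
  have "runs (For ''g'' (nv ''n'') ?c) \<tau> (n * (?T + 2) + 3) (?I n)"
  proof (rule runs_For[where I = ?I and m = n and T = ?T])
    fix j \<tau>0 assume j: "j < n" and I: "?I j \<tau>0" and gj: "nmem \<tau>0 ''g'' [] = j"
      and fr: "frame (For ''g'' (nv ''n'') ?c) \<tau> \<tau>0"
    have 0: "graph_state \<tau>0" "weight_state \<tau>0"
      using graph_state_frame[OF g'(1) fr] weight_state_frame[OF g'(2) fr] by auto
    let ?J = "\<lambda>\<tau>'. ?I (Suc j) (setn ''g'' [] (Suc j) \<tau>')"
    show "runs ?c \<tau>0 ?T ?J"
    proof (rule runs_Seq[OF runs_scale[OF 0 gj j]])
      fix \<tau>1 assume "\<exists>p. scaled_state p \<tau>1 \<and> (\<forall>i<n. scaled j i (p i))" and fr1: "frame scale \<tau>0 \<tau>1"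
      then obtain p where p: "scaled_state p \<tau>1" "\<And>i. i < n \<Longrightarrow> scaled j i (p i)" by auto
      have 1: "graph_state \<tau>1" "weight_state \<tau>1" "nmem \<tau>1 ''g'' [] = j" 
          "members ''out'' \<tau>1 = members ''out'' \<tau>0" "rmem \<tau>1 ''best'' = rmem \<tau>0 ''best''"
        using graph_state_frame[OF 0(1) fr1] weight_state_frame[OF 0(2) fr1] gj frame_nmem[OF fr1, of "''g''"]
          members_frame[OF fr1, of "''out''"] frame_rmem[OF fr1, of "''best''"] by auto
      show "runs (Seq (search s) update) \<tau>1 (search_time s n + (7 * n + 11)) ?J"
      proof (rule runs_Seq[OF runs_search[OF 1(1) p(1)]])
        show "p i \<le> 2 * n" if "i < n" for i using scaled_le[OF p(2)[OF that]] .
        fix \<tau>2 assume post: "solution_state p \<tau>2 \<and> locally_optimal s p (members ''in'' \<tau>2)"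
          and fr2: "frame (search s) \<tau>1 \<tau>2"
        let ?S = "members ''in'' \<tau>2"
        have 2: "graph_state \<tau>2" "weight_state \<tau>2" "nmem \<tau>2 ''g'' [] = j"
          "members ''out'' \<tau>2 = members ''out'' \<tau>0" "rmem \<tau>2 ''best'' = rmem \<tau>0 ''best''"
          using post weight_state_frame[OF 1(2) fr2] 1 frame_nmem[OF fr2, of "''g''"]
            members_frame[OF fr2, of "''out''"] frame_rmem[OF fr2, of "''best''"]
          by (auto simp: solution_state_def)
        have S: "indep ?S" "\<And>i. i \<in> ?S \<Longrightarrow> p i > 0" "locally_optimal s p ?S"
          using post by (auto simp: solution_state_def)
        \<comment> \<open>Positive rounded weights occur at eligible vertices only, so
          \<open>j\<close> can be added to the solution found.\<close>
        have el: "eligible j i" if "i \<in> ?S" for i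
        proof -
          have "i < n" using that by (simp add: members_def)
          then show ?thesis using p(2)[of i] S(2)[OF that] by (auto simp: scaled_def split: if_splits)
        qed
        have indj: "indep (insert j ?S)"
          using S(1) el j a_sym a_irrefl unfolding indep_def eligible_def by (auto simp: members_def)
        have js: "j \<notin> ?S" using el by (auto simp: eligible_def)
        let ?v = "W j + sum W ?S"
        have v: "sum W (insert j ?S) = ?v" using js indep_finite[OF S(1)] by simp
        have new: "sum W B \<le> \<rho> * ?v" if "indep B" "j \<in> B" "\<forall>b\<in>B. W b \<le> W j" for B
        proof (rule guess[OF that(1,2) _ p(2) S(1,2) \<rho>])
          show "(\<Sum>i\<in>{b \<in> B - {j}. p b > 0}. real (p i)) \<le> \<rho> * (\<Sum>i\<in>?S. real (p i))"
            by (rule approx[OF S]) (use that(1) in \<open>auto elim: indep_subset\<close>)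
        qed (use that(3) in auto)
        have mono: "sum W B \<le> \<rho> * y" if "sum W B \<le> \<rho> * x" "x \<le> y" for B x y
          using that \<rho> by (meson dual_order.trans mult_left_mono order_trans zero_le_divide_iff zero_le_numeral)
        show "runs update \<tau>2 (7 * n + 11) ?J"
        proof (rule runs_conseq[OF runs_update[OF 2(1-3) j] order_refl])
          fix \<tau>3 assume up: "if rmem \<tau>2 ''best'' [] < ?v
            then rmem \<tau>3 ''best'' [] = ?v \<and> members ''out'' \<tau>3 = insert j ?S
            else rmem \<tau>3 ''best'' [] = rmem \<tau>2 ''best'' [] \<and> members ''out'' \<tau>3 = members ''out'' \<tau>2"
          have old: "sum W B \<le> \<rho> * rmem \<tau>2 ''best'' []"
            if "indep B" "\<exists>h<j. h \<in> B \<and> (\<forall>b\<in>B. W b \<le> W h)" for B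
            using I that by (auto simp: 2)
          have le: "?v \<le> rmem \<tau>3 ''best'' []" "rmem \<tau>2 ''best'' [] \<le> rmem \<tau>3 ''best'' []"
            using up by (auto split: if_splits)
          have "sum W B \<le> \<rho> * rmem \<tau>3 ''best'' []"
            if B: "indep B" "h < Suc j" "h \<in> B" "\<forall>b\<in>B. W b \<le> W h" for B h
          proof (cases "h = j")
            case True
            then show ?thesis using new[of B] B mono[OF _ le(1)] by auto
          next
            case False
            then have "h < j" using B by simp
            then have "sum W B \<le> \<rho> * rmem \<tau>2 ''best'' []" using B by (intro old) auto
            then show ?thesis using le(2) by (rule mono)
          qed
          moreover have "indep (members ''out'' \<tau>3) \<and> rmem \<tau>3 ''best'' [] = sum W (members ''out'' \<tau>3)"
            using up indj v I by (auto simp: 2 split: if_splits)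
          ultimately show "?J \<tau>3" by auto
        qed
      qed simp
    qed simp
  qed (use g' in \<open>auto simp: graph_state_def frame_nmem indep_def\<close>)
  then show "runs (For ''g'' (nv ''n'') ?c) \<tau> (n * (?T + 2) + 3) (\<lambda>\<tau>. indep (members ''out'' \<tau>) \<and>
           (\<forall>B. indep B \<longrightarrow> sum W B \<le> \<rho> * sum W (members ''out'' \<tau>)))"
  proof (rule runs_conseq[OF _ order_refl])
    fix \<tau>' assume I: "?I n \<tau>'"
    have "sum W B \<le> \<rho> * sum W (members ''out'' \<tau>')" if B: "indep B" for B
    proof (cases "B = {}")
      case True
      have "sum W (members ''out'' \<tau>') \<ge> 0"
        using W_pos by (intro sum_nonneg) (auto simp: members_def intro: less_imp_le)
      then show ?thesis using True \<rho> by simp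
    next
      case False
      have "Max (W ` B) \<in> W ` B" using False indep_finite[OF B] by (intro Max_in) auto
      then obtain h where h: "h \<in> B" "W h = Max (W ` B)" by auto
      then have "\<forall>b\<in>B. W b \<le> W h" using indep_finite[OF B] by auto
      moreover have "h < n" using h B by (auto simp: indep_def)
      ultimately show ?thesis using I B h(1) by auto
    qed
    then show "indep (members ''out'' \<tau>') \<and> (\<forall>B. indep B \<longrightarrow> sum W B \<le> \<rho> * sum W (members ''out'' \<tau>'))"
      using I by auto
  qed
qed (simp add: mwis_time_def)

end

section \<open>From claw-free graphs to the ratio\<close>

text \<open>Instance of \<open>local_optimum\<close> with the rounded weights on both sides, where a
  vertex of both solutions is its own neighbour.\<close>

lemma (in indexed_graph) locally_optimal_ratio:
  assumes k: "k > 0" and deg: "\<And>i B. i < n \<Longrightarrow> indep B \<Longrightarrow> card {j \<in> B. j = i \<or> a i j} \<le> k"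
    and A: "indep A" "\<And>i. i \<in> A \<Longrightarrow> p i > 0" "locally_optimal (k + k * k) p A"
    and B: "indep B" "\<And>i. i \<in> B \<Longrightarrow> p i > 0"
  shows "(\<Sum>i\<in>B. real (p i)) \<le> (k + min 1 (152 * k powr (-1/3))) / 2 * (\<Sum>i\<in>A. real (p i))"
proof -
  interpret local_optimum A B "\<lambda>u. {i \<in> A. u = i \<or> a i u}" "\<lambda>i. real (p i)" "\<lambda>i. real (p i)" k
  proof
    show "finite A" "finite B" using A B indep_finite by auto
    show "card {u \<in> B. x \<in> {i \<in> A. u = i \<or> a i u}} \<le> k" if "x \<in> A" for x
    proof -
      have "{u \<in> B. x \<in> {i \<in> A. u = i \<or> a i u}} = {j \<in> B. j = x \<or> a x j}" using that by auto
      then show ?thesis using deg[of x B] that A(1) B(1) by (auto simp: indep_def)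
    qed
    fix U assume U: "U \<subseteq> B" "card U \<le> k + k * k"
    show "(\<Sum>u\<in>U. (real (p u))\<^sup>2) \<le> (\<Sum>x\<in>(\<Union>u\<in>U. {i \<in> A. u = i \<or> a i u}). (real (p x))\<^sup>2)"
    proof (cases "U = {}")
      case False
      have fU: "finite U" using U(1) indep_finite[OF B(1)] by (rule finite_subset)
      obtain h where h: "bij_betw h {0..<card U} U" using ex_bij_betw_nat_finite[OF fU] by auto
      \<comment> \<open>A smaller set is padded to a tuple of full length by repeating one element,
        which is why the empty set is treated apart.\<close>
      define f where "f = (\<lambda>j. if j < card U then h j else h 0)"
      have c0: "card U > 0" using False fU by auto
      have hU: "h ` {0..<card U} = U" using h by (simp add: bij_betw_def)
      have fr: "f ` {..<k + k * k} = U"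
      proof
        show "f ` {..<k + k * k} \<subseteq> U" using hU c0 by (auto simp: f_def)
        show "U \<subseteq> f ` {..<k + k * k}"
        proof
          fix u assume "u \<in> U"
          then have "u \<in> h ` {0..<card U}" by (simp only: hU)
          then obtain j where "j < card U" "u = h j" by auto
          then show "u \<in> f ` {..<k + k * k}" using U(2) by (auto simp: f_def intro!: image_eqI[of _ _ j])
        qed
      qed
      have Un: "u < n" if "u \<in> U" for u using that U(1) B(1) by (auto simp: indep_def)
      have "f j < n" if "j < k + k * k" for j using Un[of "f j"] fr that by auto
      then have "\<not> improves p A U" using A(3) fr by (auto simp: locally_optimal_def)
      moreover have "indep U" "\<forall>u\<in>U. p u > 0" using U(1) B indep_subset by auto
      ultimately have "(\<Sum>i\<in>U. (p i)\<^sup>2) \<le> (\<Sum>i\<in>{i \<in> A. near U i}. (p i)\<^sup>2)"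
        by (simp add: improves_def not_less)
      then have "real (\<Sum>i\<in>U. (p i)\<^sup>2) \<le> real (\<Sum>i\<in>{i \<in> A. near U i}. (p i)\<^sup>2)" by (simp only: of_nat_le_iff)
      moreover have "{i \<in> A. near U i} = (\<Union>u\<in>U. {i \<in> A. u = i \<or> a i u})" by (auto simp: near_def)
      ultimately show ?thesis by simp
    qed simp
  qed (use A B k in auto)
  show ?thesis by (rule ratio)
qed

definition index_adj :: "'a list \<Rightarrow> 'a set set \<Rightarrow> nat \<Rightarrow> nat \<Rightarrow> bool" where
  "index_adj vs E i j \<longleftrightarrow> i < length vs \<and> j < length vs \<and> {vs ! i, vs ! j} \<in> E"

definition ratio_bound :: "nat \<Rightarrow> real" where
  "ratio_bound d = (real (d - 1) + min 1 (152 * real (d - 1) powr (-1/3))) / 2"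

text \<open>Needed as the bound on \<open>\<rho>\<close> in \<open>guess\<close>. Equality holds at
  \<open>d = 3\<close>, where the minimum in \<open>ratio_bound\<close> is 1; from
  \<open>d = 4\<close> on, the term \<open>(d - 1) / 2\<close> is enough.\<close>

lemma ratio_bound_ge: assumes "d \<ge> 3" shows "ratio_bound d \<ge> 3/2"
proof (cases "d = 3")
  case True
  have "(2::real) powr (-1) \<le> 2 powr (-1/3)" by (intro powr_mono) auto
  then have "1 \<le> 152 * (2::real) powr (-1/3)" by (simp add: powr_minus_divide)
  then show ?thesis using True by (simp add: ratio_bound_def)
next
  case False
  then have "real (d - 1) \<ge> 3" using assms by simp
  moreover have "0 \<le> min 1 (152 * real (d - 1) powr (-1/3))" by simp
  moreover have "3/2 \<le> (x + z) / 2" if "3 \<le> x" "0 \<le> z" for x z :: real using that by argo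
  ultimately show ?thesis unfolding ratio_bound_def by blast
qed

text \<open>Stated for any state that holds the graph, so that it also applies after a conflict
  graph has been computed.\<close>

lemma runs_mwis_graph:
  fixes vs :: "'a list"
  assumes vs: "distinct vs" "simple_graph (set vs) E" "claw_free d (set vs) E" "\<And>v. v \<in> set vs \<Longrightarrow> w v > 0"
    and d: "d \<ge> 3"
    and \<sigma>: "nmem \<sigma> ''n'' [] = length vs" "\<And>i. i < length vs \<Longrightarrow> rmem \<sigma> ''w'' [i] = w (vs ! i)"
      "\<And>i j. i < length vs \<Longrightarrow> j < length vs \<Longrightarrow> nmem \<sigma> ''adj'' [i, j] > 0 \<longleftrightarrow> {vs ! i, vs ! j} \<in> E"
      "\<And>i. i < length vs \<Longrightarrow> nmem \<sigma> ''out'' [i] = 0"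
  shows "runs (mwis ((d - 1) + (d - 1) * (d - 1))) \<sigma> (mwis_time ((d - 1) + (d - 1) * (d - 1)) (length vs))
     (\<lambda>\<tau>. approx_independent_set (ratio_bound d) (set vs) E w (selected vs \<tau>))"
proof -
  let ?n = "length vs"
  have card2: "card e = 2" if "e \<in> E" for e using vs(2) that by (auto simp: simple_graph_def)
  interpret weighted_graph ?n "index_adj vs E" "\<lambda>i. w (vs ! i)"
  proof
    show "index_adj vs E i j \<Longrightarrow> index_adj vs E j i" for i j by (auto simp: index_adj_def insert_commute)
    show "\<not> index_adj vs E i i" for i using card2[of "{vs ! i}"] by (auto simp: index_adj_def)
    show "w (vs ! i) > 0" if "i < ?n" for i using that vs(4) by simp
  qed
  have inj: "inj_on (nth vs) {..<?n}" using vs(1) by (simp add: inj_on_nth)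
  \<comment> \<open>A vertex of \<open>B\<close> is near itself only. For any other vertex,
    \<open>d\<close> neighbours in \<open>B\<close> would be the talons of a \<open>d\<close>-claw;
    hence \<open>k = d - 1\<close>.\<close>
  have deg: "card {j \<in> B. j = i \<or> index_adj vs E i j} \<le> d - 1" if i: "i < ?n" and B: "indep B" for i B
  proof (cases "i \<in> B")
    case True
    then have "{j \<in> B. j = i \<or> index_adj vs E i j} = {i}" using B by (auto simp: indep_def)
    then show ?thesis using d by simp
  next
    case False
    show ?thesis
    proof (rule ccontr)
      assume "\<not> ?thesis"
      then have "d \<le> card {j \<in> B. j = i \<or> index_adj vs E i j}" by simp
      then obtain T where T: "T \<subseteq> {j \<in> B. j = i \<or> index_adj vs E i j}" "card T = d"
        using obtain_subset_with_card_n by metis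
      have Ti: "index_adj vs E i t" if "t \<in> T" for t
        using T False that by auto
      have T0: "T \<subseteq> B" using T by auto
      have Tn: "T \<subseteq> {..<?n}" using T0 B by (auto simp: indep_def)
      have fT: "finite T" using Tn finite_subset by blast
      let ?U = "insert (vs ! i) (nth vs ` T)"
      have neq: "vs ! i \<notin> nth vs ` T"
      proof
        assume "vs ! i \<in> nth vs ` T"
        then obtain t where "t \<in> T" "vs ! i = vs ! t" by auto
        then have "i = t" using inj i Tn by (auto simp: inj_on_def)
        then show False using \<open>t \<in> T\<close> T0 False by auto
      qed
      have "induced_edges E ?U = {{vs ! i, t} | t. t \<in> nth vs ` T}"
      proof (intro equalityI subsetI)
        fix e assume "e \<in> induced_edges E ?U"
        then have e: "e \<in> E" "e \<subseteq> ?U" by (auto simp: induced_edges_def)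
        obtain x y where xy: "e = {x, y}" "x \<noteq> y" using card2[OF e(1)] by (auto simp: card_2_iff)
        have "\<not> (x \<in> nth vs ` T \<and> y \<in> nth vs ` T)"
        proof
          assume "x \<in> nth vs ` T \<and> y \<in> nth vs ` T"
          then obtain s t where st: "s \<in> T" "t \<in> T" "x = vs ! s" "y = vs ! t" by auto
          then have "index_adj vs E s t" using e xy Tn by (auto simp: index_adj_def)
          then show False using st T0 B by (auto simp: indep_def)
        qed
        then show "e \<in> {{vs ! i, t} | t. t \<in> nth vs ` T}" using e(2) xy by (auto simp: insert_commute)
      next
        fix e assume "e \<in> {{vs ! i, t} | t. t \<in> nth vs ` T}"
        then obtain t where "t \<in> T" "e = {vs ! i, vs ! t}" by auto
        then show "e \<in> induced_edges E ?U" using Ti[of t] by (auto simp: induced_edges_def index_adj_def)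
      qed
      moreover have "card (nth vs ` T) = d" using T(2) inj Tn by (subst card_image) (auto intro: inj_on_subset)
      ultimately have "is_claw d ?U (induced_edges E ?U)"
        unfolding is_claw_def using neq fT by (intro exI[of _ "vs ! i"] exI[of _ "nth vs ` T"]) auto
      moreover have "?U \<subseteq> set vs" using i Tn by auto
      ultimately show False using vs(3) by (auto simp: claw_free_def)
    qed
  qed
  have k: "d - 1 > 0" using d by simp
  have "runs (mwis ((d - 1) + (d - 1) * (d - 1))) \<sigma> (mwis_time ((d - 1) + (d - 1) * (d - 1)) ?n)
    (\<lambda>\<tau>. indep (members ''out'' \<tau>) \<and> (\<forall>B. indep B \<longrightarrow>
      (\<Sum>i\<in>B. w (vs ! i)) \<le> ratio_bound d * (\<Sum>i\<in>members ''out'' \<tau>. w (vs ! i))))"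
  proof (rule runs_mwis)
    show "graph_state \<sigma>" using \<sigma> by (auto simp: graph_state_def index_adj_def)
    show "weight_state \<sigma>" using \<sigma> by (auto simp: weight_state_def)
    show "members ''out'' \<sigma> = {}" using \<sigma> by (auto simp: members_def)
    show "ratio_bound d \<ge> 3/2" by (rule ratio_bound_ge[OF d])
    show "(\<Sum>i\<in>B. real (p i)) \<le> ratio_bound d * (\<Sum>i\<in>A. real (p i))"
      if "indep A" "\<And>i. i \<in> A \<Longrightarrow> p i > 0" "locally_optimal ((d - 1) + (d - 1) * (d - 1)) p A"
        "indep B" "\<And>i. i \<in> B \<Longrightarrow> p i > 0" for p A B
      unfolding ratio_bound_def by (rule locally_optimal_ratio[OF k deg that])
  qed
  then show ?thesis
  proof (rule runs_conseq[OF _ order_refl])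
    fix \<tau> assume post: "indep (members ''out'' \<tau>) \<and> (\<forall>B. indep B \<longrightarrow>
      (\<Sum>i\<in>B. w (vs ! i)) \<le> ratio_bound d * (\<Sum>i\<in>members ''out'' \<tau>. w (vs ! i)))"
    have sel: "selected vs \<tau> = nth vs ` members ''out'' \<tau>" by (auto simp: selected_def members_def)
    have "independent_set (set vs) E (selected vs \<tau>)"
      unfolding sel independent_set_def using post by (auto simp: indep_def index_adj_def members_def)
    moreover have "sum w B \<le> ratio_bound d * sum w (selected vs \<tau>)" if "independent_set (set vs) E B" for B
    proof -
      let ?B = "{i. i < ?n \<and> vs ! i \<in> B}"
      have "indep ?B" using that by (auto simp: indep_def index_adj_def independent_set_def)
      then have "(\<Sum>i\<in>?B. w (vs ! i)) \<le> ratio_bound d * (\<Sum>i\<in>members ''out'' \<tau>. w (vs ! i))" using post by auto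
      moreover have "B = nth vs ` ?B"
      proof (intro equalityI subsetI)
        fix v assume "v \<in> B"
        moreover from this have "v \<in> set vs" using that by (auto simp: independent_set_def)
        ultimately show "v \<in> nth vs ` ?B" by (auto simp: in_set_conv_nth)
      qed auto
      moreover have "sum w (nth vs ` X) = (\<Sum>i\<in>X. w (vs ! i))" if "X \<subseteq> {..<?n}" for X
        using inj_on_subset[OF inj that] by (simp add: sum.reindex)
      ultimately show ?thesis
        using sel by (smt (verit) lessThan_iff mem_Collect_eq members_def subsetI)
    qed
    ultimately show "approx_independent_set (ratio_bound d) (set vs) E w (selected vs \<tau>)"
      by (auto simp: approx_independent_set_def max_weight_independent_set_def)
  qed
qed

section \<open>Conflict graphs of set packing instances\<close>

definition overlap :: com where
  "overlap = Seq (NSet ''f'' [] (NConst 0))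
     (For ''x'' (na ''card'' ''i'') (For ''y'' (na ''card'' ''j'')
       (Cond (eqb (NGet ''elem'' [nv ''i'', nv ''x'']) (NGet ''elem'' [nv ''j'', nv ''y'']))
         (NSet ''f'' [] (NConst 1)) Skip)))"

definition conflict_graph :: com where
  "conflict_graph = For ''i'' (nv ''n'') (For ''j'' (nv ''n'')
     (Cond (Neg (eqb (nv ''i'') (nv ''j'')))
       (Seq overlap (NSet ''adj'' [nv ''i'', nv ''j''] (nv ''f''))) Skip))"

lemma vars_overlap [simp]: "nvars overlap = {''f'', ''x'', ''y''}" "rvars overlap = {}"
  by (auto simp: overlap_def)

lemma vars_conflict_graph [simp]:
  "nvars conflict_graph = {''i'', ''j'', ''f'', ''x'', ''y'', ''adj''}" "rvars conflict_graph = {}"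
  by (auto simp: conflict_graph_def)

definition packing_state :: "nat list list \<Rightarrow> state \<Rightarrow> bool" where
  "packing_state xss \<sigma> \<longleftrightarrow> nmem \<sigma> ''n'' [] = length xss \<and>
     (\<forall>i<length xss. nmem \<sigma> ''card'' [i] = length (xss ! i) \<and>
        (\<forall>x<length (xss ! i). nmem \<sigma> ''elem'' [i, x] = xss ! i ! x))"

lemma packing_state_frame:
  "packing_state xss \<sigma> \<Longrightarrow> frame c \<sigma> \<tau> \<Longrightarrow> nvars c \<inter> {''n'', ''card'', ''elem''} = {} \<Longrightarrow> packing_state xss \<tau>"
  by (simp add: packing_state_def frame_nmem)

lemma common_element_iff:
  "set xs \<inter> set ys \<noteq> {} \<longleftrightarrow> (\<exists>x<length xs. \<exists>y<length ys. xs ! x = ys ! y)"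
proof
  assume "set xs \<inter> set ys \<noteq> {}"
  then obtain v where "v \<in> set xs" "v \<in> set ys" by auto
  then obtain x y where "x < length xs" "xs ! x = v" "y < length ys" "ys ! y = v"
    by (auto simp: in_set_conv_nth)
  then show "\<exists>x<length xs. \<exists>y<length ys. xs ! x = ys ! y" by metis
next
  assume "\<exists>x<length xs. \<exists>y<length ys. xs ! x = ys ! y"
  then obtain x y where xy: "x < length xs" "y < length ys" "xs ! x = ys ! y" by auto
  then have "xs ! x \<in> set xs" "xs ! x \<in> set ys" using nth_mem[of x xs] nth_mem[of y ys] by auto
  then show "set xs \<inter> set ys \<noteq> {}" by auto
qed

lemma runs_overlap:
  assumes p: "packing_state xss \<sigma>" and i: "nmem \<sigma> ''i'' [] = i" "i < length xss"
    and j: "nmem \<sigma> ''j'' [] = j" "j < length xss"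
    and L: "length (xss ! i) \<le> L" "length (xss ! j) \<le> L"
  shows "runs overlap \<sigma> (L * (4 * L + 5) + 4)
           (\<lambda>\<tau>. nmem \<tau> ''f'' [] > 0 \<longleftrightarrow> set (xss ! i) \<inter> set (xss ! j) \<noteq> {})"
  unfolding overlap_def
proof (rule runs_Seq)
  let ?xs = "xss ! i" and ?ys = "xss ! j"
  let ?c = "Cond (eqb (NGet ''elem'' [nv ''i'', nv ''x'']) (NGet ''elem'' [nv ''j'', nv ''y'']))
         (NSet ''f'' [] (NConst 1)) Skip"
  let ?Y = "For ''y'' (na ''card'' ''j'') ?c" and ?X = "For ''x'' (na ''card'' ''i'') (For ''y'' (na ''card'' ''j'') ?c)"
  let ?P = "\<lambda>x. \<exists>x'<x. \<exists>y<length ?ys. ?xs ! x' = ?ys ! y"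
  show "runs (NSet ''f'' [] (NConst 0)) \<sigma> 1 (\<lambda>\<tau>. \<tau> = setn ''f'' [] 0 \<sigma>)" by (intro runs_step) auto
  fix \<tau> assume \<tau>: "\<tau> = setn ''f'' [] 0 \<sigma>"
  have p': "packing_state xss \<tau>" "nmem \<tau> ''i'' [] = i" "nmem \<tau> ''j'' [] = j"
    using p i j by (auto simp: \<tau> packing_state_def)
  let ?I = "\<lambda>x \<tau>. nmem \<tau> ''f'' [] > 0 \<longleftrightarrow> ?P x"
  have "runs ?X \<tau> (L * (4 * L + 5) + 3) (?I (length ?xs))"
  proof (rule runs_For[where I = ?I and m = "length ?xs" and T = "4 * L + 3"])
    fix x \<tau>1 assume x: "x < length ?xs" "nmem \<tau>1 ''x'' [] = x" and I: "?I x \<tau>1" and fr1: "frame ?X \<tau> \<tau>1"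
    have 1: "packing_state xss \<tau>1" "nmem \<tau>1 ''i'' [] = i" "nmem \<tau>1 ''j'' [] = j"
      using packing_state_frame[OF p'(1) fr1] frame_nmem[OF fr1] p' by auto
    let ?J = "\<lambda>y \<tau>. nmem \<tau> ''f'' [] > 0 \<longleftrightarrow> ?P x \<or> (\<exists>y'<y. ?xs ! x = ?ys ! y')"
    have "runs ?Y \<tau>1 (4 * L + 3) (?J (length ?ys))"
    proof (rule runs_For[where I = ?J and m = "length ?ys" and T = 2])
      fix y \<tau>2 assume y: "y < length ?ys" "nmem \<tau>2 ''y'' [] = y" and J: "?J y \<tau>2" and fr2: "frame ?Y \<tau>1 \<tau>2"
      have 2: "packing_state xss \<tau>2" "nmem \<tau>2 ''i'' [] = i" "nmem \<tau>2 ''j'' [] = j" "nmem \<tau>2 ''x'' [] = x"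
        using packing_state_frame[OF 1(1) fr2] frame_nmem[OF fr2] 1 x by auto
      have "nmem \<tau>2 ''elem'' [i, x] = ?xs ! x" "nmem \<tau>2 ''elem'' [j, y] = ?ys ! y"
        using 2(1) i j x y by (auto simp: packing_state_def)
      then show "runs ?c \<tau>2 2 (\<lambda>\<tau>'. ?J (Suc y) (setn ''y'' [] (Suc y) \<tau>'))"
        using J 2 y by (intro runs_step) (auto simp: less_Suc_eq)
    next
      show "neval \<tau>' (na ''card'' ''j'') = length ?ys" if "frame ?Y \<tau>1 \<tau>'" for \<tau>'
        using packing_state_frame[OF 1(1) that] frame_nmem[OF that, of "''j''"] 1 j by (auto simp: packing_state_def)
    qed (use I L in auto)
    then show "runs ?Y \<tau>1 (4 * L + 3) (\<lambda>\<tau>'. ?I (Suc x) (setn ''x'' [] (Suc x) \<tau>'))"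
      by (rule runs_conseq) (auto simp: less_Suc_eq)
  next
    show "neval \<tau>' (na ''card'' ''i'') = length ?xs" if "frame ?X \<tau> \<tau>'" for \<tau>'
      using packing_state_frame[OF p'(1) that] frame_nmem[OF that, of "''i''"] p' i by (auto simp: packing_state_def)
    have "4 * L + 3 + 2 = 4 * L + 5" by simp
    then show "length ?xs * (4 * L + 3 + 2) + 3 \<le> L * (4 * L + 5) + 3"
      using L(1) by (simp only: add_le_cancel_right mult_le_mono1)
  qed (use \<tau> in auto)
  then show "runs ?X \<tau> (L * (4 * L + 5) + 3) (\<lambda>\<tau>. nmem \<tau> ''f'' [] > 0 \<longleftrightarrow> set ?xs \<inter> set ?ys \<noteq> {})"
    unfolding common_element_iff by (rule runs_conseq) auto
qed simp

lemma runs_conflict_graph: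
  assumes p: "packing_state xss \<sigma>" and adj: "\<And>i j. nmem \<sigma> ''adj'' [i, j] = 0"
    and L: "\<And>xs. xs \<in> set xss \<Longrightarrow> length xs \<le> L" "length xss \<le> L"
  shows "runs conflict_graph \<sigma> (L * (L * (L * (4 * L + 5) + 8) + 5) + 3)
     (\<lambda>\<tau>. \<forall>i<length xss. \<forall>j<length xss.
        nmem \<tau> ''adj'' [i, j] > 0 \<longleftrightarrow> i \<noteq> j \<and> set (xss ! i) \<inter> set (xss ! j) \<noteq> {})"
proof -
  let ?n = "length xss"
  let ?Q = "\<lambda>i j. i \<noteq> j \<and> set (xss ! i) \<inter> set (xss ! j) \<noteq> {}"
  let ?b = "Cond (Neg (eqb (nv ''i'') (nv ''j'')))
       (Seq overlap (NSet ''adj'' [nv ''i'', nv ''j''] (nv ''f''))) Skip"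
  let ?Y = "For ''j'' (nv ''n'') ?b" and ?X = "For ''i'' (nv ''n'') (For ''j'' (nv ''n'') ?b)"
  let ?t = "L * (4 * L + 5) + 6"
  let ?I = "\<lambda>k \<tau>. \<forall>i j. i < ?n \<and> j < ?n \<longrightarrow> (nmem \<tau> ''adj'' [i, j] > 0 \<longleftrightarrow> i < k \<and> ?Q i j)"
  have Li: "length (xss ! i) \<le> L" if "i < ?n" for i using L(1) that by simp
  have "runs ?X \<sigma> (L * (L * (L * (4 * L + 5) + 8) + 5) + 3) (?I ?n)"
  proof (rule runs_For[where I = ?I and m = ?n and T = "L * (?t + 2) + 3"])
    fix i \<tau>1 assume i: "i < ?n" "nmem \<tau>1 ''i'' [] = i" and I: "?I i \<tau>1" and fr1: "frame ?X \<sigma> \<tau>1"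
    have 1: "packing_state xss \<tau>1" using packing_state_frame[OF p fr1] by simp
    let ?J = "\<lambda>k \<tau>. \<forall>i' j. i' < ?n \<and> j < ?n \<longrightarrow>
      (nmem \<tau> ''adj'' [i', j] > 0 \<longleftrightarrow> (i' < i \<or> i' = i \<and> j < k) \<and> ?Q i' j)"
    have "runs ?Y \<tau>1 (L * (?t + 2) + 3) (?J ?n)"
    proof (rule runs_For[where I = ?J and m = ?n and T = ?t])
      fix j \<tau>2 assume j: "j < ?n" "nmem \<tau>2 ''j'' [] = j" and J: "?J j \<tau>2" and fr2: "frame ?Y \<tau>1 \<tau>2"
      have 2: "packing_state xss \<tau>2" "nmem \<tau>2 ''i'' [] = i"
        using packing_state_frame[OF 1 fr2] frame_nmem[OF fr2] i by auto
      show "runs ?b \<tau>2 ?t (\<lambda>\<tau>'. ?J (Suc j) (setn ''j'' [] (Suc j) \<tau>'))"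
      proof (rule runs_Cond)
        assume "beval \<tau>2 (Neg (eqb (nv ''i'') (nv ''j'')))"
        then have ij: "i \<noteq> j" using 2 j by simp
        show "runs (Seq overlap (NSet ''adj'' [nv ''i'', nv ''j''] (nv ''f''))) \<tau>2 (L * (4 * L + 5) + 5)
           (\<lambda>\<tau>'. ?J (Suc j) (setn ''j'' [] (Suc j) \<tau>'))"
        proof (rule runs_Seq[OF runs_overlap[OF 2 i(1) j(2,1) Li[OF i(1)] Li[OF j(1)]]])
          fix \<tau>3 assume f: "nmem \<tau>3 ''f'' [] > 0 \<longleftrightarrow> set (xss ! i) \<inter> set (xss ! j) \<noteq> {}"
            and fr3: "frame overlap \<tau>2 \<tau>3"
          have "nmem \<tau>3 ''i'' [] = i" "nmem \<tau>3 ''j'' [] = j" "nmem \<tau>3 ''adj'' = nmem \<tau>2 ''adj''"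
            using frame_nmem[OF fr3] 2 j by auto
          then show "runs (NSet ''adj'' [nv ''i'', nv ''j''] (nv ''f'')) \<tau>3 1
             (\<lambda>\<tau>'. ?J (Suc j) (setn ''j'' [] (Suc j) \<tau>'))"
            using J f ij by (intro runs_step) (auto simp: less_Suc_eq)
        qed simp
      next
        assume "\<not> beval \<tau>2 (Neg (eqb (nv ''i'') (nv ''j'')))"
        then have "i = j" using 2 j by simp
        then show "runs Skip \<tau>2 (L * (4 * L + 5) + 5) (\<lambda>\<tau>'. ?J (Suc j) (setn ''j'' [] (Suc j) \<tau>'))"
          using J by (intro runs_step) (auto simp: less_Suc_eq)
      qed simp
    next
      show "neval \<tau>' (nv ''n'') = ?n" if "frame ?Y \<tau>1 \<tau>'" for \<tau>'
        using packing_state_frame[OF 1 that] by (simp add: packing_state_def)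
      show "?n * (?t + 2) + 3 \<le> L * (?t + 2) + 3" using L(2) by (intro add_mono mult_right_mono) auto
    qed (use I in auto)
    then show "runs ?Y \<tau>1 (L * (?t + 2) + 3) (\<lambda>\<tau>'. ?I (Suc i) (setn ''i'' [] (Suc i) \<tau>'))"
      by (rule runs_conseq) (auto simp: less_Suc_eq)
  next
    show "neval \<tau>' (nv ''n'') = ?n" if "frame ?X \<sigma> \<tau>'" for \<tau>'
      using packing_state_frame[OF p that] by (simp add: packing_state_def)
    have "L * (?t + 2) + 3 + 2 = L * (L * (4 * L + 5) + 8) + 5" by simp
    then show "?n * (L * (?t + 2) + 3 + 2) + 3 \<le> L * (L * (L * (4 * L + 5) + 8) + 5) + 3"
      using L(2) by (simp only: add_le_cancel_right mult_le_mono1)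
  qed (use adj in auto)
  then show ?thesis unfolding conflict_graph_def by (rule runs_conseq) auto
qed

text \<open>The talons are pairwise disjoint and all meet the center, so choosing common elements
  injects them into a set of at most \<open>d - 1\<close> elements.\<close>

lemma claw_free_conflict_edges:
  assumes fin: "\<And>s. s \<in> S \<Longrightarrow> finite s" and k: "\<And>s. s \<in> S \<Longrightarrow> card s \<le> d - 1" and d: "d \<ge> 2"
  shows "claw_free d S (conflict_edges S)"
  unfolding claw_free_def
proof (intro allI impI notI)
  fix U assume U: "U \<subseteq> S" and "is_claw d U (induced_edges (conflict_edges S) U)"
  then obtain z T where c: "z \<notin> T" "finite T" "card T = d" "U = insert z T"
    "induced_edges (conflict_edges S) U = {{z, t} | t. t \<in> T}" by (auto simp: is_claw_def)
  have z: "z \<in> S" and TS: "T \<subseteq> S" using U c by auto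
  have meet: "z \<inter> t \<noteq> {}" if t: "t \<in> T" for t
  proof -
    have "{z, t} \<in> induced_edges (conflict_edges S) U" unfolding c(5) using t by auto
    then have "{z, t} \<in> conflict_edges S" by (simp add: induced_edges_def)
    then obtain x y where "{z, t} = {x, y}" "x \<inter> y \<noteq> {}" unfolding conflict_edges_def by blast
    then show ?thesis by (auto simp: doubleton_eq_iff)
  qed
  have disj: "s \<inter> t = {}" if st: "s \<in> T" "t \<in> T" "s \<noteq> t" for s t
  proof (rule ccontr)
    assume "s \<inter> t \<noteq> {}"
    then have "{s, t} \<in> conflict_edges S" using st TS unfolding conflict_edges_def by blast
    then have "{s, t} \<in> induced_edges (conflict_edges S) U" using st c(4) by (auto simp: induced_edges_def)
    then obtain t' where "{s, t} = {z, t'}" unfolding c(5) by auto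
    then show False using st c(1) by (auto simp: doubleton_eq_iff)
  qed
  define h where "h = (\<lambda>t. SOME x. x \<in> z \<inter> t)"
  have h: "h t \<in> z \<inter> t" if "t \<in> T" for t
    unfolding h_def some_in_eq by (rule meet[OF that])
  have "inj_on h T"
  proof (rule inj_onI)
    fix s t assume "s \<in> T" "t \<in> T" "h s = h t"
    then have "h s \<in> s \<inter> t" using h[of s] h[of t] by auto
    then show "s = t" using disj[OF \<open>s \<in> T\<close> \<open>t \<in> T\<close>] by auto
  qed
  then have "card T \<le> card z" using h fin[OF z] by (intro card_inj_on_le[of h]) auto
  then show False using c(3) k[OF z] d by simp
qed

section \<open>Polynomial and quasi-polynomial bounds\<close>

text \<open>Not asymptotic: the bound holds for all \<open>n\<close>, passes to sums and products,
  and its monomial is monotone, so a bound in the number of vertices carries over to the input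
  size.\<close>

definition poly_bounded :: "(nat \<Rightarrow> nat) \<Rightarrow> bool" where
  "poly_bounded f \<longleftrightarrow> (\<exists>C q. \<forall>n. f n \<le> C * (n + 1) ^ q)"

lemma poly_bounded_const: "poly_bounded (\<lambda>n. c)"
  unfolding poly_bounded_def by (intro exI[of _ c] exI[of _ 0]) auto

lemma poly_bounded_id: "poly_bounded (\<lambda>n. n)"
  unfolding poly_bounded_def by (intro exI[of _ 1]) auto

lemma poly_bounded_add:
  assumes "poly_bounded f" "poly_bounded g" shows "poly_bounded (\<lambda>n. f n + g n)"
proof -
  obtain C q D r where b: "\<And>n. f n \<le> C * (n + 1) ^ q" "\<And>n. g n \<le> D * (n + 1) ^ r"
    using assms unfolding poly_bounded_def by auto
  have "f n + g n \<le> (C + D) * (n + 1) ^ (q + r)" for n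
  proof -
    have "C * (n + 1) ^ q \<le> C * (n + 1) ^ (q + r)" "D * (n + 1) ^ r \<le> D * (n + 1) ^ (q + r)"
      by (intro mult_left_mono power_increasing; simp)+
    with b[of n] show ?thesis unfolding distrib_right by (meson add_mono le_trans)
  qed
  then show ?thesis unfolding poly_bounded_def by blast
qed

lemma poly_bounded_mult:
  assumes "poly_bounded f" "poly_bounded g" shows "poly_bounded (\<lambda>n. f n * g n)"
proof -
  obtain C q D r where b: "\<And>n. f n \<le> C * (n + 1) ^ q" "\<And>n. g n \<le> D * (n + 1) ^ r"
    using assms unfolding poly_bounded_def by auto
  have "f n * g n \<le> (C * D) * (n + 1) ^ (q + r)" for n
    using mult_mono[OF b(1)[of n] b(2)[of n]] by (simp add: power_add mult_ac)
  then show ?thesis unfolding poly_bounded_def by blast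
qed

lemma poly_bounded_monomial: "poly_bounded (\<lambda>n. C * (n + 1) ^ q)"
  unfolding poly_bounded_def by (intro exI[of _ C] exI[of _ q] allI order_refl)

lemmas poly_bounded_intros = poly_bounded_const poly_bounded_id poly_bounded_add poly_bounded_mult

lemma poly_bounded_loops_time: "poly_bounded (loops_time m)"
proof (induction m)
  case 0
  have "loops_time 0 = (\<lambda>n. 13 * n + 13)" by auto
  then show ?case by (auto intro!: poly_bounded_intros)
next
  case (Suc m)
  have "loops_time (Suc m) = (\<lambda>n. n * (loops_time m n + 2) + 3)" by auto
  then show ?case using Suc by (auto intro!: poly_bounded_intros)
qed

lemma poly_bounded_mwis_time: "poly_bounded (mwis_time s)"
  unfolding mwis_time_def search_time_def power2_eq_square
  by (intro poly_bounded_intros poly_bounded_loops_time[of s, unfolded eta_contract_eq])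

lemma polynomial_bound_monomial: "polynomial_bound (\<lambda>n. C * (n + 1) ^ q)"
  unfolding polynomial_bound_def
proof (intro exI bigoI)
  show "\<forall>\<^sub>F n in sequentially. norm (real (C * (n + 1) ^ q)) \<le> real C * 2 ^ q * norm (real n ^ q)"
    using eventually_ge_at_top[of 1]
  proof eventually_elim
    case (elim n)
    have "(real n + 1) ^ q \<le> (2 * real n) ^ q" using elim by (intro power_mono) auto
    then have "real C * (real n + 1) ^ q \<le> real C * (2 * real n) ^ q" by (intro mult_left_mono) auto
    then show ?case by (simp add: power_mult_distrib mult.assoc add.commute)
  qed
qed

text \<open>Written as a power of 2, a polynomial has an exponent linear in the logarithm, so the
  square of the logarithm suffices.\<close>

lemma quasi_polynomial_bound_monomial: "quasi_polynomial_bound (\<lambda>n. C * (n + 1) ^ q)"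
  unfolding quasi_polynomial_bound_def
proof (intro exI[of _ 2])
  \<comment> \<open>The threshold gives \<open>l \<ge> C + 2 * q + 1\<close>, and then
    \<open>l\<^sup>2 \<ge> (C + 2 * q + 1) * l \<ge> C + q * (l + 1)\<close>.\<close>
  show "\<forall>\<^sub>F n in sequentially. real (C * (n + 1) ^ q) \<le> 2 powr (log 2 (real n))\<^sup>2"
    using eventually_ge_at_top[of "2 ^ (C + 2 * q + 1)"]
  proof eventually_elim
    case (elim n)
    define l where "l = log 2 (real n)"
    have "(2::nat) ^ (C + 2 * q + 1) \<ge> 1" by simp
    then have n: "n \<ge> 1" using elim by linarith
    have "real (2 ^ (C + 2 * q + 1)) \<le> real n" using elim by (simp only: of_nat_le_iff)
    then have "log 2 (2 ^ (C + 2 * q + 1)) \<le> l" unfolding l_def using n by (subst log_le_cancel_iff) auto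
    moreover have "log 2 ((2::real) ^ m) = m" for m by (simp add: log_nat_power)
    ultimately have "real (C + 2 * q + 1) \<le> l" by (simp only:)
    then have l: "real C + 2 * real q + 1 \<le> l" by simp
    have nl: "real n = 2 powr l" unfolding l_def using n by simp
    have "real C \<le> 2 ^ C" using less_exp[of C] by (simp add: of_nat_less_iff[symmetric] del: of_nat_less_iff)
    then have c: "real C \<le> 2 powr C" by (simp add: powr_realpow)
    have "(real n + 1) ^ q \<le> (2 * real n) ^ q" using n by (intro power_mono) auto
    then have "real C * (real n + 1) ^ q \<le> 2 powr C * (2 * real n) ^ q" using c by (intro mult_mono) auto
    then have "real (C * (n + 1) ^ q) \<le> 2 powr C * (2 * real n) ^ q" by (simp add: add.commute)
    also have "2 * real n = 2 powr (l + 1)" by (simp add: nl powr_add)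
    also have "(2 powr (l + 1)) ^ q = 2 powr (q * (l + 1))" by (simp add: powr_power mult.commute)
    also have "2 powr C * 2 powr (q * (l + 1)) = 2 powr (C + q * (l + 1))" by (simp add: powr_add)
    also have "\<dots> \<le> 2 powr l\<^sup>2"
    proof (intro powr_mono)
      have "real C \<le> real C * l" "real q \<le> real q * l" using l by (auto simp: mult_le_cancel_left1)
      moreover have "(real C + 2 * real q + 1) * l \<le> l * l" using l by (intro mult_right_mono) auto
      ultimately show "C + q * (l + 1) \<le> l\<^sup>2" using l by (simp add: power2_eq_square algebra_simps)
    qed simp
    finally show ?case by (simp add: l_def)
  qed
qed

lemma packing_size_ge:
  "length xss \<le> packing_size xss" "xs \<in> set xss \<Longrightarrow> length xs \<le> packing_size xss"
proof -
  have len: "length xs \<le> (\<Sum>x\<leftarrow>xs. 1 + floorlog 2 x)" for xs by (induction xs) auto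
  show "length xss \<le> packing_size xss" unfolding packing_size_def by (induction xss) auto
  show "xs \<in> set xss \<Longrightarrow> length xs \<le> packing_size xss" unfolding packing_size_def
    by (induction xss) (use len in \<open>auto intro: trans_le_add1 trans_le_add2 le_SucI\<close>)
qed

section \<open>The two algorithms and their guarantee\<close>

theorem mwis_claw_free:
  assumes d: "d \<ge> 3"
  shows "\<exists>c T. quasi_polynomial_bound T \<and> approximates_MWIS_claw_free c T d (ratio_bound d)"
proof -
  let ?s = "(d - 1) + (d - 1) * (d - 1)"
  obtain C q where T: "\<And>n. mwis_time ?s n \<le> C * (n + 1) ^ q"
    using poly_bounded_mwis_time[of ?s] by (auto simp: poly_bounded_def)
  have "approximates_MWIS_claw_free (mwis ?s) (\<lambda>n. C * (n + 1) ^ q) d (ratio_bound d)"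
    unfolding approximates_MWIS_claw_free_def
  proof (intro allI impI)
    fix vs :: "nat list" and E and w :: "nat \<Rightarrow> real"
    assume a: "distinct vs \<and> simple_graph (set vs) E \<and> claw_free d (set vs) E \<and> (\<forall>v\<in>set vs. w v > 0)"
    have "runs (mwis ?s) (graph_input vs E w) (mwis_time ?s (length vs))
       (\<lambda>\<tau>. approx_independent_set (ratio_bound d) (set vs) E w (selected vs \<tau>))"
      using a d by (intro runs_mwis_graph) (auto simp: graph_input_def)
    moreover have "mwis_time ?s (length vs) \<le> C * (graph_size (set vs) E + 1) ^ q"
    proof -
      have "length vs \<le> graph_size (set vs) E" using a by (simp add: graph_size_def distinct_card)
      then have "C * (length vs + 1) ^ q \<le> C * (graph_size (set vs) E + 1) ^ q"
        by (intro mult_left_mono power_mono) auto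
      then show ?thesis using T[of "length vs"] by (rule order_trans[rotated])
    qed
    ultimately show "\<exists>t \<tau>. exec (mwis ?s) (graph_input vs E w) t \<tau> \<and> t \<le> C * (graph_size (set vs) E + 1) ^ q \<and>
               approx_independent_set (ratio_bound d) (set vs) E w (selected vs \<tau>)"
      unfolding runs_def by (meson le_trans)
  qed
  then show ?thesis using quasi_polynomial_bound_monomial by blast
qed

theorem mwis_conflict_graph:
  assumes d: "d \<ge> 3"
  shows "\<exists>c T. polynomial_bound T \<and> approximates_MWIS_conflict_graph c T (d - 1) (ratio_bound d)"
proof -
  let ?s = "(d - 1) + (d - 1) * (d - 1)"
  obtain C q where T: "\<And>n. mwis_time ?s n \<le> C * (n + 1) ^ q"
    using poly_bounded_mwis_time[of ?s] by (auto simp: poly_bounded_def)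
  have "poly_bounded (\<lambda>L. (L * (L * (L * (4 * L + 5) + 8) + 5) + 3) + C * (L + 1) ^ q)"
    by (rule poly_bounded_add[OF _ poly_bounded_monomial]) (intro poly_bounded_intros)
  then obtain D r where D: "\<And>L. (L * (L * (L * (4 * L + 5) + 8) + 5) + 3) + C * (L + 1) ^ q \<le> D * (L + 1) ^ r"
    unfolding poly_bounded_def by auto
  have "approximates_MWIS_conflict_graph (Seq conflict_graph (mwis ?s)) (\<lambda>n. D * (n + 1) ^ r) (d - 1) (ratio_bound d)"
    unfolding approximates_MWIS_conflict_graph_def
  proof (intro allI impI)
    fix xss :: "nat list list" and S and w :: "nat set \<Rightarrow> real"
    assume a: "(\<forall>xs\<in>set xss. distinct xs) \<and> distinct (map set xss) \<and> S = set (map set xss) \<and>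
        (\<forall>s\<in>S. card s \<le> d - 1) \<and> (\<forall>s\<in>S. w s > 0)"
    let ?\<sigma> = "packing_input xss w" and ?L = "packing_size xss" and ?vs = "map set xss"
    let ?E = "conflict_edges S"
    have S: "S = set ?vs" and fS: "finite S" "\<And>s. s \<in> S \<Longrightarrow> finite s" using a by auto
    have sg: "simple_graph S ?E"
      using fS by (auto simp: simple_graph_def conflict_edges_def card_2_iff)
    have cf: "claw_free d S ?E" using fS a d by (intro claw_free_conflict_edges) auto
    have "runs (Seq conflict_graph (mwis ?s)) ?\<sigma> (D * (?L + 1) ^ r)
       (\<lambda>\<tau>. approx_independent_set (ratio_bound d) S ?E w (selected ?vs \<tau>))"
    proof (rule runs_Seq)
      show "runs conflict_graph ?\<sigma> (?L * (?L * (?L * (4 * ?L + 5) + 8) + 5) + 3) (\<lambda>\<tau>. \<forall>i<length xss. \<forall>j<length xss.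
        nmem \<tau> ''adj'' [i, j] > 0 \<longleftrightarrow> i \<noteq> j \<and> set (xss ! i) \<inter> set (xss ! j) \<noteq> {})"
        using packing_size_ge by (intro runs_conflict_graph) (auto simp: packing_state_def packing_input_def)
      fix \<tau> assume adj: "\<forall>i<length xss. \<forall>j<length xss.
        nmem \<tau> ''adj'' [i, j] > 0 \<longleftrightarrow> i \<noteq> j \<and> set (xss ! i) \<inter> set (xss ! j) \<noteq> {}"
        and fr: "frame conflict_graph ?\<sigma> \<tau>"
      have m: "nmem \<tau> ''n'' = nmem ?\<sigma> ''n''" "nmem \<tau> ''out'' = nmem ?\<sigma> ''out''" "rmem \<tau> ''w'' = rmem ?\<sigma> ''w''"
        using frame_nmem[OF fr] frame_rmem[OF fr] by auto
      have e: "{?vs ! i, ?vs ! j} \<in> ?E \<longleftrightarrow> i \<noteq> j \<and> set (xss ! i) \<inter> set (xss ! j) \<noteq> {}"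
        if ij: "i < length xss" "j < length xss" for i j
      proof -
        have "{?vs ! i, ?vs ! j} \<in> ?E \<longleftrightarrow> ?vs ! i \<noteq> ?vs ! j \<and> ?vs ! i \<inter> ?vs ! j \<noteq> {}"
        proof
          assume "{?vs ! i, ?vs ! j} \<in> ?E"
          then obtain s t where "{?vs ! i, ?vs ! j} = {s, t}" "s \<noteq> t" "s \<inter> t \<noteq> {}"
            unfolding conflict_edges_def by blast
          then show "?vs ! i \<noteq> ?vs ! j \<and> ?vs ! i \<inter> ?vs ! j \<noteq> {}" by (auto simp: doubleton_eq_iff)
        next
          assume "?vs ! i \<noteq> ?vs ! j \<and> ?vs ! i \<inter> ?vs ! j \<noteq> {}"
          moreover have "?vs ! i \<in> S" "?vs ! j \<in> S" unfolding S using ij by (intro nth_mem; simp)+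
          ultimately show "{?vs ! i, ?vs ! j} \<in> ?E" unfolding conflict_edges_def by blast
        qed
        \<comment> \<open>The list presents every set once, so the program may compare positions in
          place of sets.\<close>
        moreover have "?vs ! i = ?vs ! j \<longleftrightarrow> i = j" using a ij by (intro nth_eq_iff_index_eq) auto
        ultimately show ?thesis using ij by simp
      qed
      have "runs (mwis ?s) \<tau> (mwis_time ?s (length ?vs))
         (\<lambda>\<tau>. approx_independent_set (ratio_bound d) (set ?vs) ?E w (selected ?vs \<tau>))"
      proof (rule runs_mwis_graph)
        show "nmem \<tau> ''adj'' [i, j] > 0 \<longleftrightarrow> {?vs ! i, ?vs ! j} \<in> ?E"
          if "i < length ?vs" "j < length ?vs" for i j using that adj e[of i j] by simp
      qed (use a sg cf d m S in \<open>auto simp: packing_input_def\<close>)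
      then show "runs (mwis ?s) \<tau> (mwis_time ?s (length ?vs))
         (\<lambda>\<tau>. approx_independent_set (ratio_bound d) S ?E w (selected ?vs \<tau>))" using S by simp
    next
      have "C * (length xss + 1) ^ q \<le> C * (?L + 1) ^ q"
        using packing_size_ge(1)[of xss] by (intro mult_left_mono power_mono) auto
      with T[of "length xss"] have "mwis_time ?s (length ?vs) \<le> C * (?L + 1) ^ q"
        unfolding length_map by (rule order_trans)
      then show "(?L * (?L * (?L * (4 * ?L + 5) + 8) + 5) + 3) + mwis_time ?s (length ?vs) \<le> D * (?L + 1) ^ r"
        by (rule order_trans[OF add_left_mono D])
    qed
    then show "\<exists>t \<tau>. exec (Seq conflict_graph (mwis ?s)) ?\<sigma> t \<tau> \<and> t \<le> D * (?L + 1) ^ r \<and>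
               approx_independent_set (ratio_bound d) S ?E w (selected ?vs \<tau>)"
      by (simp add: runs_def)
  qed
  then show ?thesis using polynomial_bound_monomial by blast
qed

theorem theorem1:
  "\<exists>\<epsilon> :: nat \<Rightarrow> real.
     (\<forall>d\<ge>3. 0 \<le> \<epsilon> d \<and> \<epsilon> d \<le> 1) \<and>
     \<epsilon> \<longlonglongrightarrow> 0 \<and>
     (\<forall>d\<ge>3.
        (\<exists>c T. quasi_polynomial_bound T \<and>
               approximates_MWIS_claw_free c T d ((real d - 1 + \<epsilon> d) / 2)) \<and>
        (\<exists>c T. polynomial_bound T \<and>
               approximates_MWIS_conflict_graph c T (d - 1) ((real d - 1 + \<epsilon> d) / 2)))"
proof -
  define \<epsilon> :: "nat \<Rightarrow> real" where "\<epsilon> = (\<lambda>d. min 1 (152 * real (d - 1) powr (-1/3)))"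
  have "(\<lambda>d. real (d - 1) powr (-1/3)) \<longlonglongrightarrow> 0"
  proof (rule tendsto_neg_powr)
    have "filterlim (\<lambda>d. d - 1) at_top (at_top :: nat filter)"
      unfolding filterlim_at_top
    proof
      fix Z :: nat
      show "\<forall>\<^sub>F d in at_top. Z \<le> d - 1" using eventually_ge_at_top[of "Suc Z"] by eventually_elim simp
    qed
    then show "filterlim (\<lambda>d. real (d - 1)) at_top sequentially"
      by (rule filterlim_compose[OF filterlim_real_sequentially])
  qed simp
  then have "(\<lambda>d. 152 * real (d - 1) powr (-1/3)) \<longlonglongrightarrow> 152 * 0" by (rule tendsto_mult_left)
  then have "(\<lambda>d. min 1 (152 * real (d - 1) powr (-1/3))) \<longlonglongrightarrow> min 1 (152 * 0)"
    by (intro tendsto_min tendsto_const)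
  then have "\<epsilon> \<longlonglongrightarrow> 0" unfolding \<epsilon>_def by (simp only: mult_zero_right min_def) simp
  moreover have "0 \<le> \<epsilon> d \<and> \<epsilon> d \<le> 1" for d by (simp add: \<epsilon>_def)
  moreover have "(real d - 1 + \<epsilon> d) / 2 = ratio_bound d" if "d \<ge> 3" for d
    using that by (simp add: \<epsilon>_def ratio_bound_def of_nat_diff)
  ultimately show ?thesis
    using mwis_claw_free mwis_conflict_graph by (intro exI[of _ \<epsilon>]) auto
qed

end
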